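(* Let $B_n$ be the comparability graph of $2^{[n]}$, i.e. the graph with vertex set $2^{[n]}$ in which distinct $x,y$ are adjacent iff $x\subset y$ or $y\subset x$. Let $G$ be a subgraph of $B_n$ with $V(G)=2^{[n]}$ such that $G$ has no independent set of size larger than $\binom{n}{\lfloor n/2\rfloor}$, and with the minimum number of edges among all such subgraphs. Then $|E(G)|=\left(\sqrt{\frac{\pi}{8}}+o(1)\right)2^{n}\sqrt{n}$ as $n\to\infty$.
   Context: $2^{[n]}$ denotes the family of all subsets of $[n]=\{1,\dots,n\}$. *)

theory Defs
  imports Complex_Main "HOL-Library.Landau_Symbols"
begin

record 'a graph =
  verts :: "'a set"
  edges :: "'a set set"

definition subgraph :: "'a graph \<Rightarrow> 'a graph \<Rightarrow> bool" where
  "subgraph H G \<longleftrightarrow>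
     verts H \<subseteq> verts G \<and> edges H \<subseteq> edges G \<and> (\<forall>e\<in>edges H. e \<subseteq> verts H)"

definition independent_set :: "'a graph \<Rightarrow> 'a set \<Rightarrow> bool" where
  "independent_set G S \<longleftrightarrow>
     S \<subseteq> verts G \<and> (\<forall>x\<in>S. \<forall>y\<in>S. x \<noteq> y \<longrightarrow> {x, y} \<notin> edges G)"

definition comparability_graph :: "nat \<Rightarrow> nat set graph" where
  "comparability_graph n =
     \<lparr>verts = Pow {1..n},
      edges = {{x, y} | x y. x \<in> Pow {1..n} \<and> y \<in> Pow {1..n} \<and> x \<noteq> y \<and> (x \<subseteq> y \<or> y \<subseteq> x)}\<rparr>"

definition sperner_subgraph :: "nat \<Rightarrow> nat set graph \<Rightarrow> bool" where
  "sperner_subgraph n G \<longleftrightarrow>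
     subgraph G (comparability_graph n) \<and> verts G = Pow {1..n} \<and>
     (\<forall>S. independent_set G S \<longrightarrow> card S \<le> n choose (n div 2))"

definition min_sperner_subgraph :: "nat \<Rightarrow> nat set graph \<Rightarrow> bool" where
  "min_sperner_subgraph n G \<longleftrightarrow> is_arg_min (\<lambda>H. card (edges H)) (sperner_subgraph n) G"

end

theory Submission
  imports Defs "HOL-Analysis.Gamma_Function" "HOL-Real_Asymp.Real_Asymp"
begin

text \<open>
  The lower bound is Turan's theorem (in the form of Caro and Wei) for independence number
  $N = {n \choose \lfloor n/2 \rfloor}$, together with $2^n/N \sim \sqrt{\pi n/2}$, which comes from
  Wallis' product.

  For the upper bound it suffices to partition $2^{[n]}$ into exactly $N$ chains almost all of which
  have length at most $(1+o(1))2^n/N$; the graph then consists of the pairs inside the chains. By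
  complementation one may treat only the levels from the middle upwards, where a chain
  partition is an injective map sending every set above the bottom level to a proper subset.

  Cut these levels into phases of height $h = \delta\sqrt n$, starting at the levels \<open>rung r h i\<close>.
  A chain has one of $M$ colours, and phase $i$ is covered by the chains with colours in
  a set $G_i$ whose size is proportional to the first level of the phase; cyclic
  intervals as $G_i$ make every colour active for about the same number of phases. Within a phase,
  consecutive levels are matched regardless of colours. Chains that end inside a phase, because
  the levels shrink, must be reusable later; hence they have to end at places that are spread
  evenly. So a random set of sets (the droppers) is kept free by the matchings, and the first
  level of each phase is coloured at random. If all local densities are close to their expectations, a
  fractional matching with uniform weights and Hall's theorem attach the first level of
  each phase to ends of earlier chains of the same colour. The local densities cannot be controlled
  by a union bound, since adjacent levels have degrees of order $n$ only; the local
  lemma is used instead.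
\<close>

section \<open>Matchings and random colourings\<close>

text \<open>Disjoint cliques on chains have about half the sum of the squared chain lengths as
  edges, so by convexity the lengths must be nearly equal. Symmetric chain decompositions fail here:
  their lengths vary on the scale of \<open>sqrt n\<close>, and their mean square exceeds the
  squared mean by an asymptotic factor 4/\<pi>. A chain that reaches high levels therefore has to
  skip others on the way, and the inactive phases of its colour are where it skips. If a_i is the
  size of the first level of phase i and \<open>card (G i)\<close> is proportional to a_i, then
  every colour is active on about h (a_0 + a_1 + ...)/a_0 levels, which is about half of 2^n/N. The
  constant: both bounds are 2^n/2 times the mean chain length 2^n/N, and sqrt(\<pi>/2)/2 =
  sqrt(\<pi>/8). All parameters are fixed before n grows. The loss per phase depends on \<beta>
  only, and the number of phases does not depend on n, so \<beta> can be chosen to make the total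
  loss negligible.\<close>

theorem hall_marriage:
  fixes A :: "'a \<Rightarrow> 'b set"
  assumes "finite Y" "\<And>y. y \<in> Y \<Longrightarrow> finite (A y)"
    and "\<And>S. S \<subseteq> Y \<Longrightarrow> card S \<le> card (\<Union> (A ` S))"
  shows "\<exists>f. inj_on f Y \<and> (\<forall>y\<in>Y. f y \<in> A y)"
  using assms
proof (induction "\<Sum>y\<in>Y. card (A y)" arbitrary: A rule: less_induct)
  case less
  note fin = less.prems(1) and finA = less.prems(2) and hall = less.prems(3)
  show ?case
  proof (cases "\<exists>y\<in>Y. \<exists>x1\<in>A y. \<exists>x2\<in>A y. x1 \<noteq> x2")
    case False
    have "\<exists>x. A y = {x}" if "y \<in> Y" for y
    proof -
      have "1 \<le> card (A y)" using hall[of "{y}"] that by simp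
      then have "A y \<noteq> {}" by auto
      then show ?thesis using False that by blast
    qed
    then obtain f where f: "\<And>y. y \<in> Y \<Longrightarrow> A y = {f y}" by metis
    have "inj_on f Y"
    proof (rule inj_onI, rule ccontr)
      fix y z assume yz: "y \<in> Y" "z \<in> Y" "f y = f z" "y \<noteq> z"
      have "card {y, z} \<le> card (\<Union> (A ` {y, z}))" using yz by (intro hall) auto
      then show False using yz f[of y] f[of z] by simp
    qed
    then show ?thesis using f by auto
  next
    case True
    then obtain y0 x1 x2 where y0: "y0 \<in> Y" "x1 \<in> A y0" "x2 \<in> A y0" "x1 \<noteq> x2" by blast
    \<comment> \<open>Rado's argument: if y0 has two candidates, then deleting one of them preserves
      Hall's condition, and the induction applies to the smaller family.\<close>
    define B where "B x = A(y0 := A y0 - {x})" for x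
    have finB: "finite (B x y)" if "y \<in> Y" for x y
      using finA[OF that] finA[OF y0(1)] by (simp add: B_def)
    have smaller: "(\<Sum>y\<in>Y. card (B x y)) < (\<Sum>y\<in>Y. card (A y))" if "x \<in> A y0" for x
    proof (rule sum_strict_mono_ex1[OF fin])
      show "\<forall>y\<in>Y. card (B x y) \<le> card (A y)"
        using finA by (auto simp: B_def intro!: card_mono)
      show "\<exists>y\<in>Y. card (B x y) < card (A y)"
        using card_Diff1_less[OF finA[OF y0(1)] that] y0(1)
        by (intro bexI[of _ y0]) (simp_all add: B_def del: card_Diff_singleton)
    qed
    have step: ?thesis if "x \<in> A y0" "\<And>S. S \<subseteq> Y \<Longrightarrow> card S \<le> card (\<Union> (B x ` S))" for x
    proof -
      have "\<exists>f. inj_on f Y \<and> (\<forall>y\<in>Y. f y \<in> B x y)"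
        by (rule less.hyps[OF smaller[OF that(1)] fin finB that(2)])
      then obtain f where "inj_on f Y" "\<forall>y\<in>Y. f y \<in> B x y" by blast
      then show ?thesis by (intro exI[of _ f]) (auto simp: B_def split: if_splits)
    qed
    show ?thesis
    proof (rule ccontr)
      assume no: "\<not> ?thesis"
      have viol: "\<exists>S. S \<subseteq> Y - {y0} \<and> card (\<Union> (A ` S) \<union> (A y0 - {x})) \<le> card S" if x: "x \<in> A y0" for x
      proof -
        obtain S where S: "S \<subseteq> Y" "card (\<Union> (B x ` S)) < card S"
          using step[OF x] no by (meson not_le)
        have "y0 \<in> S"
        proof (rule ccontr)
          assume "y0 \<notin> S"
          then have "B x ` S = A ` S" by (auto simp: B_def)
          then show False using hall[OF S(1)] S(2) by simp
        qed
        then have "\<Union> (B x ` S) = \<Union> (A ` (S - {y0})) \<union> (A y0 - {x})"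
          by (auto simp: B_def split: if_splits)
        moreover have "card (S - {y0}) = card S - 1"
          using \<open>y0 \<in> S\<close> by simp
        ultimately show ?thesis using S by (intro exI[of _ "S - {y0}"]) auto
      qed
      obtain S1 where S1: "S1 \<subseteq> Y - {y0}" "card (\<Union> (A ` S1) \<union> (A y0 - {x1})) \<le> card S1"
        using viol[OF y0(2)] by blast
      obtain S2 where S2: "S2 \<subseteq> Y - {y0}" "card (\<Union> (A ` S2) \<union> (A y0 - {x2})) \<le> card S2"
        using viol[OF y0(3)] by blast
      \<comment> \<open>S1 and S2 witness that both deletions fail. As x1 and x2 differ, P and Q
        together contain all of \<open>A y0\<close>, so Hall's condition for
        \<open>insert y0 (S1 \<union> S2)\<close> gains one over \<open>S1 \<union> S2\<close>.
        Adding the condition for \<open>S1 \<inter> S2\<close> contradicts the smallness of P and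
        Q.\<close>
      define P where "P = \<Union> (A ` S1) \<union> (A y0 - {x1})"
      define Q where "Q = \<Union> (A ` S2) \<union> (A y0 - {x2})"
      have finS: "finite S1" "finite S2" using S1 S2 fin finite_subset by blast+
      have finPQ: "finite P" "finite Q"
        using S1 S2 finS finA y0(1) unfolding P_def Q_def by (auto intro!: finite_UN_I)
      have "insert y0 (S1 \<union> S2) \<subseteq> Y" using S1 S2 y0 by blast
      then have "card (insert y0 (S1 \<union> S2)) \<le> card (\<Union> (A ` (insert y0 (S1 \<union> S2))))" by (rule hall)
      also have "\<Union> (A ` (insert y0 (S1 \<union> S2))) = P \<union> Q" using y0 by (auto simp: P_def Q_def)
      finally have 1: "card (S1 \<union> S2) + 1 \<le> card (P \<union> Q)"
        using S1 S2 finS by (subst (asm) card_insert_disjoint) auto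
      have "card (S1 \<inter> S2) \<le> card (\<Union> (A ` (S1 \<inter> S2)))" using S1 by (intro hall) auto
      also have "\<dots> \<le> card (P \<inter> Q)" using finPQ by (intro card_mono) (auto simp: P_def Q_def)
      finally have 2: "card (S1 \<inter> S2) \<le> card (P \<inter> Q)" .
      have "card (S1 \<union> S2) + card (S1 \<inter> S2) = card S1 + card S2"
        using card_Un_Int[OF finS] by simp
      moreover have "card (P \<union> Q) + card (P \<inter> Q) = card P + card Q"
        using card_Un_Int[OF finPQ] by simp
      moreover have "card P \<le> card S1" "card Q \<le> card S2" using S1 S2 by (auto simp: P_def Q_def)
      ultimately show False using 1 2 by linarith
    qed
  qed
qed

text \<open>Double counting yields Hall's condition: the weight at S is at least
  \<open>card S\<close>, all of it lies on the neighbourhood of S, and no point there carries more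
  than 1. With uniform weights both hypotheses become local degree counts.\<close>

corollary fractional_matching:
  fixes w :: "'b \<Rightarrow> 'a \<Rightarrow> real"
  assumes fin: "finite X" "finite Y"
    and nonneg: "\<And>x y. x \<in> X \<Longrightarrow> y \<in> Y \<Longrightarrow> 0 \<le> w x y"
    and cover: "\<And>y. y \<in> Y \<Longrightarrow> 1 \<le> (\<Sum>x\<in>X. w x y)"
    and load: "\<And>x. x \<in> X \<Longrightarrow> (\<Sum>y\<in>Y. w x y) \<le> 1"
  shows "\<exists>f. inj_on f Y \<and> (\<forall>y\<in>Y. f y \<in> X \<and> 0 < w (f y) y)"
proof -
  define A where "A y = {x\<in>X. 0 < w x y}" for y
  have "\<exists>f. inj_on f Y \<and> (\<forall>y\<in>Y. f y \<in> A y)"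
  proof (rule hall_marriage[OF fin(2)])
    show "finite (A y)" if "y \<in> Y" for y using fin by (simp add: A_def)
    show "card S \<le> card (\<Union> (A ` S))" if S: "S \<subseteq> Y" for S
    proof -
      define NS where "NS = \<Union> (A ` S)"
      have NS: "NS \<subseteq> X" "finite NS" using fin by (auto simp: NS_def A_def intro: finite_subset[OF _ fin(1)])
      have "real (card S) = (\<Sum>y\<in>S. 1)" by simp
      also have "\<dots> \<le> (\<Sum>y\<in>S. \<Sum>x\<in>X. w x y)" using S by (intro sum_mono cover) auto
      also have "\<dots> = (\<Sum>y\<in>S. \<Sum>x\<in>NS. w x y)"
      proof (intro sum.cong[OF refl] sum.mono_neutral_right fin(1) NS(1) ballI)
        fix y x assume "y \<in> S" "x \<in> X - NS"
        then have "\<not> 0 < w x y" by (auto simp: NS_def A_def)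
        then show "w x y = 0" using nonneg[of x y] \<open>y \<in> S\<close> \<open>x \<in> X - NS\<close> S by force
      qed
      also have "\<dots> = (\<Sum>x\<in>NS. \<Sum>y\<in>S. w x y)" by (rule sum.swap)
      also have "\<dots> \<le> (\<Sum>x\<in>NS. \<Sum>y\<in>Y. w x y)"
        using S NS nonneg by (intro sum_mono sum_mono2 fin(2)) auto
      also have "\<dots> \<le> (\<Sum>x\<in>NS. 1)" using NS by (intro sum_mono load) auto
      finally show ?thesis by (simp add: NS_def)
    qed
  qed
  then show ?thesis by (auto simp: A_def)
qed

text \<open>Rosenfeld's counting form of the Lovasz local lemma: by induction every further coordinate
  multiplies the number of good partial colourings by at least $(1-\kappa)$ times the number of
  colours, since a bad extension at a test \<open>T j\<close> restricts to a good colouring off \<open>T j\<close>.\<close>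

lemma local_lemma:
  fixes C :: "'v \<Rightarrow> 'c set" and w :: "'j \<Rightarrow> real"
  assumes finV: "finite V" and finC: "\<And>v. v \<in> V \<Longrightarrow> finite (C v)"
    and Cne: "\<And>v. v \<in> V \<Longrightarrow> C v \<noteq> {}"
    and finJ: "finite J" and TV: "\<And>j. j \<in> J \<Longrightarrow> T j \<subseteq> V" and Tne: "\<And>j. j \<in> J \<Longrightarrow> T j \<noteq> {}"
    and bad: "\<And>j. j \<in> J \<Longrightarrow>
      real (card {\<phi> \<in> PiE (T j) C. P j \<phi>}) \<le> w j * (\<Prod>v\<in>T j. real (card (C v)))"
    and k: "0 < \<kappa>" "\<kappa> < 1" and w0: "\<And>j. j \<in> J \<Longrightarrow> 0 \<le> w j"
    and sum: "\<And>v. v \<in> V \<Longrightarrow> (\<Sum>j | j \<in> J \<and> v \<in> T j. w j / (1 - \<kappa>) ^ card (T j)) \<le> \<kappa>"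
  shows "\<exists>\<phi>\<in>PiE V C. \<forall>j\<in>J. \<not> P j (restrict \<phi> (T j))"
proof -
  define F where "F S = {\<phi>\<in>PiE S C. \<forall>j\<in>J. T j \<subseteq> S \<longrightarrow> \<not> P j (restrict \<phi> (T j))}" for S
  have finPi: "finite (PiE S C)" if "S \<subseteq> V" for S
    using that finC finV by (intro finite_PiE) (auto intro: finite_subset)
  have finF: "finite (F S)" if "S \<subseteq> V" for S
    using finPi[OF that] by (simp add: F_def)
  define c where "c v = real (card (C v))" for v
  have c1: "c v \<ge> 1" if "v \<in> V" for v
    using finC[OF that] Cne[OF that] by (simp add: c_def card_gt_0_iff Suc_le_eq)
  have main: "(1 - \<kappa>) * c v * card (F S) \<le> card (F (insert v S))"
    if "insert v S \<subseteq> V" "v \<notin> S" for v S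
    using that
  proof (induction "card S" arbitrary: S v rule: less_induct)
    case (less S v)
    have fS: "finite S" using less.prems finV by (auto intro: finite_subset)
    have vV: "v \<in> V" and SV: "S \<subseteq> V" using less.prems by auto
    have chain: "(1 - \<kappa>) ^ card R * (\<Prod>u\<in>R. c u) * card (F S') \<le> card (F (S' \<union> R))"
      if "S' \<union> R \<subseteq> S" "S' \<inter> R = {}" for S' R
    proof -
      have "finite R" using that fS by (auto intro: finite_subset)
      then show ?thesis using that
      proof (induction R rule: finite_induct)
        case empty then show ?case by simp
      next
        case (insert u R)
        have "card (S' \<union> R) < card S"
          using insert.prems insert.hyps fS by (intro psubset_card_mono) auto
        then have "(1 - \<kappa>) * c u * card (F (S' \<union> R)) \<le> card (F (insert u (S' \<union> R)))"
          using insert.prems insert.hyps SV by (intro less.hyps) auto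
        moreover have "(1 - \<kappa>) * c u * ((1 - \<kappa>) ^ card R * (\<Prod>u\<in>R. c u) * card (F S'))
            \<le> (1 - \<kappa>) * c u * card (F (S' \<union> R))"
          using insert k c1[of u] SV by (intro mult_left_mono) auto
        ultimately show ?case using insert.hyps by (simp add: mult_ac)
      qed
    qed
    \<comment> \<open>All extensions to v of good colourings of S. One that is not good violates a
      test containing v, since the tests inside S are already passed.\<close>
    define E where "E = {\<phi>\<in>PiE (insert v S) C. restrict \<phi> S \<in> F S}"
    define Bj where "Bj j = {\<phi>\<in>E. P j (restrict \<phi> (T j))}" for j
    define Jv where "Jv = {j\<in>J. v \<in> T j \<and> T j \<subseteq> insert v S}"
    have finE: "finite E" using finPi[of "insert v S"] less.prems by (simp add: E_def)
    have cardE: "card E = card (C v) * card (F S)"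
    proof -
      have "bij_betw (\<lambda>(a, f). f(v := a)) (C v \<times> F S) E"
      proof (rule bij_betw_byWitness[where f' = "\<lambda>\<phi>. (\<phi> v, restrict \<phi> S)"])
        show "\<forall>a\<in>C v \<times> F S. (case case a of (a, f) \<Rightarrow> f(v := a) of \<phi> \<Rightarrow> (\<phi> v, restrict \<phi> S)) = a"
          using less.prems by (auto simp: F_def fun_eq_iff restrict_def PiE_def extensional_def)
        show "\<forall>\<phi>\<in>E. (case (\<phi> v, restrict \<phi> S) of (a, f) \<Rightarrow> f(v := a)) = \<phi>"
          using less.prems by (auto simp: E_def fun_eq_iff restrict_def PiE_def extensional_def)
        show "(\<lambda>(a, f). f(v := a)) ` (C v \<times> F S) \<subseteq> E"
        proof clarify
          fix a f assume a: "a \<in> C v" and f: "f \<in> F S"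
          have "f \<in> PiE S C" using f by (simp add: F_def)
          then have "f(v := a) \<in> PiE (insert v S) C" using a by (rule PiE_fun_upd[rotated])
          moreover have "restrict (f(v := a)) S = f"
            using \<open>f \<in> PiE S C\<close> less.prems by (auto simp: fun_eq_iff restrict_def PiE_def extensional_def)
          ultimately show "f(v := a) \<in> E" using f by (simp add: E_def)
        qed
        show "(\<lambda>\<phi>. (\<phi> v, restrict \<phi> S)) ` E \<subseteq> C v \<times> F S" by (auto simp: E_def)
      qed
      then show ?thesis by (metis bij_betw_same_card card_cartesian_product)
    qed
    have sub: "E \<subseteq> F (insert v S) \<union> (\<Union>j\<in>Jv. Bj j)"
    proof
      fix \<phi> assume chi: "\<phi> \<in> E"
      show "\<phi> \<in> F (insert v S) \<union> (\<Union>j\<in>Jv. Bj j)"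
      proof (cases "\<phi> \<in> F (insert v S)")
        case False
        then obtain j where j: "j \<in> J" "T j \<subseteq> insert v S" "P j (restrict \<phi> (T j))"
          using chi by (auto simp: F_def E_def)
        have "v \<in> T j"
        proof (rule ccontr)
          assume "v \<notin> T j"
          then have "T j \<subseteq> S" using j by auto
          then have "\<not> P j (restrict (restrict \<phi> S) (T j))" using chi j by (auto simp: E_def F_def)
          moreover have "restrict (restrict \<phi> S) (T j) = restrict \<phi> (T j)"
            using \<open>T j \<subseteq> S\<close> by (auto simp: fun_eq_iff restrict_def)
          ultimately show False using j by simp
        qed
        then show ?thesis using chi j by (auto simp: Jv_def Bj_def)
      qed simp
    qed
    have Bj: "real (card (Bj j)) \<le> c v * card (F S) * (w j / (1 - \<kappa>) ^ card (T j))" if j: "j \<in> Jv" for j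
    proof -
      have jJ: "j \<in> J" and vT: "v \<in> T j" and TS: "T j \<subseteq> insert v S" using j by (auto simp: Jv_def)
      define S' where "S' = S - T j"
      define R where "R = T j - {v}"
      have fT: "finite (T j)" using TS fS finite_subset by blast
      have SR: "S = S' \<union> R" using TS less.prems by (auto simp: S'_def R_def)
      define bd where "bd = {\<phi> \<in> PiE (T j) C. P j \<phi>}"
      have fbd: "finite bd" using finPi[OF TV[OF jJ]] by (simp add: bd_def)
      \<comment> \<open>A bad extension is determined by its restrictions to \<open>T j\<close> and
        to S', because these two cover \<open>insert v S\<close>. Afterwards \<open>chain\<close>
        trades F S' for F S at the price of a factor 1/(1 - \<kappa>) per coordinate of R.\<close>
      have "card (Bj j) \<le> card (bd \<times> F S')"
      proof (rule card_inj_on_le[where f = "\<lambda>\<phi>. (restrict \<phi> (T j), restrict \<phi> S')"])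
        show "inj_on (\<lambda>\<phi>. (restrict \<phi> (T j), restrict \<phi> S')) (Bj j)"
        proof (rule inj_onI)
          fix f g assume fg: "f \<in> Bj j" "g \<in> Bj j"
            "(restrict f (T j), restrict f S') = (restrict g (T j), restrict g S')"
          show "f = g"
          proof (rule PiE_ext)
            show "f \<in> PiE (insert v S) C" "g \<in> PiE (insert v S) C" using fg by (auto simp: Bj_def E_def)
            fix x assume "x \<in> insert v S"
            then have "x \<in> T j \<or> x \<in> S'" using vT by (auto simp: S'_def)
            then show "f x = g x" using fg(3) by (metis prod.inject restrict_apply')
          qed
        qed
        show "(\<lambda>\<phi>. (restrict \<phi> (T j), restrict \<phi> S')) ` Bj j \<subseteq> bd \<times> F S'"
        proof clarify
          fix \<phi> assume chi: "\<phi> \<in> Bj j"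
          have 1: "restrict \<phi> (T j) \<in> bd" using chi TS by (auto simp: Bj_def bd_def E_def)
          have "\<not> P i (restrict (restrict \<phi> S') (T i))" if "i \<in> J" "T i \<subseteq> S'" for i
          proof -
            have "\<not> P i (restrict (restrict \<phi> S) (T i))"
              using chi that by (auto simp: Bj_def E_def F_def S'_def)
            moreover have "restrict (restrict \<phi> S) (T i) = restrict (restrict \<phi> S') (T i)"
              using that by (auto simp: fun_eq_iff restrict_def S'_def)
            ultimately show ?thesis by simp
          qed
          then have "restrict \<phi> S' \<in> F S'" using chi by (auto simp: F_def Bj_def E_def S'_def)
          with 1 show "restrict \<phi> (T j) \<in> bd \<and> restrict \<phi> S' \<in> F S'" by simp
        qed
        show "finite (bd \<times> F S')" using fbd finF[of S'] SV by (auto simp: S'_def)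
      qed
      then have "real (card (Bj j)) \<le> real (card bd) * card (F S')"
        by (metis card_cartesian_product of_nat_le_iff of_nat_mult)
      also have "\<dots> \<le> (w j * (\<Prod>u\<in>T j. c u)) * card (F S')"
        using bad[OF jJ] by (intro mult_right_mono) (auto simp: bd_def c_def)
      also have "(\<Prod>u\<in>T j. c u) = c v * (\<Prod>u\<in>R. c u)"
        unfolding R_def using vT fT by (simp add: prod.remove)
      also have "w j * (c v * (\<Prod>u\<in>R. c u)) * card (F S')
          = (c v * w j / (1 - \<kappa>) ^ card R) * ((1 - \<kappa>) ^ card R * (\<Prod>u\<in>R. c u) * card (F S'))"
        using k by (simp add: field_simps)
      also have "\<dots> \<le> (c v * w j / (1 - \<kappa>) ^ card R) * card (F (S' \<union> R))"
      proof (rule mult_left_mono)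
        have "S' \<union> R \<subseteq> S" "S' \<inter> R = {}" using TS by (auto simp: S'_def R_def)
        then show "(1 - \<kappa>) ^ card R * (\<Prod>u\<in>R. c u) * card (F S') \<le> card (F (S' \<union> R))"
          by (rule chain)
        show "0 \<le> c v * w j / (1 - \<kappa>) ^ card R" using k c1[OF vV] w0[OF jJ] by simp
      qed
      also have "\<dots> = c v * card (F S) * (w j / (1 - \<kappa>) ^ card R)" unfolding SR[symmetric] by simp
      also have "\<dots> \<le> c v * card (F S) * (w j / (1 - \<kappa>) ^ card (T j))"
      proof -
        have "(1 - \<kappa>) ^ card (T j) \<le> (1 - \<kappa>) ^ card R"
          using k fT by (intro power_decreasing card_mono) (auto simp: R_def)
        then show ?thesis using k c1[OF vV] w0[OF jJ]
          by (intro mult_left_mono divide_left_mono) auto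
      qed
      finally show ?thesis .
    qed
    have finJv: "finite Jv" using finJ by (simp add: Jv_def)
    have "c v * card (F S) = real (card E)" by (simp add: cardE c_def)
    also have "\<dots> \<le> card (F (insert v S) \<union> (\<Union>j\<in>Jv. Bj j))"
      using sub finE finJv finF[of "insert v S"] less.prems by (intro of_nat_mono card_mono) (auto simp: Bj_def)
    also have "\<dots> \<le> real (card (F (insert v S))) + real (card (\<Union>j\<in>Jv. Bj j))"
      by (metis card_Un_le of_nat_add of_nat_mono)
    also have "real (card (\<Union>j\<in>Jv. Bj j)) \<le> (\<Sum>j\<in>Jv. real (card (Bj j)))"
      using card_UN_le[OF finJv, of Bj] by (metis of_nat_mono of_nat_sum)
    also have "\<dots> \<le> (\<Sum>j\<in>Jv. c v * card (F S) * (w j / (1 - \<kappa>) ^ card (T j)))"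
      by (intro sum_mono Bj)
    also have "\<dots> = c v * card (F S) * (\<Sum>j\<in>Jv. w j / (1 - \<kappa>) ^ card (T j))"
      by (simp add: sum_distrib_left)
    also have "(\<Sum>j\<in>Jv. w j / (1 - \<kappa>) ^ card (T j)) \<le> (\<Sum>j | j \<in> J \<and> v \<in> T j. w j / (1 - \<kappa>) ^ card (T j))"
      using finJ k w0 by (intro sum_mono2) (auto simp: Jv_def)
    also have "\<dots> \<le> \<kappa>" by (rule sum[OF vV])
    finally have "c v * card (F S) \<le> card (F (insert v S)) + c v * card (F S) * \<kappa>"
      using c1[OF vV] by (simp add: mult_left_mono)
    then show ?case by (simp add: algebra_simps)
  qed
  have "card (F S) > 0" if "S \<subseteq> V" for S
  proof -
    have "finite S" using that finV finite_subset by blast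
    then show ?thesis using that
    proof (induction S rule: finite_induct)
      case empty
      have "T j \<noteq> {}" if "j \<in> J" for j using Tne that by auto
      then have "F {} = {\<lambda>_. undefined}" by (auto simp: F_def)
      then show ?case by simp
    next
      case (insert v S)
      have "0 < (1 - \<kappa>) * c v * card (F S)"
        using insert k c1[of v] by (intro mult_pos_pos) auto
      also have "\<dots> \<le> card (F (insert v S))" using insert by (intro main) auto
      finally show ?case by simp
    qed
  qed
  then obtain \<phi> where "\<phi> \<in> F V" by (metis card.empty equals0I less_irrefl order_refl)
  then show ?thesis using TV by (auto simp: F_def)
qed

section \<open>Exponential moments and Chernoff bounds for random colourings\<close>

lemma exp_le_quadratic:
  fixes x :: real
  assumes "\<bar>x\<bar> \<le> 1"
  shows "exp x \<le> 1 + x + x\<^sup>2"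
proof (cases "0 \<le> x")
  case True
  then show ?thesis using assms by (intro exp_bound) auto
next
  case False
  define y where "y = - x"
  have y: "0 \<le> y" "y \<le> 1" using False assms by (auto simp: y_def)
  have "1 \<le> 1 + y ^ 3" using y by simp
  also have "\<dots> = (1 - y + y\<^sup>2) * (1 + y)" by (simp add: algebra_simps power2_eq_square power3_eq_cube)
  also have "\<dots> \<le> (1 - y + y\<^sup>2) * exp y"
    using y by (intro mult_left_mono exp_ge_add_one_self) auto
  finally have "exp (- y) \<le> 1 - y + y\<^sup>2" by (simp add: exp_minus field_simps)
  then show ?thesis by (simp add: y_def)
qed

text \<open>The moment generating function of a binomial variable in counting form: the sum over
  colourings factorises over the vertices, and 1 + p (e^l - 1) is at most exp (p (e^l - 1)).\<close>

lemma exponential_moment_colouring: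
  fixes l :: real
  assumes fin: "finite T" "finite C" and B: "B \<subseteq> C" and C: "C \<noteq> {}"
  shows "(\<Sum>\<phi>\<in>PiE T (\<lambda>_. C). exp (l * card {v\<in>T. \<phi> v \<in> B}))
    \<le> real (card C) ^ card T * exp (card B / card C * card T * (exp l - 1))"
proof -
  have finB: "finite B" using B fin(2) finite_subset by blast
  have c0: "real (card C) > 0" using C fin by (simp add: card_gt_0_iff)
  have "(\<Sum>\<phi>\<in>PiE T (\<lambda>_. C). exp (l * card {v\<in>T. \<phi> v \<in> B}))
      = (\<Sum>\<phi>\<in>PiE T (\<lambda>_. C). \<Prod>v\<in>T. if \<phi> v \<in> B then exp l else 1)"
  proof (rule sum.cong[OF refl])
    fix \<phi> :: "'a \<Rightarrow> 'b"
    have "(\<Prod>v\<in>T. if \<phi> v \<in> B then exp l else 1) = (\<Prod>v\<in>{v\<in>T. \<phi> v \<in> B}. exp l)"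
      using fin by (simp add: prod.If_cases Int_def conj_commute)
    then show "exp (l * card {v\<in>T. \<phi> v \<in> B}) = (\<Prod>v\<in>T. if \<phi> v \<in> B then exp l else 1)"
      by (simp add: exp_of_nat_mult[symmetric] mult.commute)
  qed
  also have "\<dots> = (\<Prod>v\<in>T. \<Sum>c\<in>C. if c \<in> B then exp l else 1)"
    using fin by (subst prod_sum_PiE) auto
  also have "(\<Sum>c\<in>C. if c \<in> B then exp l else (1::real)) = card B * exp l + (real (card C) - card B)"
    using fin finB B by (simp add: sum.If_cases Int_absorb1 Diff_eq[symmetric] card_Diff_subset card_mono of_nat_diff)
  also have "\<dots> = card C * (1 + card B / card C * (exp l - 1))"
    using c0 by (simp add: field_simps)
  also have "(\<Prod>v\<in>T. card C * (1 + card B / card C * (exp l - 1)))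
      = card C ^ card T * (1 + card B / card C * (exp l - 1)) ^ card T" by (simp add: power_mult_distrib)
  also have "\<dots> \<le> card C ^ card T * exp (card B / card C * (exp l - 1)) ^ card T"
  proof (intro mult_left_mono power_mono exp_ge_add_one_self)
    \<comment> \<open>Raising to a power requires a nonnegative base; for negative l this rests on p
      <= 1.\<close>
    have "card B / card C \<le> 1" using B fin c0 by (simp add: card_mono)
    then have "card B / card C * (1 - exp l) \<le> 1"
      by (smt (verit) c0 divide_nonneg_nonneg exp_gt_zero mult_left_le of_nat_0_le_iff)
    then show "0 \<le> 1 + card B / card C * (exp l - 1)" unfolding right_diff_distrib by linarith
  qed simp
  also have "exp (card B / card C * (exp l - 1)) ^ card T = exp (card B / card C * card T * (exp l - 1))"
    by (simp add: exp_of_nat_mult[symmetric] mult_ac)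
  finally show ?thesis by simp
qed

lemma markov_card:
  fixes f :: "'a \<Rightarrow> real"
  assumes "finite S" "\<And>x. x \<in> S \<Longrightarrow> 0 \<le> f x" "\<And>x. x \<in> S \<Longrightarrow> Q x \<Longrightarrow> t \<le> f x" "0 < t"
  shows "real (card {x\<in>S. Q x}) \<le> sum f S / t"
proof -
  have "card {x\<in>S. Q x} * t = (\<Sum>x\<in>{x\<in>S. Q x}. t)" by simp
  also have "\<dots> \<le> (\<Sum>x\<in>{x\<in>S. Q x}. f x)" using assms by (intro sum_mono) auto
  also have "\<dots> \<le> sum f S" using assms by (intro sum_mono2) auto
  finally show ?thesis using assms by (simp add: field_simps)
qed

lemma chernoff_colouring:
  fixes e m :: real
  assumes fin: "finite T" "finite C" and B: "B \<subseteq> C" and C: "C \<noteq> {}" and e: "0 \<le> e" "e \<le> 1"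
    and m_def: "m = real (card B) / card C * card T"
  shows "real (card {\<phi>\<in>PiE T (\<lambda>_. C). (1 + e) * m \<le> card {v\<in>T. \<phi> v \<in> B}})
      \<le> exp (- e\<^sup>2 * m / 4) * real (card C) ^ card T"
    and "real (card {\<phi>\<in>PiE T (\<lambda>_. C). card {v\<in>T. \<phi> v \<in> B} \<le> (1 - e) * m})
      \<le> exp (- e\<^sup>2 * m / 4) * real (card C) ^ card T"
proof -
  have m0: "0 \<le> m" by (simp add: m_def)
  have finPi: "finite (PiE T (\<lambda>_. C))" using fin by (intro finite_PiE) auto
  \<comment> \<open>Both tails at once: l = e/2 with threshold s = (1 + e) m, or l = -e/2 with s =
    (1 - e) m. In either case l s = l m + e^2 m/2, while the moment costs m (l + l^2) = l m + e^2
    m/4; the difference is the exponent.\<close>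
  have *: "real (card {\<phi>\<in>PiE T (\<lambda>_. C). Q \<phi>}) \<le> exp (- e\<^sup>2 * m / 4) * real (card C) ^ card T"
    if l: "\<bar>l\<bar> \<le> 1" "l\<^sup>2 = e\<^sup>2 / 4" "l * s = l * m + e\<^sup>2 * m / 2"
      and Q: "\<And>\<phi>. Q \<phi> \<Longrightarrow> l * s \<le> l * card {v\<in>T. \<phi> v \<in> B}" for Q l s
  proof -
    have "real (card {\<phi>\<in>PiE T (\<lambda>_. C). Q \<phi>})
        \<le> (\<Sum>\<phi>\<in>PiE T (\<lambda>_. C). exp (l * card {v\<in>T. \<phi> v \<in> B})) / exp (l * s)"
      using finPi Q by (intro markov_card) auto
    also have "\<dots> \<le> (real (card C) ^ card T * exp (m * (exp l - 1))) / exp (l * s)"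
      unfolding m_def by (intro divide_right_mono exponential_moment_colouring fin B C) auto
    also have "\<dots> = real (card C) ^ card T * exp (m * (exp l - 1) - l * s)" by (simp add: exp_diff)
    also have "\<dots> \<le> real (card C) ^ card T * exp (- e\<^sup>2 * m / 4)"
    proof (intro mult_left_mono)
      have "m * (exp l - 1) \<le> m * (l + l\<^sup>2)"
        using exp_le_quadratic[OF l(1)] m0 by (intro mult_left_mono) auto
      also have "\<dots> = l * m + e\<^sup>2 * m / 4" by (simp add: l algebra_simps)
      finally have "m * (exp l - 1) - l * s \<le> - e\<^sup>2 * m / 4" using l(3) by (simp add: algebra_simps)
      then show "exp (m * (exp l - 1) - l * s) \<le> exp (- e\<^sup>2 * m / 4)" by simp
    qed simp
    finally show ?thesis by (simp add: mult.commute)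
  qed
  show "real (card {\<phi>\<in>PiE T (\<lambda>_. C). (1 + e) * m \<le> card {v\<in>T. \<phi> v \<in> B}})
      \<le> exp (- e\<^sup>2 * m / 4) * real (card C) ^ card T"
    using e by (intro *[of "e/2" "(1 + e) * m"] mult_left_mono) (auto simp: power2_eq_square field_simps)
  show "real (card {\<phi>\<in>PiE T (\<lambda>_. C). card {v\<in>T. \<phi> v \<in> B} \<le> (1 - e) * m})
      \<le> exp (- e\<^sup>2 * m / 4) * real (card C) ^ card T"
  proof (intro *[of "-e/2" "(1 - e) * m"] mult_left_mono_neg)
  qed (use e in \<open>auto simp: power2_eq_square field_simps\<close>)
qed

section \<open>Turan's bound after Caro and Wei\<close>

lemma caro_wei:
  assumes "finite W"
  shows "\<exists>S\<subseteq>W. (\<forall>x\<in>S. \<forall>y\<in>S. x \<noteq> y \<longrightarrow> {x, y} \<notin> E) \<and>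
    (\<Sum>v\<in>W. 1 / (1 + real (card {u\<in>W. u \<noteq> v \<and> {u, v} \<in> E}))) \<le> card S"
  using assms
proof (induction "card W" arbitrary: W rule: less_induct)
  case less
  define nb where "nb W v = {u\<in>W. u \<noteq> v \<and> {u, v} \<in> E}" for W v
  show ?case
  proof (cases "W = {}")
    case False
    \<comment> \<open>Greedy choice of a vertex of minimum degree. All vertices of its closed
      neighbourhood R have at least that degree, so R contributes at most 1 to the sum, and deleting
      R only lowers the other degrees.\<close>
    then obtain v where v: "v \<in> W" "\<And>u. u \<in> W \<Longrightarrow> card (nb W v) \<le> card (nb W u)"
      using ex_has_least_nat[of "\<lambda>v. v \<in> W" _ "\<lambda>v. card (nb W v)"] by auto
    define R where "R = insert v (nb W v)"
    have R: "R \<subseteq> W" "finite R" "card R = 1 + card (nb W v)"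
      using v less.prems by (auto simp: R_def nb_def)
    have "card (W - R) < card W" using v R less.prems by (intro psubset_card_mono) (auto simp: R_def)
    then obtain S where S: "S \<subseteq> W - R" "\<And>x y. x \<in> S \<Longrightarrow> y \<in> S \<Longrightarrow> x \<noteq> y \<Longrightarrow> {x, y} \<notin> E"
        "(\<Sum>u\<in>W - R. 1 / (1 + real (card (nb (W - R) u)))) \<le> card S"
      using less.hyps[of "W - R"] less.prems unfolding nb_def[symmetric] by (metis finite_Diff)
    have finS: "finite S" using S(1) less.prems finite_subset by blast
    have "(\<Sum>u\<in>R. 1 / (1 + real (card (nb W u)))) \<le> (\<Sum>u\<in>R. 1 / real (card R))"
      using v R by (intro sum_mono divide_left_mono) auto
    also have "\<dots> = 1" using R by auto
    finally have 1: "(\<Sum>u\<in>R. 1 / (1 + real (card (nb W u)))) \<le> 1" .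
    have "(\<Sum>u\<in>W - R. 1 / (1 + real (card (nb W u)))) \<le> (\<Sum>u\<in>W - R. 1 / (1 + real (card (nb (W - R) u))))"
      using less.prems by (intro sum_mono divide_left_mono add_left_mono of_nat_mono card_mono)
        (auto simp: nb_def add_pos_nonneg)
    with S(3) 1 have "(\<Sum>u\<in>W. 1 / (1 + real (card (nb W u)))) \<le> card S + 1"
      by (subst sum.subset_diff[OF R(1) less.prems]) simp
    moreover have "card (insert v S) = card S + 1"
      using S(1) finS by (subst card_insert_disjoint) (auto simp: R_def)
    moreover have "\<forall>x\<in>insert v S. \<forall>y\<in>insert v S. x \<noteq> y \<longrightarrow> {x, y} \<notin> E"
    proof (intro ballI impI)
      fix x y assume xy: "x \<in> insert v S" "y \<in> insert v S" "x \<noteq> y"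
      have "{u, v} \<notin> E" "{v, u} \<notin> E" if "u \<in> S" for u
        using S(1) that by (auto simp: R_def nb_def insert_commute)
      then show "{x, y} \<notin> E" using xy S(2) by auto
    qed
    ultimately show ?thesis using S(1) v by (intro exI[of _ "insert v S"]) (auto simp: nb_def)
  qed auto
qed

text \<open>The tangent 2/c - t/c^2 lies below 1/t and makes the Caro-Wei sum linear in the degrees.
  It is taken at c = \<open>card V\<close> / N, the clique size in the extremal union of N equal
  cliques.\<close>

lemma turan_edge_bound:
  assumes fin: "finite V" "finite E" and E: "\<And>e. e \<in> E \<Longrightarrow> e \<subseteq> V \<and> card e = 2"
    and ind: "\<And>S. S \<subseteq> V \<Longrightarrow> \<forall>x\<in>S. \<forall>y\<in>S. x \<noteq> y \<longrightarrow> {x, y} \<notin> E \<Longrightarrow> card S \<le> N"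
    and N: "N > 0"
  shows "(real (card V))\<^sup>2 / N - card V \<le> 2 * real (card E)"
proof (cases "V = {}")
  case False
  define d where "d v = real (card {u\<in>V. u \<noteq> v \<and> {u, v} \<in> E})" for v
  obtain S where S: "S \<subseteq> V" "\<forall>x\<in>S. \<forall>y\<in>S. x \<noteq> y \<longrightarrow> {x, y} \<notin> E" "(\<Sum>v\<in>V. 1 / (1 + d v)) \<le> card S"
    using caro_wei[OF fin(1), of E] unfolding d_def by blast
  have "(\<Sum>v\<in>V. d v) \<le> (\<Sum>v\<in>V. real (card {e\<in>E. v \<in> e}))"
    unfolding d_def
  proof (intro sum_mono of_nat_mono)
    fix v
    show "card {u\<in>V. u \<noteq> v \<and> {u, v} \<in> E} \<le> card {e\<in>E. v \<in> e}"
      using fin by (intro card_inj_on_le[where f = "\<lambda>u. {u, v}"] inj_onI) (auto simp: doubleton_eq_iff)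
  qed
  also have "\<dots> = real (\<Sum>v\<in>V. \<Sum>e\<in>E. if v \<in> e then 1 else 0)"
    using fin by (simp add: sum.If_cases Int_def)
  also have "(\<Sum>v\<in>V. \<Sum>e\<in>E. if v \<in> e then 1 else (0::nat)) = (\<Sum>e\<in>E. \<Sum>v\<in>V. if v \<in> e then 1 else 0)"
    by (rule sum.swap)
  also have "\<dots> = (\<Sum>e\<in>E. 2)"
    using fin E by (intro sum.cong refl) (auto simp: sum.If_cases Int_absorb1 Int_def[symmetric] Collect_mem_eq)
  finally have deg: "(\<Sum>v\<in>V. d v) \<le> 2 * card E" by simp
  define c where "c = real (card V) / N"
  have c: "c > 0" using False fin N by (simp add: c_def card_gt_0_iff)
  have "(\<Sum>v\<in>V. 2 / c - (1 + d v) / c\<^sup>2) \<le> (\<Sum>v\<in>V. 1 / (1 + d v))"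
  proof (rule sum_mono)
    fix v
    have t: "1 + d v > 0" by (simp add: d_def add_pos_nonneg)
    have "0 \<le> ((1 + d v) - c)\<^sup>2 / (c\<^sup>2 * (1 + d v))" using t by simp
    also have "\<dots> = 1 / (1 + d v) - (2 / c - (1 + d v) / c\<^sup>2)"
      using t c by (simp add: field_simps power2_eq_square)
    finally show "2 / c - (1 + d v) / c\<^sup>2 \<le> 1 / (1 + d v)" by simp
  qed
  also have "\<dots> \<le> card S" by (rule S(3))
  also have "real (card S) \<le> N" using ind[OF S(1,2)] by simp
  finally have "card V * (2 / c) - (card V + (\<Sum>v\<in>V. d v)) / c\<^sup>2 \<le> N"
    by (simp add: sum_subtractf sum.distrib sum_divide_distrib[symmetric])
  then have "card V * (2 / c) * c\<^sup>2 - (card V + (\<Sum>v\<in>V. d v)) \<le> N * c\<^sup>2"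
    using c by (simp add: field_simps)
  moreover have "card V * (2 / c) * c\<^sup>2 = 2 * card V * c" using c by (simp add: power2_eq_square)
  moreover have "N * c\<^sup>2 = card V * c" using N by (simp add: c_def power2_eq_square)
  moreover have "card V * c = (real (card V))\<^sup>2 / N" by (simp add: c_def power2_eq_square)
  ultimately show ?thesis using deg by simp
qed simp

text \<open>Intervals of lengths g 0, g 1, ... are laid end to end and reduced mod M. An interval of
  length at most M stays injective, and a total length of at most b M wraps around at most b
  times.\<close>

lemma cyclic_cover:
  fixes g :: "nat \<Rightarrow> nat"
  assumes M: "M > 0" and g: "\<And>i. i < K \<Longrightarrow> g i \<le> M" and b: "(\<Sum>i<K. g i) \<le> b * M"
  shows "\<exists>G. (\<forall>i<K. G i \<subseteq> {..<M} \<and> card (G i) = g i) \<and> (\<forall>c. card {i. i < K \<and> c \<in> G i} \<le> b)"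
proof -
  define s where "s i = (\<Sum>j<i. g j)" for i
  have smono: "s i \<le> s j" if "i \<le> j" for i j
    unfolding s_def using that by (intro sum_mono2) auto
  define G where "G i = (\<lambda>t. t mod M) ` {s i..<s (Suc i)}" for i
  have "card (G i) = g i" if "i < K" for i
  proof -
    have "inj_on (\<lambda>t. t mod M) {s i..<s (Suc i)}"
    proof (rule inj_onI)
      have *: "x = y" if "x \<le> y" "x mod M = y mod M" "x \<in> {s i..<s (Suc i)}" "y \<in> {s i..<s (Suc i)}" for x y
      proof -
        have "y - x < M" using that g[OF \<open>i < K\<close>] by (auto simp: s_def)
        moreover have "M dvd y - x" using that mod_eq_dvd_iff_nat by metis
        ultimately show ?thesis using that by (metis diff_is_0_eq dvd_imp_le le_antisym not_gr0 not_le)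
      qed
      fix x y assume "x \<in> {s i..<s (Suc i)}" "y \<in> {s i..<s (Suc i)}" "x mod M = y mod M"
      then show "x = y" using *[of x y] *[of y x] by (metis nat_le_linear)
    qed
    then show ?thesis by (simp add: G_def card_image) (simp add: s_def)
  qed
  moreover have "card {i. i < K \<and> c \<in> G i} \<le> b" for c
  proof -
    \<comment> \<open>For c in \<open>G i\<close>, the point of interval i in the residue class of
      c. These points increase with i and stay below b M, where the class has only b points.\<close>
    define f where "f i = (SOME t. t \<in> {s i..<s (Suc i)} \<and> t mod M = c)" for i
    have f: "f i \<in> {s i..<s (Suc i)} \<and> f i mod M = c" if "c \<in> G i" for i
      unfolding f_def by (rule someI_ex) (use that in \<open>auto simp: G_def\<close>)
    have "card {i. i < K \<and> c \<in> G i} \<le> card ((\<lambda>q. q * M + c) ` {..<b})"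
    proof (rule card_inj_on_le[where f = f])
      show "inj_on f {i. i < K \<and> c \<in> G i}"
      proof (rule inj_onI)
        have *: "f i < f j" if "c \<in> G i" "c \<in> G j" "i < j" for i j
          using f[OF that(1)] f[OF that(2)] smono[of "Suc i" j] that(3) by simp
        fix i j assume "i \<in> {i. i < K \<and> c \<in> G i}" "j \<in> {i. i < K \<and> c \<in> G i}" "f i = f j"
        then show "i = j" using *[of i j] *[of j i] by (metis (mono_tags) linorder_neqE_nat mem_Collect_eq less_irrefl)
      qed
      show "f ` {i. i < K \<and> c \<in> G i} \<subseteq> (\<lambda>q. q * M + c) ` {..<b}"
      proof clarify
        fix i assume i: "i < K" "c \<in> G i"
        have "f i < s K" using f[OF i(2)] smono[of "Suc i" K] i by simp
        then have "f i < b * M" using b by (simp add: s_def)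
        then have "f i div M < b" by (simp add: less_mult_imp_div_less)
        moreover have "f i = f i div M * M + c" using f[OF i(2)] by (metis div_mult_mod_eq)
        ultimately show "f i \<in> (\<lambda>q. q * M + c) ` {..<b}" by auto
      qed
    qed simp
    also have "\<dots> \<le> b" using card_image_le[of "{..<b}"] by simp
    finally show ?thesis .
  qed
  moreover have "G i \<subseteq> {..<M}" for i using M by (auto simp: G_def)
  ultimately show ?thesis by blast
qed

section \<open>Balanced colourings from the local lemma\<close>

lemma one_minus_ge_exp:
  fixes x :: real
  assumes "0 \<le> x" "x \<le> 1 / 2"
  shows "exp (- 2 * x) \<le> 1 - x"
proof -
  have "1 \<le> (1 - x) * (1 + 2 * x)"
    using assms mult_nonneg_nonneg[of x "1 - 2 * x"] by (simp add: algebra_simps)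
  also have "\<dots> \<le> (1 - x) * exp (2 * x)"
    using assms by (intro mult_left_mono exp_ge_add_one_self) auto
  finally show ?thesis by (simp add: exp_minus field_simps)
qed

text \<open>For the sums in the local lemma: the number of tests of one type through a vertex is
  bounded by a binomial coefficient t that also governs their size. Half of the decay absorbs the
  factor t, and the rest needs only a lower bound s for t.\<close>

lemma times_exp_le:
  fixes t s \<theta> :: real
  assumes "0 < \<theta>" "s \<le> t"
  shows "t * exp (- \<theta> * t / 2) \<le> 4 / \<theta> * exp (- \<theta> * s / 4)"
proof -
  have "\<theta> * t / 4 \<le> exp (\<theta> * t / 4)" using exp_ge_add_one_self[of "\<theta> * t / 4"] by linarith
  then have "t \<le> 4 / \<theta> * exp (\<theta> * t / 4)" using assms by (simp add: field_simps)
  then have "t * exp (- \<theta> * t / 2) \<le> 4 / \<theta> * exp (\<theta> * t / 4) * exp (- \<theta> * t / 2)"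
    by (rule mult_right_mono) simp
  also have "\<dots> = 4 / \<theta> * exp (- \<theta> * t / 4)" by (simp add: mult.assoc exp_add[symmetric])
  also have "\<dots> \<le> 4 / \<theta> * exp (- \<theta> * s / 4)"
    using assms by (intro mult_left_mono) auto
  finally show ?thesis .
qed

text \<open>By Chernoff a test fails with probability at most 2 exp (-\<theta> |T|). With \<kappa> =
  \<theta>/4 the local lemma's correction (1 - \<kappa>)^(-|T|) is at most exp (\<theta> |T|/2), so
  half of the decay survives; this explains \<theta>/2 and \<theta>/8 in \<open>sum\<close>.
  Palettes may differ between vertices but agree within a test.\<close>

lemma balanced_colouring:
  fixes C :: "'v \<Rightarrow> 'c set" and D B :: "'j \<Rightarrow> 'c set" and \<eta> \<theta> :: real
  assumes finV: "finite V" and finC: "\<And>v. v \<in> V \<Longrightarrow> finite (C v)"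
    and Cne: "\<And>v. v \<in> V \<Longrightarrow> C v \<noteq> {}"
    and finJ: "finite J" and TV: "\<And>j. j \<in> J \<Longrightarrow> T j \<subseteq> V" and Tne: "\<And>j. j \<in> J \<Longrightarrow> T j \<noteq> {}"
    and CD: "\<And>j v. j \<in> J \<Longrightarrow> v \<in> T j \<Longrightarrow> C v = D j" and BD: "\<And>j. j \<in> J \<Longrightarrow> B j \<subseteq> D j"
    and eta: "0 \<le> \<eta>" "\<eta> \<le> 1" and theta: "0 < \<theta>" "\<theta> \<le> 1"
    and rate: "\<And>j. j \<in> J \<Longrightarrow> \<theta> \<le> \<eta>\<^sup>2 * (card (B j) / card (D j)) / 4"
    and sum: "\<And>v. v \<in> V \<Longrightarrow> (\<Sum>j | j \<in> J \<and> v \<in> T j. exp (- \<theta> * card (T j) / 2)) \<le> \<theta> / 8"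
  shows "\<exists>\<phi>\<in>PiE V C. \<forall>j\<in>J.
      (1 - \<eta>) * (card (B j) / card (D j) * card (T j)) < card {v\<in>T j. \<phi> v \<in> B j} \<and>
      card {v\<in>T j. \<phi> v \<in> B j} < (1 + \<eta>) * (card (B j) / card (D j) * card (T j))"
proof -
  define m where "m j = card (B j) / card (D j) * card (T j)" for j
  define P where "P j \<phi> \<longleftrightarrow> (1 + \<eta>) * m j \<le> card {v\<in>T j. \<phi> v \<in> B j} \<or>
      card {v\<in>T j. \<phi> v \<in> B j} \<le> (1 - \<eta>) * m j" for j and \<phi> :: "'v \<Rightarrow> 'c"
  define w where "w j = 2 * exp (- \<theta> * card (T j))" for j
  have "\<exists>\<phi>\<in>PiE V C. \<forall>j\<in>J. \<not> P j (restrict \<phi> (T j))"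
  proof (rule local_lemma[OF finV finC Cne finJ TV Tne, where w = w and \<kappa> = "\<theta> / 4"])
    show "0 < \<theta> / 4" "\<theta> / 4 < 1" using theta by auto
    show "0 \<le> w j" for j by (simp add: w_def)
    fix j assume j: "j \<in> J"
    have finT: "finite (T j)" using TV[OF j] finV finite_subset by blast
    obtain v where v: "v \<in> T j" using Tne[OF j] by blast
    have D: "finite (D j)" "D j \<noteq> {}" using CD[OF j v] finC[of v] Cne[of v] TV[OF j] v by auto
    have PiE: "PiE (T j) C = PiE (T j) (\<lambda>_. D j)" using CD[OF j] by (intro PiE_cong) auto
    have finP: "finite (PiE (T j) (\<lambda>_. D j))" using finT D by (intro finite_PiE) auto
    have "{\<phi> \<in> PiE (T j) C. P j \<phi>} \<subseteq>
        {\<phi>\<in>PiE (T j) (\<lambda>_. D j). (1 + \<eta>) * m j \<le> card {v\<in>T j. \<phi> v \<in> B j}} \<union>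
        {\<phi>\<in>PiE (T j) (\<lambda>_. D j). card {v\<in>T j. \<phi> v \<in> B j} \<le> (1 - \<eta>) * m j}" (is "_ \<subseteq> ?A \<union> ?B")
      by (auto simp: PiE P_def)
    then have "card {\<phi> \<in> PiE (T j) C. P j \<phi>} \<le> card (?A \<union> ?B)" using finP by (intro card_mono) auto
    also have "\<dots> \<le> card ?A + card ?B" by (rule card_Un_le)
    finally have "real (card {\<phi> \<in> PiE (T j) C. P j \<phi>}) \<le> real (card ?A) + real (card ?B)" by linarith
    also have "\<dots> \<le> exp (- \<eta>\<^sup>2 * m j / 4) * real (card (D j)) ^ card (T j)
        + exp (- \<eta>\<^sup>2 * m j / 4) * real (card (D j)) ^ card (T j)"
      by (intro add_mono chernoff_colouring finT D BD[OF j] eta) (simp_all add: m_def)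
    also have "\<dots> = 2 * exp (- \<eta>\<^sup>2 * m j / 4) * real (card (D j)) ^ card (T j)" by simp
    also have "\<dots> \<le> w j * real (card (D j)) ^ card (T j)"
    proof (intro mult_right_mono)
      have "\<theta> * card (T j) \<le> \<eta>\<^sup>2 * (card (B j) / card (D j)) / 4 * card (T j)"
        using rate[OF j] by (intro mult_right_mono) auto
      then show "2 * exp (- \<eta>\<^sup>2 * m j / 4) \<le> w j" by (simp add: w_def m_def)
    qed simp
    also have "real (card (D j)) ^ card (T j) = (\<Prod>v\<in>T j. real (card (C v)))" using CD[OF j] by simp
    finally show "real (card {\<phi> \<in> PiE (T j) C. P j \<phi>}) \<le> w j * (\<Prod>v\<in>T j. real (card (C v)))" .
  next
    fix v assume v: "v \<in> V"
    have "(\<Sum>j | j \<in> J \<and> v \<in> T j. w j / (1 - \<theta> / 4) ^ card (T j))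
        \<le> (\<Sum>j | j \<in> J \<and> v \<in> T j. 2 * exp (- \<theta> * card (T j) / 2))"
    proof (rule sum_mono)
      fix j
      have "exp (- \<theta> * card (T j) / 2) = exp (- 2 * (\<theta> / 4)) ^ card (T j)"
        by (simp add: exp_of_nat_mult[symmetric] mult_ac)
      also have "\<dots> \<le> (1 - \<theta> / 4) ^ card (T j)"
        using theta by (intro power_mono one_minus_ge_exp) auto
      finally have "w j / (1 - \<theta> / 4) ^ card (T j) \<le> w j / exp (- \<theta> * card (T j) / 2)"
        using theta by (intro divide_left_mono) (auto simp: w_def)
      also have "\<dots> = 2 * exp (- \<theta> * card (T j) / 2)"
        by (simp add: w_def nonzero_divide_eq_eq mult.assoc exp_add[symmetric])
      finally show "w j / (1 - \<theta> / 4) ^ card (T j) \<le> 2 * exp (- \<theta> * card (T j) / 2)" .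
    qed
    also have "\<dots> \<le> \<theta> / 4" using sum[OF v] by (simp add: sum_distrib_left[symmetric])
    finally show "(\<Sum>j | j \<in> J \<and> v \<in> T j. w j / (1 - \<theta> / 4) ^ card (T j)) \<le> \<theta> / 4" .
  qed
  then obtain \<phi> where phi: "\<phi> \<in> PiE V C" "\<And>j. j \<in> J \<Longrightarrow> \<not> P j (restrict \<phi> (T j))" by blast
  have "{v\<in>T j. restrict \<phi> (T j) v \<in> B j} = {v\<in>T j. \<phi> v \<in> B j}" for j by auto
  then have "\<forall>j\<in>J. (1 - \<eta>) * m j < card {v\<in>T j. \<phi> v \<in> B j} \<and> card {v\<in>T j. \<phi> v \<in> B j} < (1 + \<eta>) * m j"
    using phi(2) by (auto simp: P_def not_le)
  then show ?thesis using phi(1) by (auto simp: m_def)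
qed

text \<open>Here \<open>key\<close> is the type of a test. For each type, the number of tests
  through a fixed vertex times their common failure bound is at most b.\<close>

lemma sum_grouped_le:
  fixes f :: "'j \<Rightarrow> real" and c e :: "'q \<Rightarrow> real" and b :: real
  assumes fin: "finite J" "finite Q" and key: "key ` J \<subseteq> Q" and b: "0 \<le> b"
    and cnt: "\<And>q. q \<in> Q \<Longrightarrow> real (card {j\<in>J. key j = q}) \<le> c q"
    and f: "\<And>j. j \<in> J \<Longrightarrow> f j \<le> e (key j)" and e: "\<And>q. q \<in> Q \<Longrightarrow> 0 \<le> e q"
    and ce: "\<And>q. q \<in> Q \<Longrightarrow> c q * e q \<le> b"
  shows "sum f J \<le> card Q * b"
proof -
  have "sum f J = (\<Sum>q\<in>Q. \<Sum>j\<in>{j\<in>J. key j = q}. f j)"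
    using sum.group[OF fin key, of f] by simp
  also have "\<dots> \<le> (\<Sum>q\<in>Q. b)"
  proof (rule sum_mono)
    fix q assume q: "q \<in> Q"
    have "(\<Sum>j\<in>{j\<in>J. key j = q}. f j) \<le> (\<Sum>j\<in>{j\<in>J. key j = q}. e q)"
      using f by (intro sum_mono) auto
    also have "\<dots> = card {j\<in>J. key j = q} * e q" by simp
    also have "\<dots> \<le> c q * e q" using cnt[OF q] e[OF q] by (rule mult_right_mono)
    also have "\<dots> \<le> b" by (rule ce[OF q])
    finally show "(\<Sum>j\<in>{j\<in>J. key j = q}. f j) \<le> b" .
  qed
  finally show ?thesis by simp
qed

section \<open>Levels of the cube\<close>

definition level :: "nat \<Rightarrow> nat \<Rightarrow> nat set set" where
  "level n k = {x. x \<subseteq> {1..n} \<and> card x = k}"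

lemma finite_level [simp]: "finite (level n k)"
  by (rule finite_subset[of _ "Pow {1..n}"]) (auto simp: level_def)

lemma card_level: "card (level n k) = n choose k"
  unfolding level_def by (subst n_subsets) auto

lemma level_finite: "x \<in> level n k \<Longrightarrow> finite x"
  by (auto simp: level_def intro: finite_subset)

lemma card_below:
  assumes "y \<in> level n k'"
  shows "card {x\<in>level n k. x \<subseteq> y} = k' choose k"
proof -
  have "{x\<in>level n k. x \<subseteq> y} = {x. x \<subseteq> y \<and> card x = k}" using assms by (auto simp: level_def)
  then show ?thesis using n_subsets[OF level_finite[OF assms], of k] assms by (simp add: level_def)
qed

lemma card_above:
  assumes x: "x \<in> level n k" and "k \<le> k'"
  shows "card {y\<in>level n k'. x \<subseteq> y} = (n - k) choose (k' - k)"
proof -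
  have fx: "finite x" by (rule level_finite[OF x])
  have "bij_betw (\<lambda>z. x \<union> z) {z. z \<subseteq> {1..n} - x \<and> card z = k' - k} {y\<in>level n k'. x \<subseteq> y}"
  proof (rule bij_betw_byWitness[where f' = "\<lambda>y. y - x"])
    show "(\<lambda>z. x \<union> z) ` {z. z \<subseteq> {1..n} - x \<and> card z = k' - k} \<subseteq> {y\<in>level n k'. x \<subseteq> y}"
    proof clarify
      fix z assume z: "z \<subseteq> {1..n} - x" "card z = k' - k"
      then have "finite z" using finite_subset by blast
      then have "card (x \<union> z) = card x + card z" using z fx by (intro card_Un_disjoint) auto
      then show "x \<union> z \<in> level n k' \<and> x \<subseteq> x \<union> z" using z x assms by (auto simp: level_def)
    qed
    show "(\<lambda>y. y - x) ` {y\<in>level n k'. x \<subseteq> y} \<subseteq> {z. z \<subseteq> {1..n} - x \<and> card z = k' - k}"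
      using x fx by (auto simp: level_def card_Diff_subset)
  qed auto
  then have "card {y\<in>level n k'. x \<subseteq> y} = card {z. z \<subseteq> {1..n} - x \<and> card z = k' - k}"
    by (simp add: bij_betw_same_card)
  also have "\<dots> = card ({1..n} - x) choose (k' - k)" by (rule n_subsets) simp
  also have "card ({1..n} - x) = n - k" using x fx by (simp add: level_def card_Diff_subset)
  finally show ?thesis .
qed

lemma le_binomial:
  assumes "0 < k" "k < n"
  shows "n \<le> n choose k"
  using assms
proof (induction n arbitrary: k)
  case (Suc n)
  then obtain j where j: "k = Suc j" by (cases k) auto
  show ?case
  proof (cases "k = n")
    case True then show ?thesis using Suc by simp
  next
    case False
    then have "n \<le> n choose k" using Suc by auto
    moreover have "0 < n choose j" using Suc.prems j by (intro zero_less_binomial) auto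
    ultimately show ?thesis using binomial_Suc_Suc[of n j] unfolding j by linarith
  qed
qed simp

text \<open>The variance n/4 of the size of a random subset. A new element splits each deviation t
  into t - 1/2 and t + 1/2, whose squares add up to 2 t^2 + 1/2.\<close>

lemma sum_sq_dev:
  assumes "finite A"
  shows "(\<Sum>x\<in>Pow A. (real (card x) - card A / 2)\<^sup>2) = 2 ^ card A * card A / 4"
  using assms
proof (induction A rule: finite_induct)
  case (insert a A)
  have inj: "inj_on (insert a) (Pow A)" using insert by (auto simp: inj_on_def)
  have "(\<Sum>x\<in>Pow (insert a A). (real (card x) - card (insert a A) / 2)\<^sup>2)
      = (\<Sum>x\<in>Pow A. (real (card x) - (card A + 1) / 2)\<^sup>2)
        + (\<Sum>x\<in>insert a ` Pow A. (real (card x) - (card A + 1) / 2)\<^sup>2)"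
    using insert unfolding Pow_insert by (subst sum.union_disjoint) auto
  also have "(\<Sum>x\<in>insert a ` Pow A. (real (card x) - (card A + 1) / 2)\<^sup>2)
      = (\<Sum>x\<in>Pow A. (real (card x) + 1 - (card A + 1) / 2)\<^sup>2)"
  proof (subst sum.reindex[OF inj], rule sum.cong[OF refl])
    fix x assume "x \<in> Pow A"
    then have "card (insert a x) = card x + 1"
      using insert by (subst card_insert_disjoint) (auto intro: finite_subset)
    then show "((\<lambda>x. (real (card x) - (card A + 1) / 2)\<^sup>2) \<circ> insert a) x
        = (real (card x) + 1 - (card A + 1) / 2)\<^sup>2" by (simp add: add.commute)
  qed
  also have "(\<Sum>x\<in>Pow A. (real (card x) - (card A + 1) / 2)\<^sup>2) + \<dots>
      = (\<Sum>x\<in>Pow A. 2 * (real (card x) - card A / 2)\<^sup>2 + 1 / 2)"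
    unfolding sum.distrib[symmetric] by (intro sum.cong refl) (simp add: power2_eq_square field_simps)
  also have "\<dots> = 2 * (2 ^ card A * card A / 4) + 2 ^ card A / 2"
    unfolding sum.distrib sum_distrib_left[symmetric] insert.IH
    using insert by (simp add: card_Pow)
  also have "\<dots> = 2 ^ card (insert a A) * card (insert a A) / 4"
    using insert by (simp add: field_simps)
  finally show ?case .
qed simp

section \<open>Matchings between consecutive levels\<close>

text \<open>A set of size $k+1$ has $k+1$ subsets of size $k$, and a set of size $k$ has $n-k$ supersets of
  size $k+1$. So $2k+1-n$ of the former may be spared without violating the degree condition
  for a matching of the upper level into the lower one.\<close>

lemma droppers:
  fixes n lo hi h :: nat and Tg :: "nat set" and \<beta> \<theta> :: real
  assumes lo: "n + 2 * h \<le> 2 * lo + 1" "1 \<le> lo" and hi: "hi \<le> n" and h: "h \<le> n"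
    and Tg: "finite Tg" "\<And>k. k \<in> Tg \<Longrightarrow> k \<le> hi"
    and beta: "0 < \<beta>" "\<beta> \<le> 1" "2 \<le> \<beta> * h"
    and theta: "\<theta> = \<beta>\<^sup>2 * h / (128 * n)"
    and crit: "(card Tg + 1) * (4 / \<theta> * exp (- \<theta> * n / 12)) \<le> \<theta> / 8"
  obtains D where
    "\<And>k. k \<in> {lo..<hi} \<Longrightarrow> D k \<subseteq> level n k"
    "\<And>k y. k \<in> {lo..<hi} \<Longrightarrow> y \<in> level n (k + 1) \<Longrightarrow> card {x\<in>D k. x \<subseteq> y} \<le> 2 * k + 1 - n"
    "\<And>k k' y. k \<in> {lo..<hi} \<Longrightarrow> k' \<in> Tg \<Longrightarrow> k < k' \<Longrightarrow> y \<in> level n k' \<Longrightarrow>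
      (1 - \<beta>) * (real (2 * k + 1 - n) / real (k + 1)) * (k' choose k) \<le> card {x\<in>D k. x \<subseteq> y}"
proof -
  have h0: "h > 0" using beta by (cases h) auto
  then have n0: "n > 0" using h by simp
  \<comment> \<open>The largest admissible fraction of droppers below a set of size k + 1. It is at
    least 2h/n because lo lies about h levels above the middle.\<close>
  define d where "d k = real (2 * k + 1 - n) / real (k + 1)" for k
  have d: "2 * real h / n \<le> d k" "d k \<le> 1" if "k \<in> {lo..<hi}" for k
  proof -
    have "2 * h \<le> 2 * k + 1 - n" using that lo by auto
    then have "2 * real h \<le> real (2 * k + 1 - n)" by linarith
    moreover have "real (k + 1) \<le> n" using that hi by auto
    ultimately show "2 * real h / n \<le> d k" unfolding d_def
      using n0 by (intro frac_le) auto
    have "2 * k + 1 - n \<le> k + 1" using that hi by auto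
    then have "real (2 * k + 1 - n) \<le> k + 1" by linarith
    then show "d k \<le> 1" by (simp add: d_def)
  qed
  \<comment> \<open>A set will be a dropper if its colour, one of n, is below \<open>r k\<close>. So
    p k is (1 - \<beta>/2) d k rounded down to a multiple of 1/n; this costs at most \<beta>/4 d k,
    as d k >= 2h/n and \<beta> h >= 2. Aiming below d k leaves room for upward fluctuations.\<close>
  define r where "r k = nat \<lfloor>(1 - \<beta> / 2) * d k * n\<rfloor>" for k
  define p where "p k = real (r k) / n" for k
  have d0: "0 \<le> d k" for k by (simp add: d_def)
  have p: "p k \<le> (1 - \<beta> / 2) * d k" "(1 - 3 * \<beta> / 4) * d k \<le> p k" "r k \<le> n"
    if k: "k \<in> {lo..<hi}" for k
  proof -
    have nn: "0 \<le> (1 - \<beta> / 2) * d k * n" using beta d0 by simp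
    have r: "real (r k) \<le> (1 - \<beta> / 2) * d k * n" "(1 - \<beta> / 2) * d k * n - 1 \<le> real (r k)"
      unfolding r_def using nn by linarith+
    then show p1: "p k \<le> (1 - \<beta> / 2) * d k" using n0 by (simp add: p_def field_simps)
    have "((1 - \<beta> / 2) * d k * n - 1) / n \<le> p k"
      unfolding p_def using r(2) by (rule divide_right_mono) simp
    then have "(1 - \<beta> / 2) * d k - 1 / n \<le> p k" using n0 by (simp add: diff_divide_distrib)
    moreover have "1 / n \<le> \<beta> / 4 * d k"
    proof -
      have "1 / n \<le> \<beta> * h / (2 * n)" using beta n0 by (simp add: field_simps)
      also have "\<dots> = \<beta> / 4 * (2 * real h / n)" by simp
      also have "\<dots> \<le> \<beta> / 4 * d k" using beta d(1)[OF k] by (intro mult_left_mono) auto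
      finally show ?thesis .
    qed
    ultimately show "(1 - 3 * \<beta> / 4) * d k \<le> p k" by (simp add: algebra_simps)
    have "(1 - \<beta> / 2) * d k \<le> 1 * 1" using beta d[OF k] d0 by (intro mult_mono) auto
    then have "p k \<le> 1" using p1 by simp
    then show "r k \<le> n" using n0 by (simp add: p_def)
  qed
  define V where "V = (\<Union>k\<in>{lo..<hi}. level n k)"
  \<comment> \<open>Tests with k' = k + 1 limit the droppers below one set, as
    \<open>layer_matching\<close> requires; tests with k' in Tg guarantee enough droppers below
    every set of a target level.\<close>
  define J where "J = (SIGMA k:{lo..<hi}. SIGMA k':{k'\<in>insert (k + 1) Tg. k < k'}. level n k')"
  define T where "T = (\<lambda>(k::nat, k'::nat, y). {x\<in>level n k. x \<subseteq> y})"
  define B where "B = (\<lambda>(k, k'::nat, y::nat set). {..<r k})"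
  have cardT: "card (T (k, k', y)) = k' choose k" if "(k, k', y) \<in> J" for k k' y
    using that by (auto simp: T_def J_def intro: card_below)
  have "\<exists>\<phi>\<in>PiE V (\<lambda>_. {..<n}). \<forall>j\<in>J.
      (1 - \<beta> / 4) * (card (B j) / card {..<n} * card (T j)) < card {v\<in>T j. \<phi> v \<in> B j} \<and>
      card {v\<in>T j. \<phi> v \<in> B j} < (1 + \<beta> / 4) * (card (B j) / card {..<n} * card (T j))"
  proof (rule balanced_colouring[where \<theta> = \<theta>])
    show "finite V" by (simp add: V_def)
    show "finite J" using Tg by (auto simp: J_def intro!: finite_SigmaI)
    show "0 < \<theta>" using beta h0 n0 by (simp add: theta)
    have "\<beta>\<^sup>2 * h \<le> 1 * real n" using beta h by (intro mult_mono) (auto intro: power_le_one)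
    then show "\<theta> \<le> 1" using n0 by (simp add: theta field_simps)
    fix j assume "j \<in> J"
    then obtain k k' y where j: "j = (k, k', y)" "(k, k', y) \<in> J" by (metis prod_cases3)
    then have k: "k \<in> {lo..<hi}" by (auto simp: J_def)
    show "T j \<subseteq> V" using k by (auto simp: j T_def V_def)
    have "0 < k' choose k" using j by (intro zero_less_binomial) (auto simp: J_def)
    then show "T j \<noteq> {}" using cardT[OF j(2)] j(1) by force
    show "B j \<subseteq> {..<n}" using p(3)[OF k] by (auto simp: j B_def)
    \<comment> \<open>Origin of 128: the deviation \<beta>/4 gives \<beta>^2/16, the probability
      satisfies p k >= d k/4 >= h/(2n), and the Chernoff exponent contributes 1/4.\<close>
    have "\<theta> = (\<beta> / 4)\<^sup>2 * (2 * real h / n / 4) / 4" by (simp add: theta power2_eq_square field_simps)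
    also have "\<dots> \<le> (\<beta> / 4)\<^sup>2 * (p k) / 4"
    proof (intro divide_right_mono mult_left_mono)
      have "2 * real h / n / 4 \<le> (1 - 3 / 4) * d k" using d(1)[OF k] by simp
      also have "\<dots> \<le> (1 - 3 * \<beta> / 4) * d k" using beta d0 by (intro mult_right_mono) auto
      finally show "2 * real h / n / 4 \<le> p k" using p(2)[OF k] by linarith
    qed auto
    finally show "\<theta> \<le> (\<beta> / 4)\<^sup>2 * (card (B j) / card {..<n}) / 4" by (simp add: j B_def p_def)
  next
    have th0: "\<theta> > 0" using beta h0 n0 by (simp add: theta)
    fix v assume "v \<in> V"
    then obtain k where k: "k \<in> {lo..<hi}" "v \<in> level n k" by (auto simp: V_def)
    define Q where "Q = {k'\<in>insert (k + 1) Tg. k < k'}"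
    have Q: "finite Q" "card Q \<le> card Tg + 1"
      using Tg card_mono[of "insert (k + 1) Tg" Q] card_insert_le_m1[of "card Tg + 1" Tg "k + 1"]
      by (auto simp: Q_def intro: le_trans)
    have "(\<Sum>j | j \<in> J \<and> v \<in> T j. exp (- \<theta> * card (T j) / 2)) \<le> card Q * (4 / \<theta> * exp (- \<theta> * n / 12))"
    proof (rule sum_grouped_le[where key = "\<lambda>(k, k', y). k'" and
          c = "\<lambda>k'. real (k' choose k)" and e = "\<lambda>k'. exp (- \<theta> * (k' choose k) / 2)"])
      show "finite {j \<in> J. v \<in> T j}" using Tg by (auto simp: J_def)
      have jk: "j \<in> J \<Longrightarrow> v \<in> T j \<Longrightarrow> fst j = k" for j using k by (auto simp: T_def level_def)
      show "(\<lambda>(k, k', y). k') ` {j \<in> J. v \<in> T j} \<subseteq> Q"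
      proof clarify
        fix a b c assume "(a, b, c) \<in> J" "v \<in> T (a, b, c)"
        then show "b \<in> Q" using jk[of "(a, b, c)"] by (auto simp: J_def Q_def)
      qed
      show "exp (- \<theta> * card (T j) / 2) \<le> exp (- \<theta> * ((case j of (k, k', y) \<Rightarrow> k') choose k) / 2)"
        if "j \<in> {j \<in> J. v \<in> T j}" for j
        using that jk[of j] cardT by (cases j) auto
      fix k' assume k': "k' \<in> Q"
      then have kk': "k < k'" "k' \<le> hi" using Tg(2) k by (auto simp: Q_def)
      have "card {j \<in> {j \<in> J. v \<in> T j}. (case j of (k, k', y) \<Rightarrow> k') = k'}
          \<le> card {y\<in>level n k'. v \<subseteq> y}"
      proof (rule card_inj_on_le[where f = "\<lambda>(k, k', y). y"])
        show "inj_on (\<lambda>(k, k', y). y) {j \<in> {j \<in> J. v \<in> T j}. (case j of (k, k', y) \<Rightarrow> k') = k'}"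
        proof (rule inj_onI)
          fix i j
          assume "i \<in> {j \<in> {j \<in> J. v \<in> T j}. (case j of (k, k', y) \<Rightarrow> k') = k'}"
            "j \<in> {j \<in> {j \<in> J. v \<in> T j}. (case j of (k, k', y) \<Rightarrow> k') = k'}"
            "(case i of (k, k', y) \<Rightarrow> y) = (case j of (k, k', y) \<Rightarrow> y)"
          then show "i = j" using jk[of i] jk[of j] by (cases i, cases j) auto
        qed
      qed (auto simp: J_def T_def)
      \<comment> \<open>The number of tests with target level k' through v. As n - k <= k', it is at
        most their size k' choose k.\<close>
      also have "\<dots> = (n - k) choose (k' - k)" using k kk' by (intro card_above) auto
      also have "\<dots> \<le> k' choose (k' - k)"
        using k kk' lo by (intro binomial_right_mono) auto
      also have "\<dots> = k' choose k" using kk' by (intro binomial_symmetric[symmetric]) auto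
      finally show "real (card {j \<in> {j \<in> J. v \<in> T j}. (case j of (k, k', y) \<Rightarrow> k') = k'}) \<le> real (k' choose k)"
        by simp
      \<comment> \<open>The resulting lower bound n/3 for the test size is the source of n/12 in
        \<open>crit\<close>.\<close>
      have "k' \<le> k' choose k" using kk' k lo by (intro le_binomial) auto
      moreover have "n \<le> 3 * k'" using kk' k lo by auto
      ultimately have "real n / 3 \<le> real (k' choose k)" by linarith
      from times_exp_le[OF th0 this]
      show "real (k' choose k) * exp (- \<theta> * (k' choose k) / 2) \<le> 4 / \<theta> * exp (- \<theta> * n / 12)"
        by simp
    qed (use Q th0 in auto)
    also have "\<dots> \<le> (card Tg + 1) * (4 / \<theta> * exp (- \<theta> * n / 12))"
      using Q th0 by (intro mult_right_mono) auto
    finally show "(\<Sum>j | j \<in> J \<and> v \<in> T j. exp (- \<theta> * card (T j) / 2)) \<le> \<theta> / 8" using crit by linarith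
  qed (use n0 beta in auto)
  then obtain \<phi> where phi: "\<And>k k' y. (k, k', y) \<in> J \<Longrightarrow>
      (1 - \<beta> / 4) * (p k * (k' choose k)) < card {v\<in>level n k. v \<subseteq> y \<and> \<phi> v < r k} \<and>
      card {v\<in>level n k. v \<subseteq> y \<and> \<phi> v < r k} < (1 + \<beta> / 4) * (p k * (k' choose k))"
    using cardT by (fastforce simp: T_def B_def p_def conj_assoc)
  define D where "D k = {v\<in>level n k. \<phi> v < r k}" for k
  have Dy: "{x\<in>D k. x \<subseteq> y} = {v\<in>level n k. v \<subseteq> y \<and> \<phi> v < r k}" for k y by (auto simp: D_def)
  show ?thesis
  proof (rule that[of D])
    show "D k \<subseteq> level n k" for k by (auto simp: D_def)
  next
    fix k y assume k: "k \<in> {lo..<hi}" and y: "y \<in> level n (k + 1)"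
    have "(k, k + 1, y) \<in> J" using k y by (auto simp: J_def)
    then have "card {x\<in>D k. x \<subseteq> y} < (1 + \<beta> / 4) * (p k * (k + 1))" using phi[of k "k + 1" y] by (simp add: Dy)
    also have "\<dots> \<le> (1 + \<beta> / 4) * ((1 - \<beta> / 2) * d k * (k + 1))"
      using beta p(1)[OF k] by (intro mult_left_mono mult_right_mono) auto
    also have "\<dots> = ((1 + \<beta> / 4) * (1 - \<beta> / 2)) * (d k * (k + 1))" by simp
    also have "\<dots> \<le> 1 * (d k * (k + 1))"
      using beta d0 by (intro mult_right_mono) (auto simp: algebra_simps)
    also have "\<dots> = real (2 * k + 1 - n)" by (simp add: d_def)
    finally show "card {x\<in>D k. x \<subseteq> y} \<le> 2 * k + 1 - n" by simp
  next
    fix k k' y assume k: "k \<in> {lo..<hi}" and k': "k' \<in> Tg" "k < k'" and y: "y \<in> level n k'"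
    have "(1 - \<beta>) * d k \<le> ((1 - \<beta> / 4) * (1 - 3 * \<beta> / 4)) * d k"
      using d0 by (intro mult_right_mono) (auto simp: algebra_simps)
    also have "\<dots> \<le> (1 - \<beta> / 4) * p k"
      using p(2)[OF k] beta by (simp add: mult_left_mono mult.assoc)
    finally have "(1 - \<beta>) * d k * (k' choose k) \<le> (1 - \<beta> / 4) * p k * (k' choose k)"
      by (rule mult_right_mono) simp
    also have "\<dots> \<le> card {x\<in>D k. x \<subseteq> y}"
      using phi[of k k' y] k k' y by (auto simp: J_def Dy)
    finally show "(1 - \<beta>) * (real (2 * k + 1 - n) / real (k + 1)) * (k' choose k) \<le> card {x\<in>D k. x \<subseteq> y}"
      by (simp add: d_def)
  qed
qed

text \<open>Every inclusion gets weight 1/(n - k). A lower set has n - k supersets, so its load is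
  at most 1; an upper set keeps at least (k + 1) - (2k + 1 - n) = n - k subsets outside D, so it is
  covered.\<close>

lemma layer_matching:
  assumes k: "k < n" "n \<le> 2 * k + 1" and D: "D \<subseteq> level n k"
    and few: "\<And>y. y \<in> level n (k + 1) \<Longrightarrow> card {x\<in>D. x \<subseteq> y} \<le> 2 * k + 1 - n"
  shows "\<exists>f. inj_on f (level n (k + 1)) \<and> (\<forall>y\<in>level n (k + 1). f y \<in> level n k - D \<and> f y \<subseteq> y)"
proof -
  define w where "w x y = (if x \<subseteq> y then 1 / real (n - k) else 0)" for x y :: "nat set"
  have "\<exists>f. inj_on f (level n (k + 1)) \<and> (\<forall>y\<in>level n (k + 1). f y \<in> level n k - D \<and> 0 < w (f y) y)"
  proof (rule fractional_matching)
    fix y assume y: "y \<in> level n (k + 1)"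
    have "{x\<in>level n k. x \<subseteq> y} = {x\<in>level n k - D. x \<subseteq> y} \<union> {x\<in>D. x \<subseteq> y}" using D by auto
    then have "k + 1 \<le> card {x\<in>level n k - D. x \<subseteq> y} + card {x\<in>D. x \<subseteq> y}"
      using card_below[OF y, of k] card_Un_le[of "{x\<in>level n k - D. x \<subseteq> y}" "{x\<in>D. x \<subseteq> y}"] by simp
    then have "n - k \<le> card {x\<in>level n k - D. x \<subseteq> y}" using few[OF y] k by linarith
    then have "1 \<le> real (card {x\<in>level n k - D. x \<subseteq> y}) / real (n - k)" using k by simp
    also have "\<dots> = (\<Sum>x\<in>level n k - D. w x y)"
      unfolding w_def by (subst sum.If_cases) (auto simp: Int_def)
    finally show "1 \<le> (\<Sum>x\<in>level n k - D. w x y)" .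
  next
    fix x assume x: "x \<in> level n k - D"
    have "(\<Sum>y\<in>level n (k + 1). w x y) = card {y\<in>level n (k + 1). x \<subseteq> y} / real (n - k)"
      unfolding w_def by (subst sum.If_cases) (auto simp: Int_def)
    then show "(\<Sum>y\<in>level n (k + 1). w x y) \<le> 1" using card_above[of x n k "k + 1"] x by simp
  qed (auto simp: w_def)
  then show ?thesis by (auto simp: w_def split: if_splits)
qed

section \<open>Phases\<close>

text \<open>Phase 0 starts h levels above r, since next to the middle the spare fraction (2k + 1 -
  n)/(k + 1) is too small for concentration. The levels from r to \<open>rung r h 0\<close> are
  merely matched.\<close>

definition rung :: "nat \<Rightarrow> nat \<Rightarrow> nat \<Rightarrow> nat" where
  "rung r h i = r + (i + 1) * h"

lemma rung_Suc: "rung r h (Suc i) = rung r h i + h"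
  by (simp add: rung_def)

lemma rung_mono: "i \<le> j \<Longrightarrow> rung r h i \<le> rung r h j"
  by (simp add: rung_def)

lemma rung_strict_mono: "0 < h \<Longrightarrow> i < j \<Longrightarrow> rung r h i < rung r h j"
  by (simp add: rung_def)

definition phase :: "nat \<Rightarrow> nat \<Rightarrow> nat \<Rightarrow> nat" where
  "phase r h k = (k - rung r h 0) div h"

lemma phase_eqI:
  assumes "rung r h i \<le> k" "k < rung r h (Suc i)"
  shows "phase r h k = i"
proof -
  have "k - rung r h 0 = i * h + (k - rung r h i)" "k - rung r h i < h"
    using assms by (auto simp: rung_def)
  then show ?thesis by (simp add: phase_def)
qed

lemma phase_rung [simp]: "0 < h \<Longrightarrow> phase r h (rung r h i) = i"
  by (rule phase_eqI) (auto simp: rung_Suc)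

lemma rung_phase:
  assumes "0 < h" "rung r h 0 \<le> k"
  shows "rung r h (phase r h k) \<le> k" "k < rung r h (Suc (phase r h k))"
proof -
  have *: "rung r h j = rung r h 0 + j * h" for j by (simp add: rung_def)
  have "k - rung r h 0 = phase r h k * h + (k - rung r h 0) mod h" by (simp add: phase_def)
  moreover have "(k - rung r h 0) mod h < h" using assms by simp
  ultimately show "rung r h (phase r h k) \<le> k" "k < rung r h (Suc (phase r h k))"
    using assms(2) *[of "phase r h k"] *[of "Suc (phase r h k)"] unfolding mult_Suc by linarith+
qed

lemma phase_less:
  assumes "0 < h" "rung r h 0 \<le> k" "k < rung r h i"
  shows "phase r h k < i"
  using rung_phase[OF assms(1,2)] rung_mono[of i "phase r h k" r h] assms(3) by linarith

text \<open>The spare fraction of a level is exactly its relative loss of size towards the next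
  level, so droppers of full density account for all chains that have to end there.\<close>

lemma drop_times_binomial:
  assumes "k < n" "n \<le> 2 * k + 1"
  shows "real (2 * k + 1 - n) / real (k + 1) * (n choose k) = real (n choose k) - real (n choose (k + 1))"
proof -
  have "Suc k * (n choose Suc k) = (n - k) * (n choose k)"
    by (metis binomial_absorption binomial_absorb_comp)
  then have "real (k + 1) * real (n choose (k + 1)) = real (n - k) * real (n choose k)"
    by (metis Suc_eq_plus1 of_nat_mult)
  moreover have "real (2 * k + 1 - n) = real (k + 1) - real (n - k)" using assms by (simp add: of_nat_diff)
  ultimately show ?thesis by (simp add: field_simps)
qed

lemma sum_drop_binomial:
  assumes "a < b" "b \<le> n" "n \<le> 2 * a + 1"
  shows "(\<Sum>k\<in>{a..<b}. (if k + 1 = b then 1 else real (2 * k + 1 - n) / real (k + 1)) * (n choose k)) = real (n choose a)"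
proof -
  obtain c where c: "b = Suc c" "a \<le> c" using assms by (cases b) auto
  have "(\<Sum>k\<in>{a..<b}. (if k + 1 = b then 1 else real (2 * k + 1 - n) / real (k + 1)) * (n choose k))
      = (\<Sum>k\<in>{a..<c}. real (n choose k) - real (n choose (Suc k))) + (n choose c)"
    unfolding c(1) using c(2)
  proof (subst sum.atLeastLessThan_Suc, use c(2) in simp, intro arg_cong2[where f = "(+)"] sum.cong refl)
    fix k assume "k \<in> {a..<c}"
    then show "(if k + 1 = Suc c then 1 else real (2 * k + 1 - n) / real (k + 1)) * (n choose k)
        = real (n choose k) - real (n choose (Suc k))"
      using drop_times_binomial[of k n] assms c by auto
  qed simp
  also have "(\<Sum>k\<in>{a..<c}. real (n choose k) - real (n choose (Suc k))) = real (n choose a) - real (n choose c)"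
    using sum_Suc_diff'[OF c(2), of "\<lambda>k. - real (n choose k)"] by simp
  finally show ?thesis by simp
qed

text \<open>\<open>m\<close> is the downward matching that avoids the droppers D. In
  \<open>ratio\<close>, (1 - \<beta>)^2 is the supply left after two downward deviations (of the
  droppers and of their colours), and 1 + \<beta> covers the upward deviation of the coloured sets
  above an end. \<open>top\<close> keeps n - k at least n/3, so that tests looking upwards are
  large, \<open>q\<close> compares level sizes within the ladder, and \<open>crit\<close> is the
  local lemma condition for colouring the rungs. As \<open>G 0\<close> contains all colours, every
  colour has an earlier phase to continue from.\<close>

locale ladder =
  fixes n r h K M :: nat and \<beta> q :: real and G :: "nat \<Rightarrow> nat set"
    and D :: "nat \<Rightarrow> nat set set" and m :: "nat set \<Rightarrow> nat set"
  assumes r: "n \<le> 2 * r + 1" and h: "0 < h" and top: "3 * rung r h (Suc K) \<le> 2 * n"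
    and beta: "0 < \<beta>" "\<beta> < 1" and M: "0 < M"
    and G: "\<And>i. i \<le> K \<Longrightarrow> G i \<subseteq> {..<M}" "\<And>i. i \<le> K \<Longrightarrow> G i \<noteq> {}" "G 0 = {..<M}"
    and ratio: "\<And>i i'. i < i' \<Longrightarrow> i' \<le> K \<Longrightarrow>
      (1 + \<beta>) * ((n choose rung r h i') / card (G i')) \<le> (1 - \<beta>)\<^sup>2 * ((n choose rung r h i) / card (G i))"
    and q: "0 < q" "q \<le> 1"
      "\<And>k i. rung r h 0 \<le> k \<Longrightarrow> k < rung r h i \<Longrightarrow> i \<le> K \<Longrightarrow> q * (n choose k) \<le> (n choose rung r h i)"
    and D: "\<And>k. rung r h 0 \<le> k \<Longrightarrow> k < rung r h (Suc K) \<Longrightarrow> D k \<subseteq> level n k"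
      "\<And>k i y. rung r h 0 \<le> k \<Longrightarrow> k < rung r h i \<Longrightarrow> i \<le> K \<Longrightarrow> y \<in> level n (rung r h i) \<Longrightarrow>
        (1 - \<beta>) * (real (2 * k + 1 - n) / real (k + 1)) * (rung r h i choose k) \<le> card {x\<in>D k. x \<subseteq> y}"
    and m_inj: "\<And>k. r \<le> k \<Longrightarrow> k < n \<Longrightarrow> inj_on m (level n (k + 1))"
    and m: "\<And>k x. r \<le> k \<Longrightarrow> x \<in> level n (k + 1) \<Longrightarrow> m x \<in> level n k \<and> m x \<subseteq> x"
    and mD: "\<And>k x. rung r h 0 \<le> k \<Longrightarrow> k < rung r h (Suc K) \<Longrightarrow> x \<in> level n (k + 1) \<Longrightarrow> m x \<notin> D k"
    and crit: "2 * (K * h) * K * M * (4 / (\<beta>\<^sup>2 / (4 * M) * ((1 - \<beta>) * (2 * h / n)) * q) *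
      exp (- (\<beta>\<^sup>2 / (4 * M) * ((1 - \<beta>) * (2 * h / n))) * n / 12)) \<le> \<beta>\<^sup>2 / (4 * M) / 8"
begin

abbreviation "kk \<equiv> rung r h"
abbreviation "ph \<equiv> phase r h"

text \<open>\<open>st x\<close> is the set where the segment through \<open>x\<close> enters the phase of \<open>x\<close>. The sets in
  \<open>ends k\<close> are those from which a chain may jump to a later phase: the droppers, and everything
  on the last level of a phase. They have density about \<open>dens k\<close>, and these densities telescope
  (lemma \<open>sum_dens\<close>), so nearly every chain of a phase can be continued.\<close>

definition st :: "nat set \<Rightarrow> nat set" where
  "st x = (m ^^ (card x - kk (ph (card x)))) x"

definition ends :: "nat \<Rightarrow> nat set set" where
  "ends k = (if k + 1 = kk (Suc (ph k)) then level n k else D k)"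

definition dens :: "nat \<Rightarrow> real" where
  "dens k = (if k + 1 = kk (Suc (ph k)) then 1 else real (2 * k + 1 - n) / real (k + 1))"

lemma kk_le: "i \<le> Suc K \<Longrightarrow> 3 * kk i \<le> 2 * n"
  using top rung_mono[of i "Suc K" r h] by linarith

lemma kk0: "r < kk i"
  using h by (simp add: rung_def)

lemma n0: "0 < n"
  using top kk0[of "Suc K"] by (cases n) auto

lemma kk0_le: "kk 0 \<le> kk i"
  by (rule rung_mono) simp

lemma iter_m:
  "r \<le> k \<Longrightarrow> k + j \<le> n \<Longrightarrow> inj_on (m ^^ j) (level n (k + j)) \<and>
    (\<forall>x\<in>level n (k + j). (m ^^ j) x \<in> level n k \<and> (m ^^ j) x \<subseteq> x)"
proof (induction j)
  case (Suc j)
  have 1: "inj_on m (level n (k + Suc j))" using m_inj[of "k + j"] Suc.prems by simp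
  have 2: "m x \<in> level n (k + j) \<and> m x \<subseteq> x" if "x \<in> level n (k + Suc j)" for x
    using m[of "k + j" x] Suc.prems that by simp
  have IH: "inj_on (m ^^ j) (level n (k + j))"
    "\<And>x. x \<in> level n (k + j) \<Longrightarrow> (m ^^ j) x \<in> level n k \<and> (m ^^ j) x \<subseteq> x"
    using Suc by auto
  have "inj_on ((m ^^ j) \<circ> m) (level n (k + Suc j))"
    using 1 2 IH(1) by (intro comp_inj_on) (auto intro: inj_on_subset)
  then show ?case using 2 IH(2) unfolding funpow_Suc_right by fastforce
qed auto

lemma st_level:
  assumes "kk 0 \<le> k" "k < kk (Suc K)"
  shows "inj_on st (level n k)" "\<And>x. x \<in> level n k \<Longrightarrow> st x \<in> level n (kk (ph k)) \<and> st x \<subseteq> x"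
proof -
  have k: "kk (ph k) \<le> k" by (rule rung_phase[OF h assms(1)])
  have kn: "k \<le> n" using assms top by linarith
  have st: "st x = (m ^^ (k - kk (ph k))) x" if "x \<in> level n k" for x
    using that by (simp add: st_def level_def)
  have *: "inj_on (m ^^ (k - kk (ph k))) (level n k) \<and>
    (\<forall>x\<in>level n k. (m ^^ (k - kk (ph k))) x \<in> level n (kk (ph k)) \<and> (m ^^ (k - kk (ph k))) x \<subseteq> x)"
    using iter_m[of "kk (ph k)" "k - kk (ph k)"] kk0[of "ph k"] k kn by simp
  show "inj_on st (level n k)" using * st by (simp cong: inj_on_cong)
  show "st x \<in> level n (kk (ph k)) \<and> st x \<subseteq> x" if "x \<in> level n k" for x
    using * that st by simp
qed

lemma st_rung: "x \<in> level n (kk i) \<Longrightarrow> st x = x"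
  using h by (simp add: st_def level_def)

lemma st_m:
  assumes "kk i < k" "k < kk (Suc i)" "x \<in> level n k"
  shows "st (m x) = st x"
proof -
  have mx: "m x \<in> level n (k - 1)" using m[of "k - 1" x] assms kk0[of i] by simp
  have "ph k = i" "ph (k - 1) = i" using assms by (auto intro!: phase_eqI)
  moreover have "k - kk i = Suc (k - 1 - kk i)" using assms by linarith
  ultimately show ?thesis using mx assms by (simp add: st_def level_def funpow_Suc_right del: funpow.simps)
qed

lemma ends_level: "kk 0 \<le> k \<Longrightarrow> k < kk (Suc K) \<Longrightarrow> ends k \<subseteq> level n k"
  using D(1) by (simp add: ends_def)

lemma st_ends:
  "kk 0 \<le> k \<Longrightarrow> k < kk (Suc K) \<Longrightarrow> x \<in> ends k \<Longrightarrow> st x \<in> level n (kk (ph k))"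
  using ends_level st_level(2) by blast

lemma dens_bounds:
  assumes "kk 0 \<le> k" "k < kk (Suc K)"
  shows "2 * h / n \<le> dens k" "0 \<le> dens k"
proof -
  have kn: "real (k + 1) \<le> n" using assms top n0 by linarith
  have "2 * h \<le> 2 * k + 1 - n" using assms r by (simp add: rung_def)
  then have "2 * real h \<le> real (2 * k + 1 - n)" by linarith
  then have "2 * h / n \<le> real (2 * k + 1 - n) / real (k + 1)"
    using kn n0 by (intro frac_le) auto
  moreover have "2 * real h / n \<le> 1"
  proof -
    have "3 * (r + h) \<le> 2 * n" using kk_le[of 0] by (simp add: rung_def)
    then have "2 * h \<le> n" using r h unfolding add_mult_distrib2 by linarith
    then show ?thesis using n0 by simp
  qed
  ultimately show "2 * h / n \<le> dens k" by (simp add: dens_def)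
  then show "0 \<le> dens k" by (simp add: dens_def)
qed

lemma ends_below:
  assumes "kk 0 \<le> k" "k < kk i" "i \<le> K" "y \<in> level n (kk i)"
  shows "(1 - \<beta>) * dens k * (kk i choose k) \<le> card {x\<in>ends k. x \<subseteq> y}"
proof (cases "k + 1 = kk (Suc (ph k))")
  case True
  then have "real (card {x\<in>ends k. x \<subseteq> y}) = real (kk i choose k)"
    using card_below[OF assms(4), of k] by (simp add: ends_def)
  then show ?thesis using True beta by (simp add: dens_def mult_left_le_one_le)
next
  case False
  then show ?thesis using D(2)[OF assms] by (simp add: dens_def ends_def)
qed

lemma sum_dens:
  assumes "i \<le> K"
  shows "(\<Sum>k\<in>{kk i..<kk (Suc i)}. dens k * (n choose k)) = real (n choose kk i)"
proof -
  have "(\<Sum>k\<in>{kk i..<kk (Suc i)}. dens k * (n choose k))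
      = (\<Sum>k\<in>{kk i..<kk (Suc i)}. (if k + 1 = kk (Suc i) then 1 else real (2 * k + 1 - n) / real (k + 1)) * (n choose k))"
  proof (rule sum.cong[OF refl])
    fix k assume "k \<in> {kk i..<kk (Suc i)}"
    then have "ph k = i" by (intro phase_eqI) auto
    then show "dens k * (n choose k) = (if k + 1 = kk (Suc i) then 1 else real (2 * k + 1 - n) / real (k + 1)) * (n choose k)"
      by (simp add: dens_def)
  qed
  also have "\<dots> = real (n choose kk i)"
    using kk_le[of "Suc i"] assms kk0[of i] r h by (intro sum_drop_binomial) (auto simp: rung_Suc)
  finally show ?thesis .
qed

text \<open>Only the sets on rungs receive independent colours; a set inside a phase inherits the
  colour of \<open>st x\<close>. Since \<open>st\<close> is injective on a level, counting ends of
  one colour amounts to counting independent colours on a rung.\<close>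

lemma colouring:
  obtains \<phi> where
    "\<And>i v. i \<le> K \<Longrightarrow> v \<in> level n (kk i) \<Longrightarrow> \<phi> v \<in> G i"
    "\<And>k i y c. kk 0 \<le> k \<Longrightarrow> k < kk i \<Longrightarrow> i \<le> K \<Longrightarrow> y \<in> level n (kk i) \<Longrightarrow> c \<in> G (ph k) \<Longrightarrow>
      (1 - \<beta>) * (card {x\<in>ends k. x \<subseteq> y} / card (G (ph k))) \<le> card {x\<in>ends k. x \<subseteq> y \<and> \<phi> (st x) = c}"
    "\<And>k i x c. kk 0 \<le> k \<Longrightarrow> k < kk i \<Longrightarrow> i \<le> K \<Longrightarrow> x \<in> level n k \<Longrightarrow> c \<in> G i \<Longrightarrow>
      card {y\<in>level n (kk i). x \<subseteq> y \<and> \<phi> y = c} \<le> (1 + \<beta>) * (((n - k) choose (kk i - k)) / card (G i))"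
proof -
  define \<theta> where "\<theta> = \<beta>\<^sup>2 / (4 * M)"
  \<comment> \<open>A lower bound for the density of ends among the subsets of a rung set, hence for
    the size of the downward tests.\<close>
  define \<tau> where "\<tau> = (1 - \<beta>) * (2 * h / n)"
  define V where "V = (\<Union>i\<le>K. level n (kk i))"
  \<comment> \<open>For b = True a test looks at the ends on level k below z on rung i, for b =
    False at the sets of rung i above z on level k; c is the colour to be counted.\<close>
  define J where "J = (SIGMA b:(UNIV :: bool set). SIGMA k:{kk 0..<kk K}. SIGMA i:{i. i \<le> K \<and> k < kk i}.
      level n (if b then kk i else k) \<times> G (if b then ph k else i))"
  define T where "T = (\<lambda>(b, k, i, z, c :: nat).
      if b then st ` {x\<in>ends k. x \<subseteq> z} else {y\<in>level n (kk i). z \<subseteq> y})"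
  define Dc where "Dc = (\<lambda>(b, k, i, z :: nat set, c :: nat). G (if b then ph k else i))"
  define B where "B = (\<lambda>(b :: bool, k :: nat, i :: nat, z :: nat set, c :: nat). {c})"
  have finG: "finite (G i)" if "i \<le> K" for i using G(1)[OF that] finite_subset by blast
  have cardG: "0 < card (G i)" "card (G i) \<le> M" if "i \<le> K" for i
    using G(1)[of i] G(2)[of i] that finG[OF that] card_mono[of "{..<M}" "G i"] by (auto simp: card_gt_0_iff)
  have theta: "0 < \<theta>" "\<theta> \<le> 1"
  proof -
    show "0 < \<theta>" using beta M by (simp add: \<theta>_def)
    have "\<beta>\<^sup>2 \<le> 1" using beta by (intro power_le_one) auto
    moreover have "1 \<le> real M" using M by linarith
    ultimately show "\<theta> \<le> 1" by (simp add: \<theta>_def divide_le_eq)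
  qed
  have tau: "0 < \<tau>" using beta h n0 by (simp add: \<tau>_def)
  have kK: "kk K < kk (Suc K)" by (rule rung_strict_mono) (use h in auto)
  have Jk: "kk 0 \<le> k" "k < kk (Suc K)" "k < kk i" "i \<le> K" "ph k < i" "z \<in> level n (if b then kk i else k)"
      "c \<in> G (if b then ph k else i)" if "(b, k, i, z, c) \<in> J" for b k i z c
    using that kK phase_less[OF h, of r k i] unfolding J_def by auto
  have cardT1: "card (T (True, k, i, z, c)) = card {x\<in>ends k. x \<subseteq> z}" if "kk 0 \<le> k" "k < kk (Suc K)" for k i z c
  proof -
    have "{x\<in>ends k. x \<subseteq> z} \<subseteq> level n k" using ends_level that by auto
    then show ?thesis using st_level(1)[OF that] by (auto simp: T_def intro!: card_image inj_on_subset[of st "level n k"])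
  qed
  have T1: "\<tau> * (kk i choose k) \<le> card (T (True, k, i, z, c))" if "(True, k, i, z, c) \<in> J" for k i z c
  proof -
    have "\<tau> * (kk i choose k) \<le> (1 - \<beta>) * dens k * (kk i choose k)"
      unfolding \<tau>_def using dens_bounds(1)[of k] beta Jk[OF that] by (intro mult_right_mono mult_left_mono) auto
    also have "\<dots> \<le> card {x\<in>ends k. x \<subseteq> z}" using Jk[OF that] by (intro ends_below) auto
    finally show ?thesis using cardT1[of k i z c] Jk[OF that] by simp
  qed
  have T2: "card (T (False, k, i, z, c)) = (n - k) choose (kk i - k)" if "(False, k, i, z, c) \<in> J" for k i z c
    using card_above[of z n k "kk i"] Jk[OF that] by (simp add: T_def)
  have cdiv: "\<tau> * \<theta> \<le> \<theta>"
  proof -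
    have "3 * (r + h) \<le> 2 * n" using kk_le[of 0] by (simp add: rung_def)
    then have "2 * h \<le> n" using r h unfolding add_mult_distrib2 by linarith
    then have "\<tau> \<le> 1 * 1" unfolding \<tau>_def using beta n0 by (intro mult_mono) auto
    then show ?thesis using theta by simp
  qed
  have finJ: "finite J"
  proof -
    have "finite (G (if b then ph k else i))" if "kk 0 \<le> k" "k < kk i" "i \<le> K" for b k i
      using finG that phase_less[OF h that(1,2)] by auto
    then show ?thesis unfolding J_def by (intro finite_SigmaI) (auto intro: finite_cartesian_product)
  qed
  have "\<exists>\<phi>\<in>PiE V (\<lambda>v. G (ph (card v))). \<forall>j\<in>J.
      (1 - \<beta>) * (card (B j) / card (Dc j) * card (T j)) < card {v\<in>T j. \<phi> v \<in> B j} \<and>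
      card {v\<in>T j. \<phi> v \<in> B j} < (1 + \<beta>) * (card (B j) / card (Dc j) * card (T j))"
  proof (rule balanced_colouring[OF _ _ _ _ _ _ _ _ _ _ theta])
    show "finite V" by (simp add: V_def)
    have phV: "ph (card v) \<le> K" if "v \<in> V" for v using that h by (auto simp: V_def level_def)
    show "finite (G (ph (card v)))" "G (ph (card v)) \<noteq> {}" if "v \<in> V" for v
      using finG G(2) phV[OF that] by auto
    show "finite J" by (rule finJ)
    fix j assume "j \<in> J"
    moreover obtain b k i z c where j: "j = (b, k, i, z, c)" by (metis prod_cases5)
    ultimately have jJ: "(b, k, i, z, c) \<in> J" by simp
    note J = Jk[OF jJ]
    show "T j \<subseteq> V"
      using J st_ends[of k] by (cases b) (auto simp: j T_def V_def intro!: bexI[of _ "ph k"])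
    have "0 < card (T j)"
    proof (cases b)
      case True
      have "0 < \<tau> * (kk i choose k)" using tau J by simp
      then show ?thesis using T1[of k i z c] jJ True by (simp add: j)
    next
      case False
      have "kk i \<le> n" using kk_le[of i] J by linarith
      then have "0 < (n - k) choose (kk i - k)" using J by simp
      then show ?thesis using T2[of k i z c] jJ False by (simp add: j)
    qed
    then show "T j \<noteq> {}" by force
    show "G (ph (card v)) = Dc j" if "v \<in> T j" for v
    proof (cases b)
      case True
      then have "\<exists>x. x \<in> ends k \<and> v = st x" using that by (auto simp: j T_def)
      then obtain x where "x \<in> ends k" "v = st x" by blast
      then have "card v = kk (ph k)" using st_ends[of k x] J by (auto simp: level_def)
      then show ?thesis using True h by (simp add: j Dc_def)
    next
      case False
      then show ?thesis using that h by (auto simp: j T_def Dc_def level_def)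
    qed
    show "B j \<subseteq> Dc j" using J by (simp add: j B_def Dc_def)
    have "card (Dc j) \<le> M" "0 < card (Dc j)" using J cardG by (auto simp: j Dc_def)
    then have "\<beta>\<^sup>2 * (1 / M) / 4 \<le> \<beta>\<^sup>2 * (1 / card (Dc j)) / 4"
      by (intro divide_right_mono mult_left_mono divide_left_mono) auto
    then show "\<theta> \<le> \<beta>\<^sup>2 * (card (B j) / card (Dc j)) / 4" by (simp add: \<theta>_def j B_def mult.commute)
  next
    fix v assume "v \<in> V"
    then obtain i0 where i0: "i0 \<le> K" "v \<in> level n (kk i0)" by (auto simp: V_def)
    define b0 where "b0 = 4 / (\<theta> * \<tau> * q) * exp (- (\<theta> * \<tau>) * n / 12)"
    \<comment> \<open>The types of tests: direction, level, rung and colour. A rung above a level of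
      some phase has index at least 1, so there are 2 (K h) K M types, the factor in
      \<open>crit\<close>.\<close>
    define Q where "Q = (UNIV :: bool set) \<times> {kk 0..<kk K} \<times> {1..K} \<times> {..<M}"
    have cardQ: "card Q = 2 * (K * h) * K * M"
      by (simp add: Q_def card_cartesian_product rung_def card_UNIV_bool)
    define t where "t k i = ((n - k) choose (kk i - k))" for k i
    define c where "c = (\<lambda>(b :: bool, k, i, col :: nat). if k < kk i then real (kk i choose k) else 0)"
    define e where "e = (\<lambda>(b, k, i, col :: nat).
        if b then exp (- \<theta> * (\<tau> * (kk i choose k)) / 2) else exp (- \<theta> * t k i / 2))"
    have q_pos: "0 < \<theta> * \<tau> * q" using theta tau q by simp
    have jt: "(b \<longrightarrow> (\<exists>x\<in>ends k. v = st x \<and> x \<subseteq> z)) \<and> (\<not> b \<longrightarrow> kk i = kk i0 \<and> z \<subseteq> v)"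
      if "v \<in> T (b, k, i, z, c)" for b k i z c
      using that i0 by (auto simp: T_def level_def split: if_splits)
    have "(\<Sum>j | j \<in> J \<and> v \<in> T j. exp (- \<theta> * card (T j) / 2)) \<le> card Q * b0"
    proof (rule sum_grouped_le[where key = "\<lambda>(b, k, i, z, c). (b, k, i, c)" and c = c and e = e])
      show "finite {j \<in> J. v \<in> T j}" using finJ by simp
      show "finite Q" by (simp add: Q_def)
      show "(\<lambda>(b, k, i, z, c). (b, k, i, c)) ` {j \<in> J. v \<in> T j} \<subseteq> Q"
      proof clarify
        fix b k i z c assume j: "(b, k, i, z, c) \<in> J"
        have "(if b then ph k else i) \<le> K" using Jk[OF j] by simp
        then have "c < M" using Jk(7)[OF j] G(1) by blast
        then show "(b, k, i, c) \<in> Q" using Jk[OF j] j by (auto simp: Q_def J_def)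
      qed
      show "0 \<le> b0" unfolding b0_def using q_pos by simp
      show "exp (- \<theta> * card (T j) / 2) \<le> e (case j of (b, k, i, z, c) \<Rightarrow> (b, k, i, c))"
        if "j \<in> {j \<in> J. v \<in> T j}" for j
      proof -
        obtain b k i z c where j: "j = (b, k, i, z, c)" by (metis prod_cases5)
        show ?thesis
        proof (cases b)
          case True
          then have "\<theta> * (\<tau> * (kk i choose k)) \<le> \<theta> * card (T j)"
            using T1[of k i z c] that theta by (intro mult_left_mono) (auto simp: j)
          then show ?thesis using True by (simp add: j e_def)
        next
          case False
          then show ?thesis using T2[of k i z c] that by (simp add: j e_def t_def)
        qed
      qed
      fix x assume x: "x \<in> Q"
      obtain b k i col where xx: "x = (b, k, i, col)" by (metis prod_cases4)
      show "0 \<le> e x" by (simp add: xx e_def)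
      show "real (card {j \<in> {j \<in> J. v \<in> T j}. (case j of (b, k, i, z, c) \<Rightarrow> (b, k, i, c)) = x}) \<le> c x"
      proof (cases "k < kk i \<and> i \<le> K \<and> (b \<longrightarrow> (\<exists>x\<in>ends k. v = st x))  \<and> (\<not> b \<longrightarrow> kk i = kk i0)")
        case True
        have k: "kk 0 \<le> k" "k < kk (Suc K)" using x xx kK by (auto simp: Q_def)
        have "\<exists>Z. card Z \<le> kk i choose k \<and> finite Z \<and>
            (\<forall>z. (b, k, i, z, col) \<in> J \<longrightarrow> v \<in> T (b, k, i, z, col) \<longrightarrow> z \<in> Z)"
        proof (cases b)
          case b: True
          \<comment> \<open>On level k only one set u starts at v, so the tests through v belong to
            the supersets of u on the rung. As n - k <= kk i, their number is at most
            \<open>kk i choose k\<close>.\<close>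
          then obtain u where u: "u \<in> ends k" "v = st u" using True by auto
          then have uk: "u \<in> level n k" using ends_level[OF k] by auto
          have "card {y\<in>level n (kk i). u \<subseteq> y} = (n - k) choose (kk i - k)"
            using uk True by (intro card_above) auto
          also have "\<dots> \<le> kk i choose (kk i - k)" using k True r kk0[of 0] by (intro binomial_right_mono) auto
          also have "\<dots> = kk i choose k" using True by (intro binomial_symmetric[symmetric]) auto
          finally have "card {y\<in>level n (kk i). u \<subseteq> y} \<le> kk i choose k" .
          moreover have "z \<in> {y\<in>level n (kk i). u \<subseteq> y}"
            if j: "(b, k, i, z, col) \<in> J" "v \<in> T (b, k, i, z, col)" for z
          proof -
            obtain u' where u': "u' \<in> ends k" "v = st u'" "u' \<subseteq> z" using jt[OF j(2)] b by auto
            have "u' \<in> level n k" using u'(1) ends_level[OF k] by blast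
            then have "u' = u" using inj_onD[OF st_level(1)[OF k], of u' u] u u' uk by simp
            then show ?thesis using u'(3) Jk(6)[OF j(1)] b by simp
          qed
          ultimately show ?thesis by (intro exI[of _ "{y\<in>level n (kk i). u \<subseteq> y}"]) auto
        next
          case b: False
          have v: "v \<in> level n (kk i)" using True b i0 by auto
          show ?thesis
          proof (intro exI conjI allI impI)
            show "card {x\<in>level n k. x \<subseteq> v} \<le> kk i choose k" using card_below[OF v] by simp
            fix z assume j: "(b, k, i, z, col) \<in> J" "v \<in> T (b, k, i, z, col)"
            show "z \<in> {x\<in>level n k. x \<subseteq> v}" using jt[OF j(2)] Jk(6)[OF j(1)] b by simp
          qed auto
        qed
        then obtain Z where Z: "card Z \<le> kk i choose k" "finite Z"
          "\<And>z. (b, k, i, z, col) \<in> J \<Longrightarrow> v \<in> T (b, k, i, z, col) \<Longrightarrow> z \<in> Z" by blast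
        have "card {j \<in> {j \<in> J. v \<in> T j}. (case j of (b, k, i, z, c) \<Rightarrow> (b, k, i, c)) = x} \<le> card Z"
          using Z by (intro card_inj_on_le[where f = "\<lambda>(b, k, i, z, c). z"] inj_onI) (auto simp: xx)
        then show ?thesis using Z(1) True by (simp add: c_def xx)
      next
        case False
        have none: "{j \<in> {j \<in> J. v \<in> T j}. (case j of (b, k, i, z, c) \<Rightarrow> (b, k, i, c)) = x} = {}"
        proof (rule equals0I)
          fix j assume "j \<in> {j \<in> {j \<in> J. v \<in> T j}. (case j of (b, k, i, z, c) \<Rightarrow> (b, k, i, c)) = x}"
          then obtain z where "(b, k, i, z, col) \<in> J" "v \<in> T (b, k, i, z, col)"
            by (cases j) (auto simp: xx)
          then show False using False Jk(3,4) jt by meson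
        qed
        show ?thesis unfolding none by (simp add: c_def xx)
      qed
      show "c x * e x \<le> b0"
      proof (cases "k < kk i")
        case False
        then show ?thesis using q_pos by (simp add: c_def xx b0_def)
      next
        case ki: True
        have k: "kk 0 \<le> k" "i \<le> K" using x xx by (auto simp: Q_def)
        have kin: "3 * kk i \<le> 2 * n" using kk_le[of i] k by simp
        show ?thesis
        proof (cases b)
          case True
          have "kk i \<le> kk i choose k" using ki k kk0[of 0] by (intro le_binomial) auto
          moreover have "n \<le> 3 * kk i" using ki k r kk0[of 0] by linarith
          ultimately have "real n / 3 \<le> real (kk i choose k)" by linarith
          from times_exp_le[OF mult_pos_pos[OF theta(1) tau] this]
          have "c x * e x \<le> 4 / (\<theta> * \<tau>) * exp (- (\<theta> * \<tau>) * n / 12)"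
            using True ki by (simp add: c_def e_def xx mult_ac)
          also have "\<dots> \<le> b0" unfolding b0_def
            using q q_pos theta tau by (intro mult_right_mono divide_left_mono) (auto simp: mult_left_le)
          finally show ?thesis .
        next
          case False
          \<comment> \<open>Upward tests may be smaller than the number of them through v. Counting
            inclusions between the two levels shows that the quotient is the quotient of the level
            sizes, which q bounds from below.\<close>
          have id: "(n choose kk i) * (kk i choose k) = (n choose k) * t k i"
            unfolding t_def using ki kin by (intro choose_mult) auto
          have npos: "0 < real (n choose k)" using ki kin by simp
          have "q * (kk i choose k) * (n choose k) \<le> (n choose kk i) * (kk i choose k)"
            using mult_right_mono[OF q(3)[OF k(1) ki k(2)], of "real (kk i choose k)"] by (simp add: mult_ac)
          also have "\<dots> = t k i * real (n choose k)" using id by (metis mult.commute of_nat_mult)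
          finally have "q * (kk i choose k) \<le> t k i" using npos by (simp add: mult_le_cancel_right)
          then have ct: "c x \<le> t k i / q" using q ki by (simp add: c_def xx field_simps)
          have "n - k \<le> t k i" unfolding t_def using ki kin n0 by (intro le_binomial) auto
          moreover have "n \<le> 3 * (n - k)" using ki kin by linarith
          ultimately have "real n / 3 \<le> t k i" by linarith
          from times_exp_le[OF theta(1) this]
          have te: "t k i * e x \<le> 4 / \<theta> * exp (- \<theta> * n / 12)" using False by (simp add: e_def xx)
          have "c x * e x \<le> t k i / q * e x" using ct by (intro mult_right_mono) (auto simp: e_def xx)
          also have "\<dots> \<le> (4 / \<theta> * exp (- \<theta> * n / 12)) / q" using divide_right_mono[OF te, of q] q(1) by simp
          also have "\<dots> = 4 / (\<theta> * q) * exp (- \<theta> * n / 12)" by simp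
          also have "\<dots> \<le> b0" unfolding b0_def
          proof (intro mult_mono)
            show "4 / (\<theta> * q) \<le> 4 / (\<theta> * \<tau> * q)"
            proof (rule divide_left_mono)
              show "\<theta> * \<tau> * q \<le> \<theta> * q" using cdiv q(1) by (simp add: mult.commute mult_right_mono)
              show "0 < \<theta> * q * (\<theta> * \<tau> * q)" using tau theta(1) q(1) by (intro mult_pos_pos) auto
            qed simp
            show "exp (- \<theta> * n / 12) \<le> exp (- (\<theta> * \<tau>) * n / 12)"
              using mult_right_mono[OF cdiv, of "real n"] by (simp add: mult_ac)
          qed (use q_pos in auto)
          finally show ?thesis .
        qed
      qed
    qed
    also have "card Q * b0 \<le> \<theta> / 8"
      using crit unfolding cardQ b0_def \<theta>_def \<tau>_def by simp
    finally show "(\<Sum>j | j \<in> J \<and> v \<in> T j. exp (- \<theta> * card (T j) / 2)) \<le> \<theta> / 8" .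
  qed (use beta in auto)
  then obtain \<phi> where phi: "\<phi> \<in> PiE V (\<lambda>v. G (ph (card v)))" "\<And>j. j \<in> J \<Longrightarrow>
      (1 - \<beta>) * (card (B j) / card (Dc j) * card (T j)) < card {v\<in>T j. \<phi> v \<in> B j} \<and>
      card {v\<in>T j. \<phi> v \<in> B j} < (1 + \<beta>) * (card (B j) / card (Dc j) * card (T j))" by blast
  show ?thesis
  proof (rule that[of \<phi>])
    fix i v assume "i \<le> K" "v \<in> level n (kk i)"
    then show "\<phi> v \<in> G i" using phi(1) h by (auto simp: V_def level_def PiE_def Pi_def)
  next
    fix k i y c assume k: "kk 0 \<le> k" "k < kk i" "i \<le> K" "y \<in> level n (kk i)" "c \<in> G (ph k)"
    have kK': "k < kk K" "k < kk (Suc K)" using k rung_mono[of i K r h] kK by auto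
    have j: "(True, k, i, y, c) \<in> J" using k kK' by (auto simp: J_def)
    have "{v\<in>T (True, k, i, y, c). \<phi> v \<in> B (True, k, i, y, c)} = st ` {x\<in>ends k. x \<subseteq> y \<and> \<phi> (st x) = c}"
      by (auto simp: T_def B_def)
    moreover have "card (st ` {x\<in>ends k. x \<subseteq> y \<and> \<phi> (st x) = c}) = card {x\<in>ends k. x \<subseteq> y \<and> \<phi> (st x) = c}"
      using ends_level[OF k(1) kK'(2)]
      by (intro card_image inj_on_subset[OF st_level(1)[OF k(1) kK'(2)]]) auto
    ultimately show "(1 - \<beta>) * (card {x\<in>ends k. x \<subseteq> y} / card (G (ph k))) \<le> card {x\<in>ends k. x \<subseteq> y \<and> \<phi> (st x) = c}"
      using phi(2)[OF j] cardT1[OF k(1) kK'(2), of i y c] by (simp add: B_def Dc_def)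
  next
    fix k i x c assume k: "kk 0 \<le> k" "k < kk i" "i \<le> K" "x \<in> level n k" "c \<in> G i"
    have kK': "k < kk K" "k < kk (Suc K)" using k rung_mono[of i K r h] kK by auto
    have j: "(False, k, i, x, c) \<in> J" using k kK' by (auto simp: J_def)
    have "{v\<in>T (False, k, i, x, c). \<phi> v \<in> B (False, k, i, x, c)} = {y\<in>level n (kk i). x \<subseteq> y \<and> \<phi> y = c}"
      by (auto simp: T_def B_def)
    then show "card {y\<in>level n (kk i). x \<subseteq> y \<and> \<phi> y = c} \<le> (1 + \<beta>) * (((n - k) choose (kk i - k)) / card (G i))"
      using phi(2)[OF j] T2[OF j] by (simp add: B_def Dc_def)
  qed
qed

end

context ladder
begin

text \<open>The weight of x below y is g'/((1 + \<beta>) t), where t/g' is the expected number of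
  sets of colour c above x on rung i'; hence no end is overloaded. The weight arriving at y is at
  least a constant times the sum of \<open>dens k\<close> times the level sizes over the phase. This
  sum is the size of rung i by \<open>sum_dens\<close>, and \<open>ratio\<close> makes the result at
  least 1.\<close>

lemma feed:
  assumes ii: "i < i'" "i' \<le> K" and c: "c \<in> G i" "c \<in> G i'"
    and low: "\<And>k y. kk i \<le> k \<Longrightarrow> k < kk (Suc i) \<Longrightarrow> y \<in> level n (kk i') \<Longrightarrow>
      (1 - \<beta>) * (card {x\<in>ends k. x \<subseteq> y} / card (G i)) \<le> card {x\<in>ends k. x \<subseteq> y \<and> \<phi> (st x) = c}"
    and up: "\<And>k x. kk i \<le> k \<Longrightarrow> k < kk (Suc i) \<Longrightarrow> x \<in> level n k \<Longrightarrow>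
      card {y\<in>level n (kk i'). x \<subseteq> y \<and> \<phi> y = c} \<le> (1 + \<beta>) * (((n - k) choose (kk i' - k)) / card (G i'))"
  shows "\<exists>f. inj_on f {y\<in>level n (kk i'). \<phi> y = c} \<and> (\<forall>y\<in>{y\<in>level n (kk i'). \<phi> y = c}.
      (\<exists>k\<in>{kk i..<kk (Suc i)}. f y \<in> ends k \<and> \<phi> (st (f y)) = c) \<and> f y \<subseteq> y)"
proof -
  define X where "X k = {x\<in>ends k. \<phi> (st x) = c}" for k
  define Y where "Y = {y\<in>level n (kk i'). \<phi> y = c}"
  define t where "t k = real ((n - k) choose (kk i' - k))" for k
  define g where "g = real (card (G i))"
  define g' where "g' = real (card (G i'))"
  define w where "w x y = (if x \<subseteq> y then g' / ((1 + \<beta>) * t (card x)) else 0)" for x y :: "nat set"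
  have gpos: "0 < g" "0 < g'"
    using c ii G(1)[of i] G(1)[of i'] by (auto simp: g_def g'_def card_gt_0_iff intro: finite_subset)
  have iS: "kk (Suc i) \<le> kk i'" using ii by (intro rung_mono) auto
  have kn: "3 * kk i' \<le> 2 * n" using kk_le[of i'] ii by simp
  have k: "kk 0 \<le> k" "k < kk i'" "k < kk (Suc K)" "ph k = i" "k < n" "0 < t k"
    if "k \<in> {kk i..<kk (Suc i)}" for k
  proof -
    show "kk 0 \<le> k" "k < kk i'" using that iS kk0_le[of i] by auto
    then show "k < kk (Suc K)" using rung_mono[of i' "Suc K" r h] ii by simp
    show "ph k = i" using that by (intro phase_eqI) auto
    show "k < n" "0 < t k" using \<open>k < kk i'\<close> kn by (auto simp: t_def)
  qed
  have Xk: "X k \<subseteq> level n k" if "k \<in> {kk i..<kk (Suc i)}" for k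
    using ends_level[of k] k[OF that] by (auto simp: X_def)
  have finX: "finite (X k)" if "k \<in> {kk i..<kk (Suc i)}" for k
    using Xk[OF that] finite_subset finite_level by blast
  have "\<exists>f. inj_on f Y \<and> (\<forall>y\<in>Y. f y \<in> (\<Union>k\<in>{kk i..<kk (Suc i)}. X k) \<and> 0 < w (f y) y)"
  proof (rule fractional_matching)
    show "finite (\<Union>k\<in>{kk i..<kk (Suc i)}. X k)"
      using finX by (intro finite_UN_I finite_atLeastLessThan) auto
    show "finite Y" by (simp add: Y_def)
    show "0 \<le> w x y" for x y using gpos beta by (simp add: w_def t_def)
  next
    fix x assume "x \<in> (\<Union>k\<in>{kk i..<kk (Suc i)}. X k)"
    then obtain k where kx: "k \<in> {kk i..<kk (Suc i)}" "x \<in> level n k" using Xk by blast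
    have "(\<Sum>y\<in>Y. w x y) = card {y\<in>Y. x \<subseteq> y} * (g' / ((1 + \<beta>) * t (card x)))"
      unfolding w_def by (subst sum.If_cases) (auto simp: Y_def Int_def)
    also have "{y\<in>Y. x \<subseteq> y} = {y\<in>level n (kk i'). x \<subseteq> y \<and> \<phi> y = c}" by (auto simp: Y_def)
    also have "card {y\<in>level n (kk i'). x \<subseteq> y \<and> \<phi> y = c} * (g' / ((1 + \<beta>) * t (card x)))
        \<le> (1 + \<beta>) * (t k / g') * (g' / ((1 + \<beta>) * t (card x)))"
      using up[of k x] kx gpos beta k[OF kx(1)]
      by (intro mult_right_mono) (auto simp: t_def g'_def)
    also have "\<dots> = 1" using k[OF kx(1)] kx gpos beta by (simp add: level_def)
    finally show "(\<Sum>y\<in>Y. w x y) \<le> 1" .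
  next
    fix y assume "y \<in> Y"
    then have y: "y \<in> level n (kk i')" by (simp add: Y_def)
    define a where "a k = real (n choose k)" for k
    have apos: "0 < a (kk i')" using kn by (simp add: a_def)
    \<comment> \<open>Collects the factors that do not depend on the level; by the double count
      \<open>id\<close>, level j contributes at least Z times \<open>dens j * a j\<close>.\<close>
    define Z where "Z = (1 - \<beta>)\<^sup>2 * g' / ((1 + \<beta>) * g * a (kk i'))"
    have "(1 + \<beta>) * (a (kk i') / g') \<le> (1 - \<beta>)\<^sup>2 * (a (kk i) / g)"
      using ratio[OF ii] by (simp add: a_def g_def g'_def)
    moreover have "0 < (1 + \<beta>) * (a (kk i') / g')" using gpos apos beta by simp
    ultimately have "1 \<le> ((1 - \<beta>)\<^sup>2 * (a (kk i) / g)) / ((1 + \<beta>) * (a (kk i') / g'))"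
      by (simp only: le_divide_eq_1_pos)
    also have "\<dots> = Z * a (kk i)" by (simp add: Z_def mult_ac)
    also have "\<dots> = (\<Sum>k\<in>{kk i..<kk (Suc i)}. Z * (dens k * a k))"
      using sum_dens[of i] ii by (simp add: a_def sum_distrib_left[symmetric])
    also have "\<dots> \<le> (\<Sum>k\<in>{kk i..<kk (Suc i)}. card {x\<in>X k. x \<subseteq> y} * (g' / ((1 + \<beta>) * t k)))"
    proof (rule sum_mono)
      fix j assume j: "j \<in> {kk i..<kk (Suc i)}"
      have "(n choose kk i') * (kk i' choose j) = (n choose j) * ((n - j) choose (kk i' - j))"
        using k[OF j] kn by (intro choose_mult) auto
      then have id: "a (kk i') * real (kk i' choose j) = a j * t j"
        unfolding a_def t_def by (metis of_nat_mult)
      have "Z * (dens j * a j) = ((1 - \<beta>) * ((1 - \<beta>) * dens j * (a j * t j) / g)) * (g' / ((1 + \<beta>) * t j)) / a (kk i')"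
        using k(6)[OF j] by (simp add: Z_def power2_eq_square mult_ac)
      also have "\<dots> = (1 - \<beta>) * ((1 - \<beta>) * dens j * real (kk i' choose j) / g) * (g' / ((1 + \<beta>) * t j))"
        unfolding id[symmetric] using apos by simp
      also have "\<dots> \<le> (1 - \<beta>) * (card {x\<in>ends j. x \<subseteq> y} / g) * (g' / ((1 + \<beta>) * t j))"
        using ends_below[of j i' y] k[OF j] ii y gpos beta
        by (intro mult_right_mono mult_left_mono divide_right_mono) auto
      also have "\<dots> \<le> card {x\<in>ends j. x \<subseteq> y \<and> \<phi> (st x) = c} * (g' / ((1 + \<beta>) * t j))"
        using low[of j y] j y gpos beta k[OF j] by (intro mult_right_mono) (auto simp: g_def)
      also have "{x\<in>ends j. x \<subseteq> y \<and> \<phi> (st x) = c} = {x\<in>X j. x \<subseteq> y}" by (auto simp: X_def)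
      finally show "Z * (dens j * a j) \<le> card {x\<in>X j. x \<subseteq> y} * (g' / ((1 + \<beta>) * t j))" .
    qed
    also have "\<dots> = (\<Sum>k\<in>{kk i..<kk (Suc i)}. \<Sum>x\<in>X k. w x y)"
    proof (rule sum.cong[OF refl])
      fix j assume j: "j \<in> {kk i..<kk (Suc i)}"
      have fX: "finite (X j)" by (rule finX[OF j])
      have "(\<Sum>x\<in>X j. w x y) = (\<Sum>x\<in>X j. if x \<subseteq> y then g' / ((1 + \<beta>) * t j) else 0)"
        using Xk[OF j] by (intro sum.cong refl) (auto simp: w_def level_def)
      then show "card {x\<in>X j. x \<subseteq> y} * (g' / ((1 + \<beta>) * t j)) = (\<Sum>x\<in>X j. w x y)"
        using fX by (simp add: sum.If_cases Int_def)
    qed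
    also have "\<dots> = (\<Sum>x\<in>(\<Union>k\<in>{kk i..<kk (Suc i)}. X k). w x y)"
    proof (rule sum.UNION_disjoint[symmetric])
      show "\<forall>k\<in>{kk i..<kk (Suc i)}. finite (X k)" using finX by auto
      show "\<forall>k\<in>{kk i..<kk (Suc i)}. \<forall>j\<in>{kk i..<kk (Suc i)}. k \<noteq> j \<longrightarrow> X k \<inter> X j = {}"
      proof (intro ballI impI)
        fix k j assume kj: "k \<in> {kk i..<kk (Suc i)}" "j \<in> {kk i..<kk (Suc i)}" "k \<noteq> j"
        then have "level n k \<inter> level n j = {}" by (auto simp: level_def)
        then show "X k \<inter> X j = {}" using Xk[OF kj(1)] Xk[OF kj(2)] by blast
      qed
    qed simp
    finally show "1 \<le> (\<Sum>x\<in>(\<Union>k\<in>{kk i..<kk (Suc i)}. X k). w x y)" .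
  qed
  then obtain f where f: "inj_on f Y" "\<And>y. y \<in> Y \<Longrightarrow> f y \<in> (\<Union>k\<in>{kk i..<kk (Suc i)}. X k) \<and> 0 < w (f y) y"
    by blast
  have "(\<exists>k\<in>{kk i..<kk (Suc i)}. f y \<in> ends k \<and> \<phi> (st (f y)) = c) \<and> f y \<subseteq> y" if "y \<in> Y" for y
    using f(2)[OF that] by (auto simp: X_def w_def split: if_splits)
  then show ?thesis using f(1) unfolding Y_def by blast
qed

text \<open>The predecessor of a set is its match under \<open>m\<close>, except on the rungs 1 to
  K, where a set of colour c is sent by \<open>feed\<close> to an end in the last earlier phase with
  c active. Colours are thereby constant along a chain from rung 0 on, which will bound its
  length.\<close>

lemma pred_map:
  obtains p col where
    "\<And>x. x \<subseteq> {1..n} \<Longrightarrow> r < card x \<Longrightarrow> p x \<subseteq> x \<and> r \<le> card (p x) \<and> card (p x) < card x"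
    "inj_on p {x. x \<subseteq> {1..n} \<and> r < card x}"
    "\<And>x. x \<subseteq> {1..n} \<Longrightarrow> kk 0 \<le> card x \<Longrightarrow> card x < kk (Suc K) \<Longrightarrow> col x \<in> G (ph (card x))"
    "\<And>x. x \<subseteq> {1..n} \<Longrightarrow> kk 0 < card x \<Longrightarrow> card x < kk (Suc K) \<Longrightarrow> kk 0 \<le> card (p x) \<and> col (p x) = col x"
proof -
  obtain \<phi> where phi: "\<And>i v. i \<le> K \<Longrightarrow> v \<in> level n (kk i) \<Longrightarrow> \<phi> v \<in> G i"
    and low: "\<And>k i y c. kk 0 \<le> k \<Longrightarrow> k < kk i \<Longrightarrow> i \<le> K \<Longrightarrow> y \<in> level n (kk i) \<Longrightarrow> c \<in> G (ph k) \<Longrightarrow>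
      (1 - \<beta>) * (card {x\<in>ends k. x \<subseteq> y} / card (G (ph k))) \<le> card {x\<in>ends k. x \<subseteq> y \<and> \<phi> (st x) = c}"
    and up: "\<And>k i x c. kk 0 \<le> k \<Longrightarrow> k < kk i \<Longrightarrow> i \<le> K \<Longrightarrow> x \<in> level n k \<Longrightarrow> c \<in> G i \<Longrightarrow>
      card {y\<in>level n (kk i). x \<subseteq> y \<and> \<phi> y = c} \<le> (1 + \<beta>) * (((n - k) choose (kk i - k)) / card (G i))"
    using colouring by blast
  \<comment> \<open>A maximum over a nonempty set, as \<open>G 0\<close> has every colour. Different
    active phases of one colour have different values, so an end is never claimed by two
    rungs.\<close>
  define pv where "pv i c = Max {j. j < i \<and> c \<in> G j}" for i c
  have pv: "pv i c < i" "c \<in> G (pv i c)" "\<And>j. j < i \<Longrightarrow> c \<in> G j \<Longrightarrow> j \<le> pv i c"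
    if "1 \<le> i" "i \<le> K" "c \<in> G i" for i c
  proof -
    have "0 \<in> {j. j < i \<and> c \<in> G j}" using that G(1)[OF that(2)] G(3) by auto
    then have "pv i c \<in> {j. j < i \<and> c \<in> G j}" unfolding pv_def by (intro Max_in) auto
    then show "pv i c < i" "c \<in> G (pv i c)" by auto
    show "j \<le> pv i c" if "j < i" "c \<in> G j" for j unfolding pv_def using that by (intro Max_ge) auto
  qed
  define Pf where "Pf i c f \<longleftrightarrow> inj_on f {y\<in>level n (kk i). \<phi> y = c} \<and>
      (\<forall>y\<in>{y\<in>level n (kk i). \<phi> y = c}.
      (\<exists>k\<in>{kk (pv i c)..<kk (Suc (pv i c))}. f y \<in> ends k \<and> \<phi> (st (f y)) = c) \<and> f y \<subseteq> y)" for i c f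
  have "\<exists>f. inj_on f {y\<in>level n (kk i). \<phi> y = c} \<and> (\<forall>y\<in>{y\<in>level n (kk i). \<phi> y = c}.
      (\<exists>k\<in>{kk (pv i c)..<kk (Suc (pv i c))}. f y \<in> ends k \<and> \<phi> (st (f y)) = c) \<and> f y \<subseteq> y)"
    if ic: "1 \<le> i" "i \<le> K" "c \<in> G i" for i c
  proof (rule feed)
    show "pv i c < i" "i \<le> K" "c \<in> G (pv i c)" "c \<in> G i" using pv(1,2)[OF ic] ic by auto
    fix k assume k: "kk (pv i c) \<le> k" "k < kk (Suc (pv i c))"
    have k': "kk 0 \<le> k" "k < kk i" "ph k = pv i c"
      using k kk0_le[of "pv i c"] rung_mono[of "Suc (pv i c)" i r h] pv(1)[OF ic] by (auto intro: phase_eqI)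
    show "(1 - \<beta>) * (card {x\<in>ends k. x \<subseteq> y} / card (G (pv i c))) \<le> card {x\<in>ends k. x \<subseteq> y \<and> \<phi> (st x) = c}"
      if "y \<in> level n (kk i)" for y
      using low[of k i y c] k' ic that pv(2)[OF ic] by simp
    show "card {y\<in>level n (kk i). x \<subseteq> y \<and> \<phi> y = c} \<le> (1 + \<beta>) * (((n - k) choose (kk i - k)) / card (G i))"
      if "x \<in> level n k" for x
      using up[of k i x c] k' ic that by simp
  qed
  then have ex: "\<exists>f. Pf i c f" if "1 \<le> i" "i \<le> K" "c \<in> G i" for i c
    using that unfolding Pf_def by simp
  define f where "f i c = (SOME f. Pf i c f)" for i c
  have f': "inj_on (f i c) {y\<in>level n (kk i). \<phi> y = c} \<and>
      (\<forall>y\<in>{y\<in>level n (kk i). \<phi> y = c}.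
      (\<exists>k\<in>{kk (pv i c)..<kk (Suc (pv i c))}. f i c y \<in> ends k \<and> \<phi> (st (f i c y)) = c) \<and> f i c y \<subseteq> y)"
    if "1 \<le> i" "i \<le> K" "c \<in> G i" for i c
    using someI_ex[OF ex[OF that]] unfolding f_def[symmetric] unfolding Pf_def .
  define R where "R x \<longleftrightarrow> (\<exists>i. 1 \<le> i \<and> i \<le> K \<and> card x = kk i)" for x :: "nat set"
  define p where "p x = (if R x then f (ph (card x)) (\<phi> x) x else m x)" for x
  have lev: "x \<in> level n (card x)" if "x \<subseteq> {1..n}" for x using that by (simp add: level_def)
  have rungs: "\<exists>i k. 1 \<le> i \<and> i \<le> K \<and> card x = kk i \<and> \<phi> x \<in> G i \<and> p x = f i (\<phi> x) x \<and> p x \<subseteq> x \<and>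
      kk (pv i (\<phi> x)) \<le> k \<and> k < kk (Suc (pv i (\<phi> x))) \<and> p x \<in> ends k \<and> \<phi> (st (p x)) = \<phi> x \<and>
      kk 0 \<le> k \<and> k < kk i \<and> p x \<in> level n k"
    if x: "x \<subseteq> {1..n}" "R x" for x
  proof -
    obtain i where i: "1 \<le> i" "i \<le> K" "card x = kk i" using x(2) by (auto simp: R_def)
    have xl: "x \<in> level n (kk i)" using lev[OF x(1)] i by simp
    have c: "\<phi> x \<in> G i" using phi[OF i(2) xl] .
    have px: "p x = f i (\<phi> x) x" using x i h by (simp add: p_def)
    obtain k where k: "k \<in> {kk (pv i (\<phi> x))..<kk (Suc (pv i (\<phi> x)))}" "p x \<in> ends k" "\<phi> (st (p x)) = \<phi> x" "p x \<subseteq> x"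
      using f'[OF i(1,2) c] xl unfolding px by blast
    have "kk 0 \<le> k" "k < kk i"
      using k(1) kk0_le[of "pv i (\<phi> x)"] rung_mono[of "Suc (pv i (\<phi> x))" i r h] pv(1)[OF i(1,2) c] by auto
    moreover have "p x \<in> level n k"
      using ends_level[of k] k(2) calculation rung_mono[of i "Suc K" r h] i by auto
    ultimately show ?thesis using i c px k by (intro exI[of _ i] exI[of _ k]) auto
  qed
  have plain: "p x \<in> level n (card x - 1) \<and> p x \<subseteq> x \<and> p x = m x"
    if x: "x \<subseteq> {1..n}" "r < card x" "\<not> R x" for x
    using m[of "card x - 1" x] x lev[OF x(1)] by (auto simp: p_def)
  show ?thesis
  proof (rule that[of p "\<lambda>x. \<phi> (st x)"])
    fix x assume x: "x \<subseteq> {1..n}" "r < card x"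
    show "p x \<subseteq> x \<and> r \<le> card (p x) \<and> card (p x) < card x"
    proof (cases "R x")
      case True
      then show ?thesis using rungs[OF x(1) True] kk0[of 0] by (auto simp: level_def)
    next
      case False
      then show ?thesis using plain[OF x False] x by (auto simp: level_def)
    qed
  next
    \<comment> \<open>A rung set and an ordinary set cannot share an image: droppers are avoided by
      \<open>m\<close>, and directly above the last level of an earlier phase lies a rung, whose
      sets do not use \<open>m\<close>.\<close>
    have mixed: False if x: "x \<subseteq> {1..n}" "R x" and y: "y \<subseteq> {1..n}" "r < card y" "\<not> R y" and eq: "p x = p y" for x y
    proof -
      obtain i k where i: "1 \<le> i" "i \<le> K" "\<phi> x \<in> G i" "kk (pv i (\<phi> x)) \<le> k" "k < kk (Suc (pv i (\<phi> x)))"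
        "p x \<in> ends k" "kk 0 \<le> k" "k < kk i" "p x \<in> level n k" using rungs[OF x] by blast
      have "p y \<in> level n (card y - 1)" using plain[OF y] by blast
      then have cy: "card y = k + 1" using i(9) eq y(2) by (auto simp: level_def)
      have phk: "ph k = pv i (\<phi> x)" using i by (intro phase_eqI)
      have "k + 1 \<noteq> kk (Suc (ph k))"
      proof
        assume "k + 1 = kk (Suc (ph k))"
        moreover have "Suc (ph k) \<le> K" using pv(1)[OF i(1,2,3)] i(2) phk by simp
        ultimately have "R y" using cy by (auto simp: R_def intro!: exI[of _ "Suc (ph k)"])
        then show False using y by simp
      qed
      then have "p y \<in> D k" using i(6) eq by (simp add: ends_def)
      moreover have "m y \<notin> D k"
        using mD[of k y] i(7,8) rung_mono[of i "Suc K" r h] i(2) lev[OF y(1)] cy by simp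
      ultimately show False using plain[OF y] by simp
    qed
    have rr: "x = y" if x: "x \<subseteq> {1..n}" "R x" and y: "y \<subseteq> {1..n}" "R y" and eq: "p x = p y" for x y
    proof -
      obtain i k where i: "1 \<le> i" "i \<le> K" "card x = kk i" "\<phi> x \<in> G i" "p x = f i (\<phi> x) x"
        "kk (pv i (\<phi> x)) \<le> k" "k < kk (Suc (pv i (\<phi> x)))" "p x \<in> level n k" "\<phi> (st (p x)) = \<phi> x"
        using rungs[OF x] by blast
      obtain i' k' where i': "1 \<le> i'" "i' \<le> K" "card y = kk i'" "\<phi> y \<in> G i'" "p y = f i' (\<phi> y) y"
        "kk (pv i' (\<phi> y)) \<le> k'" "k' < kk (Suc (pv i' (\<phi> y)))" "p y \<in> level n k'" "\<phi> (st (p y)) = \<phi> y"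
        using rungs[OF y] by blast
      have kk': "k = k'" using i(8) i'(8) eq by (simp add: level_def)
      have c: "\<phi> x = \<phi> y" using i(9) i'(9) eq by simp
      have "pv i (\<phi> x) = pv i' (\<phi> x)"
        using phase_eqI[OF i(6,7)] phase_eqI[OF i'(6,7)] kk' c by simp
      then have "i = i'"
        using pv(1,3)[OF i(1,2,4)] pv(1,3)[OF i'(1,2,4)] i(4) i'(4) c by (metis not_less_iff_gr_or_eq not_le)
      then show "x = y"
        using f'[OF i(1,2,4)] i(3,5) i'(3,5) c eq lev[OF x(1)] lev[OF y(1)] by (auto simp: inj_on_def)
    qed
    have pp: "x = y" if x: "x \<subseteq> {1..n}" "r < card x" "\<not> R x" and y: "y \<subseteq> {1..n}" "r < card y" "\<not> R y"
        and eq: "p x = p y" for x y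
    proof -
      have "card x - 1 = card y - 1" using plain[OF x] plain[OF y] eq by (auto simp: level_def)
      then have "card x = card y" using x y by linarith
      then have xy: "x \<in> level n (card x - 1 + 1)" "y \<in> level n (card x - 1 + 1)"
        using lev[OF x(1)] lev[OF y(1)] x by auto
      have "card x \<le> n" using card_mono[of "{1..n}" x] x by simp
      then have "inj_on m (level n (card x - 1 + 1))" using x by (intro m_inj) auto
      then show ?thesis using plain[OF x] plain[OF y] eq xy by (auto dest: inj_onD)
    qed
    show "inj_on p {x. x \<subseteq> {1..n} \<and> r < card x}"
    proof (rule inj_onI, clarify)
      fix x y assume "x \<subseteq> {1..n}" "r < card x" "y \<subseteq> {1..n}" "r < card y" "p x = p y"
      then show "x = y" using mixed[of x y] mixed[of y x] rr[of x y] pp[of x y] by metis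
    qed
  next
    fix x assume x: "x \<subseteq> {1..n}" "kk 0 \<le> card x" "card x < kk (Suc K)"
    have "ph (card x) < Suc K" by (rule phase_less[OF h x(2,3)])
    then show "\<phi> (st x) \<in> G (ph (card x))"
      using phi st_level(2)[OF x(2,3) lev[OF x(1)]] by auto
  next
    fix x assume x: "x \<subseteq> {1..n}" "kk 0 < card x" "card x < kk (Suc K)"
    show "kk 0 \<le> card (p x) \<and> \<phi> (st (p x)) = \<phi> (st x)"
    proof (cases "R x")
      case True
      obtain i k where "card x = kk i" "\<phi> (st (p x)) = \<phi> x" "kk 0 \<le> k" "p x \<in> level n k"
        using rungs[OF x(1) True] by blast
      then show ?thesis using st_rung[of x i] lev[OF x(1)] by (simp add: level_def)
    next
      case False
      have rx: "r < card x" using x kk0[of 0] by linarith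
      have pl: "p x \<in> level n (card x - 1)" "p x = m x" using plain[OF x(1) rx False] by auto
      define i where "i = ph (card x)"
      have i: "kk i \<le> card x" "card x < kk (Suc i)"
        using rung_phase[OF h, of r "card x"] x by (auto simp: i_def)
      have "i \<le> K" using phase_less[OF h _ x(3)] x by (simp add: i_def)
      have "card x \<noteq> kk i"
      proof
        assume e: "card x = kk i"
        then have "i \<noteq> 0" using x(2) by (metis less_irrefl)
        then have "R x" using \<open>i \<le> K\<close> e by (auto simp: R_def intro!: exI[of _ i])
        then show False using False by simp
      qed
      then have "st (m x) = st x" using i lev[OF x(1)] by (intro st_m[of i]) auto
      then show ?thesis using pl x by (simp add: level_def)
    qed
  qed
qed

end

section \<open>Chain partitions\<close>

text \<open>Encodes a partition of the sets of size at least r into chains, one through each set of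
  level r, by sending a set to the bottom of its chain.\<close>

definition chain_map :: "nat \<Rightarrow> nat \<Rightarrow> (nat set \<Rightarrow> nat set) \<Rightarrow> bool" where
  "chain_map n r f \<longleftrightarrow> (\<forall>x. x \<subseteq> {1..n} \<and> r \<le> card x \<longrightarrow> f x \<in> level n r) \<and> (\<forall>x\<in>level n r. f x = x) \<and>
    (\<forall>x y. x \<subseteq> {1..n} \<and> r \<le> card x \<and> y \<subseteq> {1..n} \<and> r \<le> card y \<and> f x = f y \<longrightarrow> x \<subseteq> y \<or> y \<subseteq> x)"

text \<open>The chain with bottom z, cut off at level t, because lengths are controlled only below
  the top of the ladder.\<close>

definition fibre :: "nat \<Rightarrow> nat \<Rightarrow> (nat set \<Rightarrow> nat set) \<Rightarrow> nat \<Rightarrow> nat set \<Rightarrow> nat set set" where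
  "fibre n r f t z = {x. x \<subseteq> {1..n} \<and> r \<le> card x \<and> card x < t \<and> f x = z}"

text \<open>The orbits of an injective shrinking map are chains. Level r is made fixed, so n
  iterations reach the bottom; two sets with the same bottom lie on one orbit, because injectivity
  cancels equal predecessors.\<close>

lemma chain_roots_of_pred:
  fixes p :: "nat set \<Rightarrow> nat set" and n r :: nat
  assumes pred: "\<forall>x. x \<subseteq> {1..n} \<and> r < card x \<longrightarrow> p x \<subseteq> x \<and> r \<le> card (p x) \<and> card (p x) < card x"
    and inj: "inj_on p {x. x \<subseteq> {1..n} \<and> r < card x}"
  defines "p' \<equiv> \<lambda>x. if r < card x then p x else x"
  defines "base \<equiv> p' ^^ n"
  shows "\<And>x j. x \<subseteq> {1..n} \<Longrightarrow> r \<le> card x \<Longrightarrow> (p' ^^ j) x \<subseteq> x \<and> r \<le> card ((p' ^^ j) x)"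
    and "\<And>x. x \<subseteq> {1..n} \<Longrightarrow> r \<le> card x \<Longrightarrow> base x \<in> level n r"
    and "\<And>x. x \<in> level n r \<Longrightarrow> base x = x"
    and "\<And>x y. x \<subseteq> {1..n} \<Longrightarrow> r \<le> card x \<Longrightarrow> y \<subseteq> {1..n} \<Longrightarrow> r \<le> card y \<Longrightarrow> base x = base y \<Longrightarrow>
      \<exists>j. x = (p' ^^ j) y \<or> y = (p' ^^ j) x"
proof -
  have p: "p x \<subseteq> x \<and> r \<le> card (p x) \<and> card (p x) < card x" if "x \<subseteq> {1..n}" "r < card x" for x
    using pred that by blast
  have iter: "(p' ^^ j) x \<subseteq> x \<and> r \<le> card ((p' ^^ j) x) \<and> card ((p' ^^ j) x) \<le> max r (card x - j)"
    if x: "x \<subseteq> {1..n}" "r \<le> card x" for x j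
  proof (induction j)
    case (Suc j)
    define y where "y = (p' ^^ j) x"
    have y: "y \<subseteq> {1..n}" "r \<le> card y" "y \<subseteq> x" "card y \<le> max r (card x - j)" using Suc x by (auto simp: y_def)
    have Sy: "(p' ^^ Suc j) x = p' y" by (simp add: y_def)
    show ?case unfolding Sy
    proof (cases "r < card y")
      case True
      then have "p' y = p y" by (simp add: p'_def)
      then show "p' y \<subseteq> x \<and> r \<le> card (p' y) \<and> card (p' y) \<le> max r (card x - Suc j)"
        using p[OF y(1) True] y(3,4) by auto
    next
      case False
      then have "p' y = y" by (simp add: p'_def)
      then show "p' y \<subseteq> x \<and> r \<le> card (p' y) \<and> card (p' y) \<le> max r (card x - Suc j)"
        using False y by auto
    qed
  qed (use x in auto)
  show "(p' ^^ j) x \<subseteq> x \<and> r \<le> card ((p' ^^ j) x)" if "x \<subseteq> {1..n}" "r \<le> card x" for x j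
    using iter[OF that] by blast
  show rootl: "base x \<in> level n r" if x: "x \<subseteq> {1..n}" "r \<le> card x" for x
  proof -
    have "card x \<le> n" using card_mono[of "{1..n}" x] x by simp
    then show ?thesis using iter[OF x, of n] x by (auto simp: base_def level_def)
  qed
  have fix0: "(p' ^^ j) x = x" if "card x = r" for x j
    using that by (induction j) (auto simp: p'_def)
  then show "base x = x" if "x \<in> level n r" for x using that by (simp add: base_def level_def)
  have root_p: "base (p' x) = base x" if "x \<subseteq> {1..n}" "r \<le> card x" for x
  proof -
    have "base (p' x) = p' (base x)" by (simp add: base_def funpow_swap1)
    also have "\<dots> = base x" using rootl[OF that] by (simp add: p'_def level_def)
    finally show ?thesis .
  qed
  show "\<exists>j. x = (p' ^^ j) y \<or> y = (p' ^^ j) x"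
    if "x \<subseteq> {1..n}" "r \<le> card x" "y \<subseteq> {1..n}" "r \<le> card y" "base x = base y" for x y
    using that
  proof (induction "card x" arbitrary: x rule: less_induct)
    case less
    show ?case
    proof (cases "r < card x")
      case False
      then have "card x = r" using less.prems(2) by simp
      from fix0[OF this, of n] have "x = (p' ^^ n) y" using less.prems(5) by (simp add: base_def)
      then show ?thesis by blast
    next
      case True
      have px: "p x \<subseteq> x" "r \<le> card (p x)" "card (p x) < card x" using p[OF less.prems(1) True] by auto
      have pp: "p' x = p x" using True by (simp add: p'_def)
      have "\<exists>j. p x = (p' ^^ j) y \<or> y = (p' ^^ j) (p x)"
        using less.hyps[OF px(3)] px less.prems root_p[OF less.prems(1,2)] pp by auto
      then consider j where "y = (p' ^^ j) (p x)" | "\<exists>j. p x = (p' ^^ j) y" by blast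
      then show ?thesis
      proof cases
        case 1
        then have "y = (p' ^^ Suc j) x" using pp by (simp add: funpow_swap1)
        then show ?thesis by blast
      next
        case 2
        \<comment> \<open>With the least j, w is the point of the orbit of y just before
          \<open>p x\<close>. Minimality excludes that w is \<open>p x\<close> itself, so w is above
          level r and injectivity of p gives x = w.\<close>
        define j where "j = (LEAST j. p x = (p' ^^ j) y)"
        have j: "p x = (p' ^^ j) y" unfolding j_def by (rule LeastI_ex[OF 2])
        show ?thesis
        proof (cases j)
          case 0
          then have "y = (p' ^^ 1) x" using j pp by simp
          then show ?thesis by blast
        next
          case (Suc i)
          define w where "w = (p' ^^ i) y"
          have w: "w \<subseteq> {1..n}" "r \<le> card w" using iter[OF less.prems(3,4), of i] less.prems by (auto simp: w_def)
          have pw: "p x = p' w" using j Suc by (simp add: w_def)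
          have "p x \<noteq> w" unfolding w_def
            using not_less_Least[of i "\<lambda>j. p x = (p' ^^ j) y"] Suc by (simp add: j_def)
          then have "r < card w" using pw w by (auto simp: p'_def split: if_splits)
          then have "x = w" using inj_onD[OF inj, of x w] pw w less.prems True by (simp add: p'_def)
          then show ?thesis unfolding w_def by blast
        qed
      qed
    qed
  qed
qed

context ladder
begin

text \<open>A chain has at most one set per level and a single colour c from rung 0 on. It meets at
  most h levels below rung 0 and at most h levels in each of the at most b phases where c is
  active.\<close>

lemma chain_roots:
  assumes cover: "\<And>c. card {i. i \<le> K \<and> c \<in> G i} \<le> b"
  obtains base where
    "chain_map n r base"
    "\<And>z. card (fibre n r base (kk (Suc K)) z) \<le> h + b * h"
proof -
  obtain p col where p: "\<And>x. x \<subseteq> {1..n} \<Longrightarrow> r < card x \<Longrightarrow> p x \<subseteq> x \<and> r \<le> card (p x) \<and> card (p x) < card x"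
    and inj: "inj_on p {x. x \<subseteq> {1..n} \<and> r < card x}"
    and colG: "\<And>x. x \<subseteq> {1..n} \<Longrightarrow> kk 0 \<le> card x \<Longrightarrow> card x < kk (Suc K) \<Longrightarrow> col x \<in> G (ph (card x))"
    and colp: "\<And>x. x \<subseteq> {1..n} \<Longrightarrow> kk 0 < card x \<Longrightarrow> card x < kk (Suc K) \<Longrightarrow> kk 0 \<le> card (p x) \<and> col (p x) = col x"
  proof (rule pred_map)
    fix p col
    assume "\<And>x. x \<subseteq> {1..n} \<Longrightarrow> r < card x \<Longrightarrow> p x \<subseteq> x \<and> r \<le> card (p x) \<and> card (p x) < card x"
      "inj_on p {x. x \<subseteq> {1..n} \<and> r < card x}"
      "\<And>x. x \<subseteq> {1..n} \<Longrightarrow> kk 0 \<le> card x \<Longrightarrow> card x < kk (Suc K) \<Longrightarrow> col x \<in> G (ph (card x))"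
      "\<And>x. x \<subseteq> {1..n} \<Longrightarrow> kk 0 < card x \<Longrightarrow> card x < kk (Suc K) \<Longrightarrow> kk 0 \<le> card (p x) \<and> col (p x) = col x"
    then show thesis by (rule that)
  qed
  define p' where "p' = (\<lambda>x. if r < card x then p x else x)"
  define base where "base = p' ^^ n"
  have "\<forall>x. x \<subseteq> {1..n} \<and> r < card x \<longrightarrow> p x \<subseteq> x \<and> r \<le> card (p x) \<and> card (p x) < card x"
    using p by blast
  note roots = chain_roots_of_pred[OF this inj, folded p'_def, folded base_def]
  have comp: "x \<subseteq> y \<or> y \<subseteq> x"
    if "x \<subseteq> {1..n}" "r \<le> card x" "y \<subseteq> {1..n}" "r \<le> card y" "base x = base y" for x y
    using roots(4)[OF that] roots(1)[of x] roots(1)[of y] that by blast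
  have coliter: "col ((p' ^^ j) y) = col y"
    if y: "y \<subseteq> {1..n}" "r \<le> card y" "card y < kk (Suc K)" and "kk 0 \<le> card ((p' ^^ j) y)" for y j
    using that(4)
  proof (induction j)
    case (Suc j)
    define w where "w = (p' ^^ j) y"
    have w: "w \<subseteq> y" "r \<le> card w" using roots(1)[OF y(1,2), of j] by (auto simp: w_def)
    have wn: "w \<subseteq> {1..n}" using w y by auto
    have "card w \<le> card y" using w y by (intro card_mono) (auto intro: finite_subset)
    have kp: "kk 0 \<le> card (p' w)" using Suc.prems by (simp add: w_def)
    have "r < card w"
      using kp w kk0[of 0] by (cases "r < card w") (auto simp: p'_def)
    then have pw: "p' w = p w" "card (p w) < card w" using p[OF wn] by (auto simp: p'_def)
    then have "col (p w) = col w" using colp[OF wn] kp \<open>card w \<le> card y\<close> y by simp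
    moreover have "col w = col y" using Suc.IH kp pw by (simp add: w_def)
    ultimately show ?case using pw by (simp add: w_def)
  qed simp
  have bound: "card (fibre n r base (kk (Suc K)) z) \<le> h + b * h" for z
  proof -
    define F where "F = {x. x \<subseteq> {1..n} \<and> r \<le> card x \<and> card x < kk (Suc K) \<and> base x = z}"
    have finF: "finite F" by (rule finite_subset[of _ "Pow {1..n}"]) (auto simp: F_def)
    have injc: "inj_on card F"
    proof (rule inj_onI)
      fix x y assume xy: "x \<in> F" "y \<in> F" "card x = card y"
      then have fin: "finite x" "finite y" by (auto simp: F_def intro: finite_subset)
      from xy have "x \<subseteq> y \<or> y \<subseteq> x" using comp by (auto simp: F_def)
      then show "x = y" using xy(3) fin card_subset_eq by metis
    qed
    have "\<exists>c. \<forall>x\<in>F. kk 0 \<le> card x \<longrightarrow> col x = c"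
    proof (cases "\<exists>x\<in>F. kk 0 \<le> card x")
      case True
      then obtain x where x: "x \<in> F" "kk 0 \<le> card x" by blast
      have "col y = col x" if y: "y \<in> F" "kk 0 \<le> card y" for y
      proof -
        obtain j where "x = (p' ^^ j) y \<or> y = (p' ^^ j) x"
          using roots(4)[of x y] x y by (auto simp: F_def)
        then show ?thesis using coliter[of y j] coliter[of x j] x y by (auto simp: F_def)
      qed
      then show ?thesis by blast
    qed blast
    then obtain c where c: "\<And>x. x \<in> F \<Longrightarrow> kk 0 \<le> card x \<Longrightarrow> col x = c" by blast
    define I where "I = {i. i \<le> K \<and> c \<in> G i}"
    have finI: "finite I" by (simp add: I_def)
    have "card ` F \<subseteq> {r..<kk 0} \<union> (\<Union>i\<in>I. {kk i..<kk (Suc i)})"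
    proof clarify
      fix x assume x: "x \<in> F" "card x \<notin> (\<Union>i\<in>I. {kk i..<kk (Suc i)})"
      show "card x \<in> {r..<kk 0}"
      proof (rule ccontr)
        assume "card x \<notin> {r..<kk 0}"
        then have k: "kk 0 \<le> card x" using x by (auto simp: F_def)
        have "ph (card x) \<in> I"
          using colG[of x] c[OF x(1) k] x k phase_less[OF h k, of "Suc K"] by (auto simp: I_def F_def)
        then show False using x(2) rung_phase[OF h k] by auto
      qed
    qed
    then have "card (card ` F) \<le> card ({r..<kk 0} \<union> (\<Union>i\<in>I. {kk i..<kk (Suc i)}))"
      using finI by (intro card_mono) auto
    also have "\<dots> \<le> card {r..<kk 0} + card (\<Union>i\<in>I. {kk i..<kk (Suc i)})" by (rule card_Un_le)
    also have "card (\<Union>i\<in>I. {kk i..<kk (Suc i)}) \<le> (\<Sum>i\<in>I. card {kk i..<kk (Suc i)})"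
      by (rule card_UN_le[OF finI])
    also have "\<dots> = card I * h" by (simp add: rung_Suc)
    also have "card I * h \<le> b * h" using cover[of c] by (intro mult_right_mono) (auto simp: I_def)
    also have "card {r..<kk 0} = h" by (simp add: rung_def)
    finally show ?thesis using card_image[OF injc] by (simp add: F_def fibre_def)
  qed
  have "chain_map n r base" using roots(2,3) comp by (simp add: chain_map_def)
  then show ?thesis using bound by (rule that)
qed

end

text \<open>Assembles droppers, matchings and cyclic intervals. The targets of the droppers are the
  K + 1 rungs; the level next above a dropper is one more, hence K + 2 in
  \<open>crit1\<close>.\<close>

lemma ladder_exists:
  fixes n r h K M b :: nat and \<beta> q :: real and g :: "nat \<Rightarrow> nat"
  assumes r: "n \<le> 2 * r + 1" and h: "0 < h" and top: "3 * rung r h (Suc K) \<le> 2 * n"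
    and beta: "0 < \<beta>" "\<beta> < 1" "2 \<le> \<beta> * h" and M: "0 < M"
    and g: "\<And>i. i \<le> K \<Longrightarrow> 0 < g i" "\<And>i. i \<le> K \<Longrightarrow> g i \<le> M" "g 0 = M"
    and ratio: "\<And>i i'. i < i' \<Longrightarrow> i' \<le> K \<Longrightarrow>
      (1 + \<beta>) * ((n choose rung r h i') / g i') \<le> (1 - \<beta>)\<^sup>2 * ((n choose rung r h i) / g i)"
    and q: "0 < q" "q \<le> 1"
      "\<And>k i. rung r h 0 \<le> k \<Longrightarrow> k < rung r h i \<Longrightarrow> i \<le> K \<Longrightarrow> q * (n choose k) \<le> (n choose rung r h i)"
    and b: "(\<Sum>i\<le>K. g i) \<le> b * M"
    and crit1: "(K + 2) * (4 / (\<beta>\<^sup>2 * h / (128 * n)) * exp (- (\<beta>\<^sup>2 * h / (128 * n)) * n / 12)) \<le> \<beta>\<^sup>2 * h / (128 * n) / 8"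
    and crit2: "2 * (K * h) * K * M * (4 / (\<beta>\<^sup>2 / (4 * M) * ((1 - \<beta>) * (2 * h / n)) * q) *
      exp (- (\<beta>\<^sup>2 / (4 * M) * ((1 - \<beta>) * (2 * h / n))) * n / 12)) \<le> \<beta>\<^sup>2 / (4 * M) / 8"
  obtains base where
    "chain_map n r base"
    "\<And>z. card (fibre n r base (rung r h (Suc K)) z) \<le> h + b * h"
proof -
  have rn: "rung r h (Suc K) \<le> n" "h \<le> n" using top by (auto simp: rung_def)
  have n0: "0 < n" using rn h by simp
  define \<theta> where "\<theta> = \<beta>\<^sup>2 * h / (128 * n)"
  have th0: "0 < \<theta>" using beta h n0 by (simp add: \<theta>_def)
  have cT: "card (rung r h ` {..K}) \<le> K + 1" using card_image_le[of "{..K}" "rung r h"] by simp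
  have "real (card (rung r h ` {..K}) + 1) * (4 / \<theta> * exp (- \<theta> * n / 12)) \<le> (K + 2) * (4 / \<theta> * exp (- \<theta> * n / 12))"
    using cT th0 by (intro mult_right_mono) auto
  also have "\<dots> \<le> \<theta> / 8" using crit1 by (simp add: \<theta>_def)
  finally have crit: "real (card (rung r h ` {..K}) + 1) * (4 / \<theta> * exp (- \<theta> * n / 12)) \<le> \<theta> / 8" .
  obtain D where D: "\<And>k. k \<in> {rung r h 0..<rung r h (Suc K)} \<Longrightarrow> D k \<subseteq> level n k"
    "\<And>k y. k \<in> {rung r h 0..<rung r h (Suc K)} \<Longrightarrow> y \<in> level n (k + 1) \<Longrightarrow> card {x\<in>D k. x \<subseteq> y} \<le> 2 * k + 1 - n"
    "\<And>k k' y. k \<in> {rung r h 0..<rung r h (Suc K)} \<Longrightarrow> k' \<in> rung r h ` {..K} \<Longrightarrow> k < k' \<Longrightarrow> y \<in> level n k' \<Longrightarrow>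
      (1 - \<beta>) * (real (2 * k + 1 - n) / real (k + 1)) * (k' choose k) \<le> card {x\<in>D k. x \<subseteq> y}"
  proof (rule droppers)
    show "n + 2 * h \<le> 2 * rung r h 0 + 1" "1 \<le> rung r h 0" using r h by (auto simp: rung_def)
    show "rung r h (Suc K) \<le> n" "h \<le> n" by (fact rn)+
    show "finite (rung r h ` {..K})" by simp
    show "k \<le> rung r h (Suc K)" if "k \<in> rung r h ` {..K}" for k using that by (auto intro: rung_mono)
    show "0 < \<beta>" "\<beta> \<le> 1" "2 \<le> \<beta> * h" using beta by auto
    show "\<theta> = \<beta>\<^sup>2 * h / (128 * n)" by (simp add: \<theta>_def)
    show "real (card (rung r h ` {..K}) + 1) * (4 / \<theta> * exp (- \<theta> * n / 12)) \<le> \<theta> / 8" by (fact crit)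
    fix D
    assume "\<And>k. k \<in> {rung r h 0..<rung r h (Suc K)} \<Longrightarrow> D k \<subseteq> level n k"
      "\<And>k y. k \<in> {rung r h 0..<rung r h (Suc K)} \<Longrightarrow> y \<in> level n (k + 1) \<Longrightarrow> card {x\<in>D k. x \<subseteq> y} \<le> 2 * k + 1 - n"
      "\<And>k k' y. k \<in> {rung r h 0..<rung r h (Suc K)} \<Longrightarrow> k' \<in> rung r h ` {..K} \<Longrightarrow> k < k' \<Longrightarrow> y \<in> level n k' \<Longrightarrow>
        (1 - \<beta>) * (real (2 * k + 1 - n) / real (k + 1)) * (k' choose k) \<le> card {x\<in>D k. x \<subseteq> y}"
    then show thesis by (rule that)
  qed
  \<comment> \<open>Outside the phases no set is spared by the matching.\<close>
  define E where "E k = (if k \<in> {rung r h 0..<rung r h (Suc K)} then D k else {})" for k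
  have "\<exists>f. inj_on f (level n (k + 1)) \<and> (\<forall>y\<in>level n (k + 1). f y \<in> level n k - E k \<and> f y \<subseteq> y)"
    if "r \<le> k" "k < n" for k
    using that r D(1,2) by (intro layer_matching) (auto simp: E_def)
  then obtain mm where mm: "\<And>k. r \<le> k \<Longrightarrow> k < n \<Longrightarrow> inj_on (mm k) (level n (k + 1))"
      "\<And>k y. r \<le> k \<Longrightarrow> k < n \<Longrightarrow> y \<in> level n (k + 1) \<Longrightarrow> mm k y \<in> level n k - E k \<and> mm k y \<subseteq> y"
    by metis
  define m where "m x = mm (card x - 1) x" for x
  have mk: "m x = mm k x" if "x \<in> level n (k + 1)" for x k using that by (simp add: m_def level_def)
  have kn: "k < n" if "x \<in> level n (k + 1)" for x k
    using that card_mono[of "{1..n}" x] by (simp add: level_def)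
  obtain G where Gc: "\<And>i. i < Suc K \<Longrightarrow> G i \<subseteq> {..<M} \<and> card (G i) = g i"
      "\<And>c. card {i. i < Suc K \<and> c \<in> G i} \<le> b"
    using cyclic_cover[OF M, of "Suc K" g b] g b by (auto simp: lessThan_Suc_atMost less_Suc_eq_le)
  interpret ladder n r h K M \<beta> q G D m
  proof
    show "n \<le> 2 * r + 1" "0 < h" "3 * rung r h (Suc K) \<le> 2 * n" "0 < \<beta>" "\<beta> < 1" "0 < M" "0 < q" "q \<le> 1"
      by (fact r h top beta M q)+
    show "G i \<subseteq> {..<M}" if "i \<le> K" for i using Gc(1)[of i] that by simp
    show "G i \<noteq> {}" if "i \<le> K" for i using Gc(1)[of i] g(1)[OF that] that by auto
    show "G 0 = {..<M}" using Gc(1)[of 0] g(3) by (intro card_subset_eq) auto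
    show "(1 + \<beta>) * ((n choose rung r h i') / card (G i')) \<le> (1 - \<beta>)\<^sup>2 * ((n choose rung r h i) / card (G i))"
      if "i < i'" "i' \<le> K" for i i' using ratio[OF that] Gc(1)[of i] Gc(1)[of i'] that by simp
    show "q * (n choose k) \<le> (n choose rung r h i)" if "rung r h 0 \<le> k" "k < rung r h i" "i \<le> K" for k i
      using q(3)[OF that] .
    show "D k \<subseteq> level n k" if "rung r h 0 \<le> k" "k < rung r h (Suc K)" for k using D(1) that by simp
    show "(1 - \<beta>) * (real (2 * k + 1 - n) / real (k + 1)) * (rung r h i choose k) \<le> card {x\<in>D k. x \<subseteq> y}"
      if "rung r h 0 \<le> k" "k < rung r h i" "i \<le> K" "y \<in> level n (rung r h i)" for k i y
      using D(3)[of k "rung r h i" y] that rung_mono[of i "Suc K" r h] by auto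
    show "inj_on m (level n (k + 1))" if "r \<le> k" "k < n" for k
      using mm(1)[OF that] inj_on_cong[of "level n (k + 1)" m "mm k"] mk[of _ k] by blast
    show "m x \<in> level n k \<and> m x \<subseteq> x" if "r \<le> k" "x \<in> level n (k + 1)" for k x
      using mm(2)[OF that(1) kn[OF that(2)] that(2)] mk[OF that(2)] by simp
    show "m x \<notin> D k" if "rung r h 0 \<le> k" "k < rung r h (Suc K)" "x \<in> level n (k + 1)" for k x
      using mm(2)[OF _ kn[OF that(3)] that(3)] mk[OF that(3)] that rung_def[of r h 0] by (auto simp: E_def)
  qed (use crit2 in auto)
  have cov: "card {i. i \<le> K \<and> c \<in> G i} \<le> b" for c using Gc(2)[of c] by (simp add: less_Suc_eq_le)
  show ?thesis
  proof (rule chain_roots[OF cov])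
    fix base
    assume "chain_map n r base"
      "\<And>z. card (fibre n r base (rung r h (Suc K)) z) \<le> h + b * h"
    then show thesis by (rule that)
  qed
qed

section \<open>Level sums and the numbers of active colours\<close>

lemma upper_binomial_sum:
  assumes "n < 2 * a"
  shows "2 * (\<Sum>k\<in>{a..n}. n choose k) \<le> 2 ^ n"
proof (cases "a \<le> n")
  case True
  have "(\<Sum>k\<in>{a..n}. n choose k) = (\<Sum>k\<in>{0..n - a}. n choose k)"
    by (rule sum.reindex_bij_witness[where i = "\<lambda>k. n - k" and j = "\<lambda>k. n - k"])
      (use True in \<open>auto simp: binomial_symmetric[symmetric]\<close>)
  then have "2 * (\<Sum>k\<in>{a..n}. n choose k) = (\<Sum>k\<in>{a..n} \<union> {0..n - a}. n choose k)"
    using assms by (subst sum.union_disjoint) auto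
  also have "\<dots> \<le> (\<Sum>k\<in>{..n}. n choose k)" by (intro sum_mono2) auto
  also have "\<dots> = 2 ^ n" by (rule choose_row_sum)
  finally show ?thesis .
qed simp

lemma binomial_step_le:
  assumes "n \<le> 2 * k + 1"
  shows "n choose Suc k \<le> n choose k"
  using assms binomial_antimono[of k "Suc k" n] by (cases "Suc k \<le> n") (auto simp: not_le binomial_eq_0)

lemma binomial_upper_antimono:
  assumes "n \<le> 2 * k + 1" "k \<le> k'"
  shows "n choose k' \<le> n choose k"
  using assms(2,1)
proof (induction k' rule: dec_induct)
  case (step j)
  then show ?case using binomial_step_le[of n j] by simp
qed simp

text \<open>A lower Riemann sum: levels shrink above the middle, so a rung is no larger than any of
  the h levels ending at it.\<close>

lemma rung_binomial_sum:
  assumes "n \<le> 2 * r + 1" "0 < h"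
  shows "h * (\<Sum>i=1..K. n choose rung r h i) \<le> (\<Sum>k\<in>{rung r h 0<..rung r h K}. n choose k)"
proof (induction K)
  case (Suc K)
  have "h * (n choose rung r h (Suc K)) = (\<Sum>k\<in>{rung r h K<..rung r h (Suc K)}. n choose rung r h (Suc K))"
    by (simp add: rung_Suc)
  also have "\<dots> \<le> (\<Sum>k\<in>{rung r h K<..rung r h (Suc K)}. n choose k)"
    using assms by (intro sum_mono binomial_upper_antimono) (auto simp: rung_def)
  finally have "h * (\<Sum>i=1..Suc K. n choose rung r h i) \<le> (\<Sum>k\<in>{rung r h 0<..rung r h K}. n choose k)
      + (\<Sum>k\<in>{rung r h K<..rung r h (Suc K)}. n choose k)"
    using Suc by (simp add: distrib_left)
  also have "\<dots> = (\<Sum>k\<in>{rung r h 0<..rung r h K} \<union> {rung r h K<..rung r h (Suc K)}. n choose k)"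
    by (subst sum.union_disjoint) auto
  also have "{rung r h 0<..rung r h K} \<union> {rung r h K<..rung r h (Suc K)} = {rung r h 0<..rung r h (Suc K)}"
    using rung_mono[of 0 K r h] rung_mono[of K "Suc K" r h] by auto
  finally show ?case .
qed simp

text \<open>About M a_i/a_0 colours are active in phase i, up to powers of \<gamma>. A colour is
  then active in about (a_0 + a_1 + ...)/a_0 phases, and h times the sum from a_1 on is at most half
  of 2^n. The drop required by \<open>first\<close> keeps the number of active colours at most M
  after rounding, and the last condition on M makes the rounding cost at most a factor
  1/\<gamma>.\<close>

lemma half_cover:
  fixes n r h K M :: nat and \<beta> q \<gamma> :: real
  assumes r: "n \<le> 2 * r + 1" and h: "0 < h" and top: "3 * rung r h (Suc K) \<le> 2 * n"
    and beta: "0 < \<beta>" "\<beta> < 1" "2 \<le> \<beta> * h"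
    and gamma: "\<gamma> = (1 - \<beta>)\<^sup>2 / (1 + \<beta>)"
    and M: "0 < M" "K \<le> M" "1 \<le> M * (q * (1 - \<gamma>))"
    and first: "(n choose rung r h 1) / (n choose rung r h 0) \<le> \<gamma> ^ (2 * K) * (1 - 1 / M)"
    and q: "0 < q" "q \<le> 1"
      "\<And>k i. rung r h 0 \<le> k \<Longrightarrow> k \<le> rung r h i \<Longrightarrow> i \<le> K \<Longrightarrow> q * (n choose k) \<le> (n choose rung r h i)"
    and crit1: "(K + 2) * (4 / (\<beta>\<^sup>2 * h / (128 * n)) * exp (- (\<beta>\<^sup>2 * h / (128 * n)) * n / 12)) \<le> \<beta>\<^sup>2 * h / (128 * n) / 8"
    and crit2: "2 * (K * h) * K * M * (4 / (\<beta>\<^sup>2 / (4 * M) * ((1 - \<beta>) * (2 * h / n)) * q) *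
      exp (- (\<beta>\<^sup>2 / (4 * M) * ((1 - \<beta>) * (2 * h / n))) * n / 12)) \<le> \<beta>\<^sup>2 / (4 * M) / 8"
  obtains base where
    "chain_map n r base"
    "\<And>z. real (card (fibre n r base (rung r h (Suc K)) z))
      \<le> 4 * h + 2 ^ n / 2 / (\<gamma> ^ (2 * K) * (n choose rung r h 0))"
proof -
  define a where "a i = real (n choose rung r h i)" for i
  have rn: "rung r h i \<le> n" if "i \<le> Suc K" for i using rung_mono[OF that, of r h] top by linarith
  have a: "0 < a i" if "i \<le> Suc K" for i using rn[OF that] by (simp add: a_def)
  have gam: "0 < \<gamma>" "\<gamma> < 1"
  proof -
    show "0 < \<gamma>" using beta by (simp add: gamma)
    have "(1 - \<beta>)\<^sup>2 < 1" using beta by (simp add: power_less_one_iff abs_square_less_1)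
    then show "\<gamma> < 1" using beta by (simp add: gamma)
  qed
  \<comment> \<open>One factor \<open>\<gamma>\<close> per phase pays for the losses in the local densities, the other one for
    rounding \<open>s i\<close> to an integer.\<close>
  define s where "s i = M * (a i / (a 0 * \<gamma> ^ (2 * i)))" for i
  define g where "g i = nat \<lceil>s i\<rceil>" for i
  have s0: "0 < s i" if "i \<le> K" for i using a[of i] a[of 0] gam M that by (simp add: s_def)
  have g: "s i \<le> g i" "g i \<le> s i + 1" "0 < g i" if "i \<le> K" for i
    using s0[OF that] unfolding g_def by linarith+
  have g0: "g 0 = M" using a[of 0] by (simp add: g_def s_def)
  have g_up: "g i \<le> s i / \<gamma>" if "i \<le> K" for i
  proof -
    have "q * a 0 \<le> a i" using q(3)[of "rung r h 0" i] that rung_mono[of 0 i r h] by (simp add: a_def)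
    moreover have "\<gamma> ^ (2 * i) \<le> 1" using gam by (intro power_le_one) auto
    ultimately have "q * (a 0 * \<gamma> ^ (2 * i)) \<le> a i * 1"
      using mult_mono[of "q * a 0" "a i" "\<gamma> ^ (2 * i)" 1] a[of i] that gam by (simp add: mult_ac)
    then have "q \<le> a i / (a 0 * \<gamma> ^ (2 * i))" using a[of 0] gam by (simp add: field_simps)
    then have "(M * (1 - \<gamma>)) * q \<le> (M * (1 - \<gamma>)) * (a i / (a 0 * \<gamma> ^ (2 * i)))"
      using gam by (intro mult_left_mono) auto
    then have "M * (1 - \<gamma>) * q \<le> (1 - \<gamma>) * s i" by (simp add: s_def mult_ac)
    then have "1 \<le> (1 - \<gamma>) * s i" using M(3) by (simp add: mult_ac)
    then have "s i * \<gamma> + 1 \<le> s i" by (simp add: algebra_simps)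
    then have "(s i + 1) * \<gamma> \<le> s i" using gam(2) unfolding distrib_right by linarith
    then have "s i + 1 \<le> s i / \<gamma>" using gam by (simp add: pos_le_divide_eq)
    then show ?thesis using g(2)[OF that] by linarith
  qed
  have a_le: "a i \<le> a 1" if "1 \<le> i" for i
    unfolding a_def of_nat_le_iff using that r by (intro binomial_upper_antimono rung_mono) (auto simp: rung_def)
  have gK: "\<gamma> ^ (2 * K) \<le> \<gamma> ^ (2 * i)" if "i \<le> K" for i
    using gam that by (intro power_decreasing) auto
  have sK: "s i \<le> M * (a i / (a 0 * \<gamma> ^ (2 * K)))" if "i \<le> K" for i
    unfolding s_def using a[of i] a[of 0] that gK[OF that] gam
    by (intro mult_left_mono divide_left_mono) auto
  have gM: "g i \<le> M" if "i \<le> K" for i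
  proof (cases "i = 0")
    case False
    have "a i / a 0 \<le> \<gamma> ^ (2 * K) * (1 - 1 / M)"
      using first a_le[of i] False a[of 0] by (simp add: a_def divide_right_mono order_trans[rotated])
    then have "a i / (a 0 * \<gamma> ^ (2 * K)) \<le> 1 - 1 / M"
      using gam a[of 0] by (simp add: field_simps)
    then have "M * (a i / (a 0 * \<gamma> ^ (2 * K))) \<le> M * (1 - 1 / M)" by (intro mult_left_mono) auto
    also have "\<dots> = real M - 1" using M by (simp add: right_diff_distrib)
    finally have "s i \<le> real M - 1" using sK[OF that] by linarith
    then have "real (g i) \<le> real M" using g(2)[OF that] by linarith
    then show ?thesis by simp
  qed (simp add: g0)
  have ratio: "(1 + \<beta>) * (a i' / g i') \<le> (1 - \<beta>)\<^sup>2 * (a i / g i)" if "i < i'" "i' \<le> K" for i i'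
  proof -
    have iK: "i \<le> K" using that by simp
    have "a i' / g i' \<le> a i' / s i'" using g[OF that(2)] s0[OF that(2)] a[of i'] that
      by (intro divide_left_mono) auto
    also have "\<dots> = a 0 / M * \<gamma> ^ (2 * i')" using a[of i'] a[of 0] that gam M by (simp add: s_def)
    also have "\<dots> \<le> a 0 / M * \<gamma> ^ (2 * i + 2)"
      using that gam a[of 0] by (intro mult_left_mono power_decreasing) auto
    also have "\<dots> = \<gamma> * (a i / (s i / \<gamma>))" using a[of i] a[of 0] iK gam M by (simp add: s_def power2_eq_square)
    also have "\<dots> \<le> \<gamma> * (a i / g i)"
      using g[OF iK] g_up[OF iK] s0[OF iK] a[of i] iK gam by (intro mult_left_mono divide_left_mono) auto
    finally have "(1 + \<beta>) * (a i' / g i') \<le> (1 + \<beta>) * (\<gamma> * (a i / g i))" using beta by (intro mult_left_mono) auto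
    also have "\<dots> = (1 - \<beta>)\<^sup>2 * (a i / g i)" using beta by (simp add: gamma)
    finally show ?thesis .
  qed
  \<comment> \<open>In the bound for b the additive 3 comes from phase 0, from rounding b, and from
    rounding the \<open>g i\<close>, which costs K/M <= 1. With the h levels below rung 0 this
    yields 4 h.\<close>
  define b where "b = nat \<lceil>(\<Sum>i\<le>K. real (g i)) / M\<rceil>"
  have "(\<Sum>i\<le>K. real (g i)) / M \<le> b" unfolding b_def by linarith
  then have "real (\<Sum>i\<le>K. g i) \<le> real (b * M)" using M by (simp add: pos_divide_le_eq)
  then have bM: "(\<Sum>i\<le>K. g i) \<le> b * M" by linarith
  have "0 \<le> (\<Sum>i\<le>K. real (g i)) / M" by (intro divide_nonneg_nonneg sum_nonneg) auto
  then have "real b \<le> (\<Sum>i\<le>K. real (g i)) / M + 1" unfolding b_def by linarith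
  also have "(\<Sum>i\<le>K. real (g i)) = M + (\<Sum>i=1..K. real (g i))"
  proof -
    have "{..K} = insert 0 {1..K}" by auto
    then show ?thesis by (simp add: g0)
  qed
  also have "(M + (\<Sum>i=1..K. real (g i))) / M + 1 = 2 + (\<Sum>i=1..K. real (g i)) / M" using M by (simp add: field_simps)
  also have "(\<Sum>i=1..K. real (g i)) \<le> (\<Sum>i=1..K. M * (a i / (a 0 * \<gamma> ^ (2 * K))) + 1)"
    using g(2) sK by (intro sum_mono) (smt (verit) atLeastAtMost_iff)
  also have "\<dots> = M * ((\<Sum>i=1..K. a i) / (a 0 * \<gamma> ^ (2 * K))) + K"
    by (simp add: sum.distrib sum_distrib_left sum_divide_distrib)
  finally have b: "real b \<le> 2 + (M * ((\<Sum>i=1..K. a i) / (a 0 * \<gamma> ^ (2 * K))) + K) / M"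
    using M by (simp add: divide_right_mono)
  have "(M * ((\<Sum>i=1..K. a i) / (a 0 * \<gamma> ^ (2 * K))) + K) / M = (\<Sum>i=1..K. a i) / (a 0 * \<gamma> ^ (2 * K)) + K / M"
    using M by (simp add: add_divide_distrib)
  moreover have "K / M \<le> 1" using M by simp
  ultimately have b3: "real b \<le> 3 + (\<Sum>i=1..K. a i) / (a 0 * \<gamma> ^ (2 * K))" using b by linarith
  have "h * (\<Sum>i=1..K. n choose rung r h i) \<le> (\<Sum>k\<in>{rung r h 0<..rung r h K}. n choose k)"
    by (rule rung_binomial_sum[OF r h])
  also have "\<dots> \<le> (\<Sum>k\<in>{rung r h 0..n}. n choose k)" using rn[of K] by (intro sum_mono2) auto
  finally have "2 * (h * (\<Sum>i=1..K. n choose rung r h i)) \<le> 2 ^ n"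
    using upper_binomial_sum[of n "rung r h 0"] r h by (simp add: rung_def)
  then have "real (2 * (h * (\<Sum>i=1..K. n choose rung r h i))) \<le> real (2 ^ n)" by (rule of_nat_mono)
  then have ha: "h * (\<Sum>i=1..K. a i) \<le> 2 ^ n / 2" by (simp add: a_def)
  have "real (h + b * h) = h + h * real b" by simp
  also have "\<dots> \<le> h + h * (3 + (\<Sum>i=1..K. a i) / (a 0 * \<gamma> ^ (2 * K)))"
    using b3 by (intro add_left_mono mult_left_mono) auto
  also have "\<dots> = 4 * h + (h * (\<Sum>i=1..K. a i)) / (a 0 * \<gamma> ^ (2 * K))" by (simp add: distrib_left)
  also have "\<dots> \<le> 4 * h + 2 ^ n / 2 / (a 0 * \<gamma> ^ (2 * K))"
    using ha a[of 0] gam by (intro add_left_mono divide_right_mono) auto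
  finally have total: "real (h + b * h) \<le> 4 * h + 2 ^ n / 2 / (\<gamma> ^ (2 * K) * (n choose rung r h 0))"
    by (simp add: a_def mult.commute)
  obtain base where base:
    "chain_map n r base"
    "\<And>z. card (fibre n r base (rung r h (Suc K)) z) \<le> h + b * h"
    by (rule ladder_exists[OF r h top beta M(1), of g q b])
      (use g(3) gM g0 ratio q bM crit1 crit2 in \<open>auto simp: a_def less_imp_le\<close>)
  have bd: "real (card (fibre n r base (rung r h (Suc K)) z))
      \<le> 4 * h + 2 ^ n / 2 / (\<gamma> ^ (2 * K) * (n choose rung r h 0))" for z
    using base(2)[of z] total by linarith
  from base(1) bd show ?thesis by (rule that)
qed

section \<open>Asymptotics\<close>

lemma wallis_product_central_binomial:
  "(\<Prod>k=1..m. (4 * real k ^ 2) / (4 * real k ^ 2 - 1)) * (2 * m + 1) = (4 ^ m / real ((2 * m) choose m))\<^sup>2"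
proof (induction m)
  case (Suc m)
  have "(m + 1) * ((2 * Suc m) choose Suc m) = 2 * (2 * m + 1) * ((2 * m) choose m)"
  proof -
    have "Suc m * (Suc (2 * m + 1) choose Suc m) = Suc (2 * m + 1) * ((2 * m + 1) choose m)"
      by (rule Suc_times_binomial)
    moreover have "(2 * m + 1) choose m = (2 * m + 1) choose Suc m"
      by (subst binomial_symmetric) auto
    moreover have "Suc m * ((2 * m + 1) choose Suc m) = (2 * m + 1) * ((2 * m) choose m)"
      using Suc_times_binomial[of m "2 * m"] by simp
    moreover have "(m + 1) * A = 2 * (2 * m + 1) * c"
      if "Suc m * A = Suc (2 * m + 1) * B" "B = B'" "Suc m * B' = (2 * m + 1) * c" for A B B' c :: nat
    proof -
      have "(m + 1) * A = 2 * (Suc m * B)" using that(1) by simp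
      then show ?thesis using that(2,3) by (simp only: mult.assoc)
    qed
    ultimately have "(m + 1) * (Suc (2 * m + 1) choose Suc m) = 2 * (2 * m + 1) * ((2 * m) choose m)" by blast
    then show ?thesis by simp
  qed
  then have "real (m + 1) * real ((2 * Suc m) choose Suc m) = real (2 * (2 * m + 1)) * real ((2 * m) choose m)"
    by (metis of_nat_mult)
  then have C: "real ((2 * Suc m) choose Suc m) = 2 * (2 * real m + 1) / (real m + 1) * real ((2 * m) choose m)"
    by (simp add: field_simps)
  define P where "P = (\<Prod>k=1..m. (4 * real k ^ 2) / (4 * real k ^ 2 - 1))"
  define c where "c = real ((2 * m) choose m)"
  have c: "c > 0" by (simp add: c_def)
  have "P * (2 * real m + 1) = (4 ^ m / c)\<^sup>2" using Suc unfolding P_def[symmetric] c_def by (simp add: add.commute)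
  moreover have "2 * real m + 1 \<noteq> 0" using of_nat_0_le_iff[of m, where 'a = real] by linarith
  ultimately have P: "P = (4 ^ m / c)\<^sup>2 / (2 * real m + 1)" by (metis nonzero_mult_div_cancel_right)
  have "(\<Prod>k=1..Suc m. (4 * real k ^ 2) / (4 * real k ^ 2 - 1)) * (2 * Suc m + 1)
      = P * ((4 * (real m + 1) ^ 2) / (4 * (real m + 1) ^ 2 - 1)) * (2 * real m + 3)"
    by (simp add: P_def add.commute)
  also have "4 * (real m + 1) ^ 2 - 1 = (2 * real m + 1) * (2 * real m + 3)"
    by (simp add: power2_eq_square algebra_simps)
  also have "P * ((4 * (real m + 1) ^ 2) / ((2 * real m + 1) * (2 * real m + 3))) * (2 * real m + 3)
      = P * (4 * (real m + 1) ^ 2) / (2 * real m + 1)"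
  proof -
    have "x * (y / (u * v)) * v = x * y / u" if "v \<noteq> 0" for x y u v :: real using that by simp
    moreover have "2 * real m + 3 \<noteq> 0" using of_nat_0_le_iff[of m, where 'a = real] by linarith
    ultimately show ?thesis by blast
  qed
  also have "\<dots> = (4 ^ Suc m / (2 * (2 * real m + 1) / (real m + 1) * c))\<^sup>2"
  proof -
    have "(f / c)\<^sup>2 / u * (4 * v\<^sup>2) / u = (4 * f / (2 * u / v * c))\<^sup>2" if "v \<noteq> 0" for f u v :: real
      using that by (cases "u = 0") (simp_all add: divide_simps power2_eq_square)
    moreover have "real m + 1 \<noteq> 0" using of_nat_0_le_iff[of m, where 'a = real] by linarith
    ultimately show ?thesis unfolding P power_Suc by blast
  qed
  finally show ?case using C by (simp add: c_def)
qed simp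

text \<open>Reduces odd n = 2m + 1 to n + 1: numerator and denominator both double, as C(2m + 2, m +
  1) = 2 C(2m + 1, m).\<close>

lemma central_binomial_power:
  "2 ^ n / real (n choose (n div 2)) = 4 ^ ((n + 1) div 2) / real ((2 * ((n + 1) div 2)) choose ((n + 1) div 2))"
proof (cases "even n")
  case True
  then obtain m where "n = 2 * m" by blast
  then show ?thesis by (simp add: power_mult)
next
  case False
  then obtain m where m: "n = 2 * m + 1" by (metis oddE)
  have "(2 * m + 2) choose (m + 1) = ((2 * m + 1) choose m) + ((2 * m + 1) choose (m + 1))"
    by simp
  also have "(2 * m + 1) choose (m + 1) = (2 * m + 1) choose m" by (subst binomial_symmetric) auto
  finally have *: "(2 * m + 2) choose (m + 1) = 2 * ((2 * m + 1) choose m)" by simp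
  have "(n + 1) div 2 = m + 1" "2 * ((n + 1) div 2) = 2 * m + 2" "n div 2 = m" using m by auto
  moreover have "2 ^ (2 * m + 1) / d = 4 ^ (m + 1) / (2 * d)" for d :: real by (simp add: power_mult)
  ultimately show ?thesis using * by (simp only: m of_nat_mult of_nat_numeral)
qed

lemma central_binomial_limit:
  "(\<lambda>n. 2 ^ n / (real (n choose (n div 2)) * sqrt n)) \<longlonglongrightarrow> sqrt (pi / 2)"
proof -
  define q where "q n = (n + 1) div 2" for n :: nat
  define P where "P m = (\<Prod>k=1..m. (4 * real k ^ 2) / (4 * real k ^ 2 - 1))" for m
  have eq: "2 ^ n / (real (n choose (n div 2)) * sqrt n) = sqrt (P (q n) * ((2 * q n + 1) / n))" if "n > 0" for n
  proof -
    have "(2 ^ n / (real (n choose (n div 2)) * sqrt n))\<^sup>2 = (2 ^ n / real (n choose (n div 2)))\<^sup>2 / n"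
      by (simp add: power_divide power_mult_distrib)
    also have "\<dots> = P (q n) * ((2 * q n + 1) / n)"
      unfolding central_binomial_power q_def[symmetric] P_def
      using wallis_product_central_binomial[of "q n"] by simp
    finally show ?thesis by (rule real_sqrt_unique[symmetric]) simp
  qed
  have "filterlim q at_top sequentially"
    unfolding filterlim_at_top
  proof
    fix Z
    show "\<forall>\<^sub>F n in sequentially. Z \<le> q n"
      using eventually_ge_at_top[of "2 * Z"] by eventually_elim (auto simp: q_def)
  qed
  then have 1: "(\<lambda>n. P (q n)) \<longlonglongrightarrow> pi / 2"
    using filterlim_compose[OF wallis] unfolding P_def by blast
  have 2: "(\<lambda>n. (2 * q n + 1) / n) \<longlonglongrightarrow> 1"
  proof (rule tendsto_sandwich)
    show "\<forall>\<^sub>F n in sequentially. (real n + 1) / n \<le> (2 * q n + 1) / n"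
    proof (rule always_eventually, rule allI)
      fix n
      have "n + 1 \<le> 2 * q n + 1" by (simp add: q_def)
      then have "real n + 1 \<le> 2 * q n + 1" by linarith
      then show "(real n + 1) / n \<le> (2 * q n + 1) / n" by (intro divide_right_mono) auto
    qed
    show "\<forall>\<^sub>F n in sequentially. (2 * q n + 1) / n \<le> (real n + 2) / n"
    proof (rule always_eventually, rule allI)
      fix n
      have "2 * q n + 1 \<le> n + 2" by (simp add: q_def)
      then have "2 * q n + 1 \<le> real n + 2" by linarith
      then show "(2 * q n + 1) / n \<le> (real n + 2) / n" by (intro divide_right_mono) auto
    qed
    show "(\<lambda>n. (real n + 1) / n) \<longlonglongrightarrow> 1" by real_asymp
    show "(\<lambda>n. (real n + 2) / n) \<longlonglongrightarrow> 1" by real_asymp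
  qed
  have "(\<lambda>n. sqrt (P (q n) * ((2 * q n + 1) / n))) \<longlonglongrightarrow> sqrt (pi / 2 * 1)"
    by (intro tendsto_intros 1 2)
  then have "(\<lambda>n. sqrt (P (q n) * ((2 * q n + 1) / n))) \<longlonglongrightarrow> sqrt (pi / 2)" by simp
  then show ?thesis
    by (rule Lim_transform_eventually)
      (use eq in \<open>auto intro!: eventually_mono[OF eventually_gt_at_top[of 0]]\<close>)
qed

lemma sqrt_half_pi: "sqrt (pi / 2) = 2 * sqrt (pi / 8)"
proof -
  have "sqrt (pi / 2) = sqrt (2\<^sup>2 * (pi / 8))" by simp
  also have "\<dots> = 2 * sqrt (pi / 8)" by (subst real_sqrt_mult) simp
  finally show ?thesis .
qed

section \<open>Ratios of binomial coefficients near the middle\<close>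

lemma binomial_step_eq:
  assumes "k < n" "n \<le> 2 * k + 1"
  shows "real (n choose Suc k) = (1 - real (2 * k + 1 - n) / real (k + 1)) * (n choose k)"
  using drop_times_binomial[OF assms] by (simp add: left_diff_distrib)

text \<open>One level up multiplies by 1 - (2j + 1 - n)/(j + 1). Below k' the numerator is at most u
  and j + 1 is at least n/2.\<close>

lemma binomial_lower:
  assumes n: "n \<le> 2 * k + 1" and k: "k \<le> k'" "k' \<le> n" and u: "2 * k' \<le> n + u" "2 * u \<le> n"
  shows "(1 - 2 * real u / n) ^ (k' - k) * (n choose k) \<le> n choose k'"
  using k(1) k(2) u(1)
proof (induction k' rule: dec_induct)
  case (step j)
  have n0: "0 < n" using step by linarith
  have w: "0 \<le> 1 - 2 * real u / n" using u(2) n0 by (simp add: field_simps)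
  have "(1 - 2 * real u / n) ^ (Suc j - k) * (n choose k) = (1 - 2 * real u / n) * ((1 - 2 * real u / n) ^ (j - k) * (n choose k))"
    using step by (simp add: Suc_diff_le)
  also have "\<dots> \<le> (1 - 2 * real u / n) * (n choose j)"
    using step w by (intro mult_left_mono) auto
  also have "\<dots> \<le> (1 - real (2 * j + 1 - n) / real (j + 1)) * (n choose j)"
  proof (rule mult_right_mono)
    have "real (2 * j + 1 - n) / real (j + 1) \<le> real u / (real n / 2)"
      using step n n0 by (intro frac_le) auto
    then show "1 - 2 * real u / n \<le> 1 - real (2 * j + 1 - n) / real (j + 1)" by (simp add: mult.commute)
  qed simp
  also have "\<dots> = real (n choose Suc j)" using step n by (intro binomial_step_eq[symmetric]) auto
  finally show ?case .
qed simp

lemma binomial_upper: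
  assumes n: "n + v \<le> 2 * k + 1" and k: "k \<le> k'" "k' \<le> n"
  shows "n choose k' \<le> (1 - real v / n) ^ (k' - k) * (n choose k)"
  using k(1) k(2)
proof (induction k' rule: dec_induct)
  case (step j)
  have n0: "0 < n" using step by linarith
  have w: "0 \<le> 1 - real v / n"
  proof -
    have "v \<le> n" using n step by linarith
    then show ?thesis using n0 by simp
  qed
  have "real (n choose Suc j) = (1 - real (2 * j + 1 - n) / real (j + 1)) * (n choose j)"
    using step n by (intro binomial_step_eq) auto
  also have "\<dots> \<le> (1 - real v / n) * (n choose j)"
  proof (rule mult_right_mono)
    have "real v / n \<le> real (2 * j + 1 - n) / real (j + 1)"
      using step n n0 by (intro frac_le) auto
    then show "1 - real (2 * j + 1 - n) / real (j + 1) \<le> 1 - real v / n" by simp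
  qed simp
  also have "\<dots> \<le> (1 - real v / n) * ((1 - real v / n) ^ (j - k) * (n choose k))"
    using step w by (intro mult_left_mono) auto
  also have "\<dots> = (1 - real v / n) ^ (Suc j - k) * (n choose k)" using step by (simp add: Suc_diff_le)
  finally show ?case .
qed simp

lemma middle_binomial:
  assumes "n \<le> 2 * r + 1" "2 * r \<le> n + 1"
  shows "n choose r = n choose (n div 2)"
proof -
  have "r = n div 2 \<or> (odd n \<and> r = Suc (n div 2))" using assms by presburger
  then show ?thesis using central_binomial_odd[of n] by auto
qed

text \<open>Allows the local lemma conditions to be checked at a lower bound c/sqrt n for \<theta>,
  where the decay exp (-c sqrt n/12) beats all polynomial factors.\<close>

lemma crit_mono:
  fixes t \<theta> x A :: real
  assumes "0 < t" "t \<le> \<theta>" "0 \<le> A" "0 \<le> x"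
  shows "A / \<theta> * exp (- \<theta> * x / 12) \<le> A / t * exp (- t * x / 12)"
proof (rule mult_mono)
  show "A / \<theta> \<le> A / t" using assms by (intro divide_left_mono) auto
  show "exp (- \<theta> * x / 12) \<le> exp (- t * x / 12)" using assms by (simp add: mult_right_mono)
qed (use assms in auto)

text \<open>Order of choices: \<delta> gives the phase height \<delta> sqrt n and the final error; K
  makes the ladder reach C sqrt n; q bounds level ratios over this height; \<beta> is so small that
  K phases lose at most a factor exp (-\<delta>^2/2); M is large in terms of K, q and \<gamma>. Then
  n tends to infinity.\<close>

lemma half_cover_asymptotic:
  fixes \<epsilon> C :: real
  assumes eps: "0 < \<epsilon>" and C: "0 < C"
  shows "\<forall>\<^sub>F n in sequentially. \<forall>r. n \<le> 2 * r + 1 \<longrightarrow> 2 * r \<le> n + 1 \<longrightarrow>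
    (\<exists>top base. chain_map n r base \<and> n / 2 + C * sqrt n \<le> real top \<and>
      (\<forall>z. card (fibre n r base top z) \<le> (sqrt (pi / 8) + \<epsilon>) * sqrt n))"
proof -
  have "\<forall>\<^sub>F d in at_right (0::real). 4 * d + exp (d\<^sup>2 / 2) / (1 - 5 * d\<^sup>2) * (sqrt (pi / 8) + d) < sqrt (pi / 8) + \<epsilon>"
  proof (rule order_tendstoD)
    have "((\<lambda>d. 4 * d + exp (d\<^sup>2 / 2) / (1 - 5 * d\<^sup>2) * (sqrt (pi / 8) + d)) \<longlongrightarrow>
        4 * 0 + exp (0\<^sup>2 / 2) / (1 - 5 * 0\<^sup>2) * (sqrt (pi / 8) + 0)) (at_right (0::real))"
      by (intro tendsto_intros) auto
    then show "((\<lambda>d. 4 * d + exp (d\<^sup>2 / 2) / (1 - 5 * d\<^sup>2) * (sqrt (pi / 8) + d)) \<longlongrightarrow> sqrt (pi / 8)) (at_right (0::real))"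
      by simp
    show "sqrt (pi / 8) < sqrt (pi / 8) + \<epsilon>" using eps by simp
  qed
  moreover have "\<forall>\<^sub>F d in at_right (0::real). d < 1 / 4" by real_asymp
  moreover have "\<forall>\<^sub>F d in at_right (0::real). 0 < d" by (simp add: eventually_at_right_less)
  ultimately have "\<forall>\<^sub>F d in at_right (0::real). 0 < d \<and> d < 1 / 4 \<and>
      4 * d + exp (d\<^sup>2 / 2) / (1 - 5 * d\<^sup>2) * (sqrt (pi / 8) + d) < sqrt (pi / 8) + \<epsilon>"
    by eventually_elim auto
  then obtain \<delta> where d: "0 < \<delta>" "\<delta> < 1 / 4"
    "4 * \<delta> + exp (\<delta>\<^sup>2 / 2) / (1 - 5 * \<delta>\<^sup>2) * (sqrt (pi / 8) + \<delta>) < sqrt (pi / 8) + \<epsilon>"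
    using eventually_happens'[OF trivial_limit_at_right_real] by blast
  define K where "K = nat \<lceil>(C + 1) / \<delta>\<rceil>"
  have K: "C + 1 \<le> (K + 2) * \<delta>"
  proof -
    have "(C + 1) / \<delta> \<le> K" unfolding K_def by linarith
    then have "C + 1 \<le> K * \<delta>" using d by (simp add: pos_divide_le_eq)
    then show ?thesis using d by (simp add: distrib_right)
  qed
  define w where "w = (K + 2) * \<delta>"
  have w: "0 < w" using d by (simp add: w_def)
  \<comment> \<open>Within the ladder each step loses a fraction of at most (4 w sqrt n + 4)/n, over
    at most w sqrt n steps, hence at most A in total. The 2 in q comes from
    \<open>one_minus_ge_exp\<close>.\<close>
  define A where "A = 4 * w\<^sup>2 + 4 * w"
  define q where "q = exp (- 2 * A)"
  have "0 \<le> A" using w by (simp add: A_def)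
  then have q: "0 < q" "q \<le> 1" by (auto simp: q_def)
  \<comment> \<open>This threshold is used twice, for \<gamma>^(2K) and for 1 - 1/M: their product
    exceeds exp (-\<delta>^2), which bounds the ratio of rung 1 to rung 0.\<close>
  have expd: "exp (- (\<delta>\<^sup>2 / 2)) < 1" using d by simp
  have "\<forall>\<^sub>F b in at_right (0::real). exp (- (\<delta>\<^sup>2 / 2)) < ((1 - b)\<^sup>2 / (1 + b)) ^ (2 * K)"
  proof (rule order_tendstoD)
    have "((\<lambda>b. ((1 - b)\<^sup>2 / (1 + b)) ^ (2 * K)) \<longlongrightarrow> ((1 - 0)\<^sup>2 / (1 + 0)) ^ (2 * K)) (at_right (0::real))"
      by (intro tendsto_intros) auto
    then show "((\<lambda>b. ((1 - b)\<^sup>2 / (1 + b)) ^ (2 * K)) \<longlongrightarrow> 1) (at_right (0::real))" by simp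
  qed (rule expd)
  moreover have "\<forall>\<^sub>F b in at_right (0::real). b < 1" by real_asymp
  moreover have "\<forall>\<^sub>F b in at_right (0::real). 0 < b" by (simp add: eventually_at_right_less)
  ultimately have "\<forall>\<^sub>F b in at_right (0::real). 0 < b \<and> b < 1 \<and> exp (- (\<delta>\<^sup>2 / 2)) < ((1 - b)\<^sup>2 / (1 + b)) ^ (2 * K)"
    by eventually_elim auto
  then obtain \<beta> where beta: "0 < \<beta>" "\<beta> < 1" "exp (- (\<delta>\<^sup>2 / 2)) < ((1 - \<beta>)\<^sup>2 / (1 + \<beta>)) ^ (2 * K)"
    using eventually_happens'[OF trivial_limit_at_right_real] by blast
  define \<gamma> where "\<gamma> = (1 - \<beta>)\<^sup>2 / (1 + \<beta>)"
  have gam: "0 < \<gamma>" "\<gamma> < 1"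
  proof -
    show "0 < \<gamma>" using beta by (simp add: \<gamma>_def)
    have "(1 - \<beta>)\<^sup>2 < 1" using beta by (simp add: power_less_one_iff abs_square_less_1)
    then show "\<gamma> < 1" using beta by (simp add: \<gamma>_def)
  qed
  have "\<forall>\<^sub>F M in sequentially. exp (- (\<delta>\<^sup>2 / 2)) < 1 - 1 / real M"
  proof (rule order_tendstoD)
    show "(\<lambda>M. 1 - 1 / real M) \<longlonglongrightarrow> 1" by real_asymp
  qed (rule expd)
  moreover have "\<forall>\<^sub>F M in sequentially. 1 / (q * (1 - \<gamma>)) \<le> real M"
    using eventually_ge_at_top[of "nat \<lceil>1 / (q * (1 - \<gamma>))\<rceil>"] by eventually_elim linarith
  ultimately have "\<forall>\<^sub>F M in sequentially. exp (- (\<delta>\<^sup>2 / 2)) < 1 - 1 / real M \<and> 1 / (q * (1 - \<gamma>)) \<le> real M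
      \<and> K \<le> M \<and> 0 < M"
    using eventually_ge_at_top[of K] eventually_gt_at_top[of 0] by eventually_elim auto
  then obtain M where M: "exp (- (\<delta>\<^sup>2 / 2)) < 1 - 1 / real M" "1 / (q * (1 - \<gamma>)) \<le> real M" "K \<le> M" "0 < M"
    using eventually_happens'[OF trivial_limit_sequentially] by blast
  have Mq: "1 \<le> M * (q * (1 - \<gamma>))" using M(2) q gam by (simp add: pos_divide_le_eq)
  \<comment> \<open>c1/sqrt n and c2/sqrt n are lower bounds for the rates in the two local lemma
    conditions, from h >= 3/4 \<delta> sqrt n.\<close>
  define c1 where "c1 = \<beta>\<^sup>2 * (3 / 4 * \<delta>) / 128"
  define c2 where "c2 = \<beta>\<^sup>2 / (4 * M) * ((1 - \<beta>) * (2 * (3 / 4 * \<delta>)))"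
  define \<theta>1 where "\<theta>1 = \<beta>\<^sup>2 / (4 * M) / 8"
  have c: "0 < c1" "0 < c2" "0 < \<theta>1" using d beta M by (auto simp: c1_def c2_def \<theta>1_def)
  have c2q: "0 < c2 * q" using c q by simp
  define K1 where "K1 = real (2 * K * K * M)"
  have K1: "0 \<le> K1" by (simp add: K1_def)
  have lim: "\<forall>\<^sub>F n in sequentially. 2 ^ n / (real (n choose (n div 2)) * sqrt n) < 2 * (sqrt (pi / 8) + \<delta>)"
    by (rule order_tendstoD[OF central_binomial_limit]) (use d sqrt_half_pi in simp)
  have ev1: "\<forall>\<^sub>F n in sequentially. 4 \<le> \<delta> * sqrt (real n)" using d by real_asymp
  have ev2: "\<forall>\<^sub>F n in sequentially. 3 * ((real n + 1) / 2 + w * sqrt n) \<le> 2 * real n" using w by real_asymp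
  have ev3: "\<forall>\<^sub>F n in sequentially. 2 \<le> \<beta> * (3 / 4 * (\<delta> * sqrt (real n)))"
    using d beta by real_asymp
  have ev4: "\<forall>\<^sub>F n in sequentially. 4 * (w * sqrt (real n)) + 4 \<le> real n / 2" using w by real_asymp
  have ev5: "\<forall>\<^sub>F n in sequentially. \<delta> * sqrt (real n) * (4 * (\<delta> * sqrt (real n)) + 4) \<le> 5 * \<delta>\<^sup>2 * n"
    using ev1
  proof eventually_elim
    case (elim n)
    have "\<delta> * sqrt n * 4 \<le> \<delta> * sqrt n * (\<delta> * sqrt n)" using elim d by (intro mult_left_mono) auto
    also have "\<dots> = \<delta>\<^sup>2 * (sqrt n * sqrt n)" by (simp add: power2_eq_square)
    also have "\<dots> = \<delta>\<^sup>2 * n" by simp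
    finally have "\<delta> * sqrt n * 4 \<le> \<delta>\<^sup>2 * n" .
    moreover have "\<delta> * sqrt n * (4 * (\<delta> * sqrt n)) = 4 * (\<delta>\<^sup>2 * (sqrt n * sqrt n))"
      by (simp only: power2_eq_square mult_ac)
    ultimately show ?case by (simp add: distrib_left)
  qed
  have ev7: "\<forall>\<^sub>F n in sequentially. (real K + 2) * 4 / (c1 / sqrt n) * exp (- (c1 / sqrt n) * real n / 12) \<le> (c1 / sqrt n) / 8"
    using c(1) by real_asymp
  have ev8: "\<forall>\<^sub>F n in sequentially. K1 * real n * (4 / q / (c2 / sqrt n) * exp (- (c2 / sqrt n) * real n / 12)) \<le> \<theta>1"
    using c(2,3) q(1) by real_asymp
  have ev10: "\<forall>\<^sub>F n in sequentially. real K + 3 \<le> sqrt (real n)" by real_asymp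
  show ?thesis
    using lim ev1 ev2 ev3 ev4 ev5 ev7 ev8 ev10 eventually_gt_at_top[of 0]
  proof eventually_elim
    case (elim n)
    define s where "s = sqrt (real n)"
    have s: "0 < s" "s * s = real n" "1 \<le> s" "s \<le> n" using elim(10) real_sqrt_le_iff[of "real n" "(real n)\<^sup>2"]
      by (auto simp: s_def power2_eq_square)
    define h where "h = nat \<lfloor>\<delta> * s\<rfloor>"
    have ds: "4 \<le> \<delta> * s" using elim(2) by (simp add: s_def)
    have h: "real h \<le> \<delta> * s" "\<delta> * s - 1 \<le> real h" using ds unfolding h_def by linarith+
    have h34: "3 / 4 * (\<delta> * s) \<le> real h" using h(2) ds by linarith
    have h0: "0 < h" using h34 ds by linarith
    show ?case
    proof (intro allI impI)
      fix r assume r: "n \<le> 2 * r + 1" "2 * r \<le> n + 1"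
      have Kh: "real ((K + 2) * h) \<le> w * s"
      proof -
        have "real ((K + 2) * h) = real (K + 2) * real h" by (rule of_nat_mult)
        also have "\<dots> \<le> real (K + 2) * (\<delta> * s)" using h(1) by (intro mult_left_mono) auto
        also have "\<dots> = w * s" by (simp add: w_def mult.assoc add.commute)
        finally show ?thesis .
      qed
      have top: "3 * rung r h (Suc K) \<le> 2 * n"
      proof -
        have "real r \<le> (real n + 1) / 2" using of_nat_mono[OF r(2), where 'a = real] by simp
        moreover have "real (rung r h (Suc K)) = real r + real ((K + 2) * h)" by (simp add: rung_def algebra_simps)
        ultimately have "real (rung r h (Suc K)) \<le> (real n + 1) / 2 + w * s" using Kh by (simp only: add_mono)
        then have "3 * real (rung r h (Suc K)) \<le> 3 * ((real n + 1) / 2 + w * s)" by (rule mult_left_mono) simp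
        also have "\<dots> \<le> 2 * real n" using elim(3) by (simp add: s_def)
        finally have "real (3 * rung r h (Suc K)) \<le> real (2 * n)" by simp
        then show ?thesis by (simp only: of_nat_le_iff)
      qed
      have rn: "rung r h i \<le> n" if "i \<le> Suc K" for i using rung_mono[OF that, of r h] top by linarith
      have lowK: "q * (n choose k) \<le> n choose k'" if k: "r \<le> k" "k \<le> k'" "k' \<le> rung r h K" for k k'
      proof -
        define u where "u = 2 * ((K + 2) * h) + 2"
        define x where "x = 2 * real u / n"
        have k'n: "k' \<le> n" using k rn[of K] by simp
        have u1: "2 * k' \<le> n + u" using k r by (simp add: u_def rung_def)
        have uw: "2 * real u \<le> 4 * (w * s) + 4" using Kh by (simp add: u_def)
        then have "2 * real u \<le> real n / 2" using elim(5) by (simp add: s_def)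
        then have u2: "2 * u \<le> n" "x \<le> 1 / 2" using elim(10) by (auto simp: x_def field_simps)
        have x0: "0 \<le> x" by (simp add: x_def)
        have kd: "real (k' - k) \<le> w * s"
        proof -
          have "k' - k \<le> (K + 2) * h" using k by (simp add: rung_def)
          then have "real (k' - k) \<le> real ((K + 2) * h)" by (rule of_nat_mono)
          then show ?thesis using Kh by linarith
        qed
        have "x * real (k' - k) \<le> (4 * (w * s) + 4) / n * (w * s)"
          unfolding x_def using uw kd s w by (intro mult_mono divide_right_mono) auto
        also have "\<dots> = 4 * w\<^sup>2 + 4 * w * s / n"
          using s(1) s(2)[symmetric] by (simp add: field_simps power2_eq_square)
        also have "\<dots> \<le> A" unfolding A_def using w s(4) elim(10)
          by (simp add: pos_divide_le_eq)
        finally have xA: "x * real (k' - k) \<le> A" .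
        have "q \<le> exp (- 2 * x) ^ (k' - k)"
          using xA by (simp add: q_def exp_of_nat_mult[symmetric] mult_ac)
        also have "\<dots> \<le> (1 - x) ^ (k' - k)" using x0 u2 by (intro power_mono one_minus_ge_exp) auto
        finally have "q * (n choose k) \<le> (1 - x) ^ (k' - k) * (n choose k)" by (rule mult_right_mono) simp
        also have "\<dots> \<le> n choose k'"
          unfolding x_def using k r k'n u1 u2 by (intro binomial_lower) auto
        finally show ?thesis .
      qed
      define a0 where "a0 = real (n choose rung r h 0)"
      define N where "N = real (n choose (n div 2))"
      have rung0: "rung r h 0 = r + h" by (simp add: rung_def)
      \<comment> \<open>Each of the h <= \<delta> sqrt n steps up from the middle loses about 4
        \<delta>/sqrt n at most; Bernoulli's inequality adds this up to 4 \<delta>^2, and additive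
        constants are absorbed in the fifth \<delta>^2.\<close>
      have a0: "(1 - 5 * \<delta>\<^sup>2) * N \<le> a0"
      proof -
        define u where "u = 2 * h + 1"
        define x where "x = 2 * real u / n"
        have w4: "4 * (\<delta> * s) + 4 \<le> real n / 2"
        proof -
          have "\<delta> * s \<le> w * s" using s d by (simp add: w_def)
          then show ?thesis using elim(5) by (simp add: s_def)
        qed
        have ux: "2 * real u \<le> 4 * (\<delta> * s) + 4" using h by (simp add: u_def)
        then have u2: "2 * u \<le> n" "x \<le> 1" using w4 elim(10) by (auto simp: x_def)
        have "real h * x \<le> \<delta> * s * ((4 * (\<delta> * s) + 4) / n)"
          unfolding x_def using h ux d s by (intro mult_mono divide_right_mono) auto
        also have "\<dots> \<le> 5 * \<delta>\<^sup>2" using elim(6) elim(10) by (simp add: s_def pos_divide_le_eq)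
        finally have "1 - 5 * \<delta>\<^sup>2 \<le> 1 + real h * (- x)" by simp
        also have "\<dots> \<le> (1 - x) ^ h" using Bernoulli_inequality[of "- x" h] u2 by simp
        finally have "(1 - 5 * \<delta>\<^sup>2) * (n choose r) \<le> (1 - x) ^ h * (n choose r)" by (rule mult_right_mono) simp
        also have "\<dots> \<le> n choose (r + h)"
          using binomial_lower[of n r "r + h" u] r rn[of 0] u2 by (simp add: rung0 u_def x_def)
        finally show ?thesis using middle_binomial[OF r] by (simp add: a0_def N_def rung0)
      qed
      have d5: "0 < 1 - 5 * \<delta>\<^sup>2"
      proof -
        have "\<delta> * \<delta> \<le> 1 / 4 * (1 / 4)" using d by (intro mult_mono) auto
        then show ?thesis by (simp add: power2_eq_square)
      qed
      have N0: "0 < N" by (simp add: N_def)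
      have a0pos: "0 < a0" using rn[of 0] by (simp add: a0_def)
      \<comment> \<open>Every step from rung 0 to rung 1 loses at least the fraction 2h/n, in total
        a factor exp (-2 h^2/n), and 2 h^2 >= \<delta>^2 n.\<close>
      have first: "(n choose rung r h 1) / (n choose rung r h 0) \<le> \<gamma> ^ (2 * K) * (1 - 1 / M)"
      proof -
        have "rung r h 1 \<le> n" using rn[of 1] by simp
        moreover have "rung r h 1 - rung r h 0 = h" by (simp add: rung_def)
        ultimately have "n choose rung r h 1 \<le> (1 - real (2 * h) / n) ^ h * a0"
          using r binomial_upper[of n "2 * h" "rung r h 0" "rung r h 1"] rung_mono[of 0 1 r h]
          by (simp add: a0_def rung0)
        then have "(n choose rung r h 1) / (n choose rung r h 0) \<le> (1 - real (2 * h) / n) ^ h"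
          using a0pos by (simp add: pos_divide_le_eq a0_def)
        also have "\<dots> \<le> exp (- (real (2 * h) / n)) ^ h"
        proof (rule power_mono)
          show "1 - real (2 * h) / n \<le> exp (- (real (2 * h) / n))"
            using exp_ge_add_one_self[of "- (real (2 * h) / n)"] by simp
          have "2 * h \<le> n" using top r(1) by (simp add: rung_def)
          then show "0 \<le> 1 - real (2 * h) / n" using elim(10) by simp
        qed
        also have "\<dots> = exp (- (2 * (real h * real h) / n))" by (simp add: exp_of_nat_mult[symmetric])
        also have "\<dots> \<le> exp (- \<delta>\<^sup>2)"
        proof -
          have "(3 / 4 * (\<delta> * s)) * (3 / 4 * (\<delta> * s)) \<le> real h * real h"
            using h34 ds by (intro mult_mono) auto
          moreover have "(3 / 4 * (\<delta> * s)) * (3 / 4 * (\<delta> * s)) = 9 / 16 * \<delta>\<^sup>2 * n"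
            using s(2) by (simp add: power2_eq_square mult_ac)
          moreover have "0 \<le> \<delta>\<^sup>2 * n" by simp
          ultimately have "\<delta>\<^sup>2 * n \<le> 2 * (real h * real h)" by linarith
          then show ?thesis using elim(10) by (simp add: pos_le_divide_eq)
        qed
        also have "\<dots> = exp (- (\<delta>\<^sup>2 / 2)) * exp (- (\<delta>\<^sup>2 / 2))" by (simp add: exp_add[symmetric])
        also have "\<dots> \<le> \<gamma> ^ (2 * K) * (1 - 1 / M)"
          using beta(3) M(1) gam by (intro mult_mono) (auto simp: \<gamma>_def[symmetric])
        finally show ?thesis .
      qed
      show "\<exists>top base. chain_map n r base \<and> n / 2 + C * sqrt n \<le> real top \<and>
        (\<forall>z. card (fibre n r base top z) \<le> (sqrt (pi / 8) + \<epsilon>) * sqrt n)"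
      proof (rule half_cover[OF r(1) h0 top beta(1,2) _ \<gamma>_def M(4,3) Mq first q])
        show "2 \<le> \<beta> * h"
        proof -
          have "2 \<le> \<beta> * (3 / 4 * (\<delta> * s))" using elim(4) by (simp add: s_def)
          also have "\<dots> \<le> \<beta> * h" using h34 beta by (intro mult_left_mono) auto
          finally show ?thesis .
        qed
        show "q * (n choose k) \<le> (n choose rung r h i)" if "rung r h 0 \<le> k" "k \<le> rung r h i" "i \<le> K" for k i
          using lowK[of k "rung r h i"] that rung_mono[of i K r h] by (simp add: rung0)
        have hs: "3 / 4 * \<delta> / s \<le> h / n"
        proof -
          have "3 / 4 * \<delta> / s = 3 / 4 * (\<delta> * s) / n" using s(1) unfolding s(2)[symmetric] by simp
          also have "\<dots> \<le> h / n" using h34 by (intro divide_right_mono) auto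
          finally show ?thesis .
        qed
        show "(K + 2) * (4 / (\<beta>\<^sup>2 * h / (128 * n)) * exp (- (\<beta>\<^sup>2 * h / (128 * n)) * n / 12)) \<le> \<beta>\<^sup>2 * h / (128 * n) / 8"
        proof -
          define \<theta> where "\<theta> = \<beta>\<^sup>2 * h / (128 * n)"
          have "c1 / s = \<beta>\<^sup>2 / 128 * (3 / 4 * \<delta> / s)" by (simp add: c1_def)
          also have "\<dots> \<le> \<beta>\<^sup>2 / 128 * (h / n)" using hs by (intro mult_left_mono) auto
          finally have t: "c1 / s \<le> \<theta>" by (simp add: \<theta>_def)
          have "(real K + 2) * 4 / \<theta> * exp (- \<theta> * n / 12) \<le> (real K + 2) * 4 / (c1 / s) * exp (- (c1 / s) * real n / 12)"
            using c(1) s(1) t by (intro crit_mono) auto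
          also have "\<dots> \<le> c1 / s / 8" using elim(7) by (simp add: s_def)
          also have "\<dots> \<le> \<theta> / 8" using t by simp
          finally have "(real K + 2) * 4 / \<theta> * exp (- \<theta> * n / 12) \<le> \<theta> / 8" .
          moreover have "real (K + 2) * (4 / \<theta> * e) = (real K + 2) * 4 / \<theta> * e" for e by (simp add: add.commute)
          ultimately show ?thesis unfolding \<theta>_def[symmetric] by (simp only:)
        qed
        show "2 * (K * h) * K * M * (4 / (\<beta>\<^sup>2 / (4 * M) * ((1 - \<beta>) * (2 * h / n)) * q) *
          exp (- (\<beta>\<^sup>2 / (4 * M) * ((1 - \<beta>) * (2 * h / n))) * n / 12)) \<le> \<beta>\<^sup>2 / (4 * M) / 8"
        proof -
          define \<theta> where "\<theta> = \<beta>\<^sup>2 / (4 * M) * ((1 - \<beta>) * (2 * h / n))"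
          have "c2 / s = \<beta>\<^sup>2 / (4 * M) * ((1 - \<beta>) * (2 * (3 / 4 * \<delta> / s)))" by (simp add: c2_def)
          also have "\<dots> \<le> \<beta>\<^sup>2 / (4 * M) * ((1 - \<beta>) * (2 * (h / n)))" using hs beta by (intro mult_left_mono) auto
          also have "\<dots> = \<theta>" by (simp add: \<theta>_def)
          finally have t: "c2 / s \<le> \<theta>" .
          have hn: "h \<le> n" using top by (simp add: rung_def)
          have "real (2 * (K * h) * K * M) * (4 / (\<theta> * q) * exp (- \<theta> * n / 12))
              \<le> K1 * real n * (4 / q / (c2 / s) * exp (- (c2 / s) * real n / 12))"
          proof (rule mult_mono)
            show "real (2 * (K * h) * K * M) \<le> K1 * real n"
              using mult_left_mono[OF of_nat_mono[OF hn, where 'a = real] K1] by (simp add: K1_def mult_ac)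
            have "4 / (\<theta> * q) * exp (- \<theta> * n / 12) = 4 / q / \<theta> * exp (- \<theta> * n / 12)" by (simp add: mult.commute)
            also have "\<dots> \<le> 4 / q / (c2 / s) * exp (- (c2 / s) * real n / 12)"
              using c(2) s(1) t q by (intro crit_mono) auto
            finally show "4 / (\<theta> * q) * exp (- \<theta> * n / 12) \<le> 4 / q / (c2 / s) * exp (- (c2 / s) * real n / 12)" .
            have "0 < \<theta>" using t c(2) s(1) by (smt (verit) divide_pos_pos)
            then show "0 \<le> 4 / (\<theta> * q) * exp (- \<theta> * n / 12)" using q by simp
          qed (use K1 in auto)
          also have "\<dots> \<le> \<theta>1" using elim(8) by (simp add: s_def)
          finally show ?thesis unfolding \<theta>_def[symmetric] \<theta>1_def .
        qed
      next
        fix base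
        assume base:
          "chain_map n r base"
          "\<And>z. real (card (fibre n r base (rung r h (Suc K)) z))
            \<le> 4 * h + 2 ^ n / 2 / (\<gamma> ^ (2 * K) * (n choose rung r h 0))"
        \<comment> \<open>Rounding h down costs at most K + 2 levels in total and r may lie 1/2
          below n/2; the summand 1 in C + 1 pays for both.\<close>
        have top_ge: "n / 2 + C * sqrt n \<le> real (rung r h (Suc K))"
        proof -
          have "real n / 2 - 1 / 2 \<le> real r" using of_nat_mono[OF r(1), where 'a = real] by simp
          moreover have "(C + 1) * s \<le> w * s" using K s by (simp add: w_def)
          moreover have "w * s - real (K + 2) \<le> real ((K + 2) * h)"
          proof -
            have "w * s - real (K + 2) = real (K + 2) * (\<delta> * s - 1)" by (simp add: w_def algebra_simps)
            also have "\<dots> \<le> real (K + 2) * real h" using h(2) by (intro mult_left_mono) auto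
            also have "\<dots> = real ((K + 2) * h)" by (rule of_nat_mult[symmetric])
            finally show ?thesis .
          qed
          moreover have "real K + 3 \<le> s" using elim(9) by (simp add: s_def)
          moreover have "real (rung r h (Suc K)) = real r + real ((K + 2) * h)" by (simp add: rung_def algebra_simps)
          ultimately show ?thesis by (simp add: s_def[symmetric] algebra_simps)
        qed
        have total: "4 * h + 2 ^ n / 2 / (\<gamma> ^ (2 * K) * (n choose rung r h 0)) \<le> (sqrt (pi / 8) + \<epsilon>) * s"
        proof -
          have "2 ^ n / (N * s) < 2 * (sqrt (pi / 8) + \<delta>)" using elim(1) by (simp only: N_def s_def)
          moreover have "x / 2 \<le> y" if "x < 2 * y" for x y :: real using that by simp
          ultimately have lim': "2 ^ n / (N * s) / 2 \<le> sqrt (pi / 8) + \<delta>" by blast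
          have "exp (- (\<delta>\<^sup>2 / 2)) * ((1 - 5 * \<delta>\<^sup>2) * N) \<le> \<gamma> ^ (2 * K) * a0"
            using beta(3) a0 N0 d5 gam by (intro mult_mono) (auto simp: \<gamma>_def[symmetric])
          then have "2 ^ n / 2 / (\<gamma> ^ (2 * K) * a0) \<le> 2 ^ n / 2 / (exp (- (\<delta>\<^sup>2 / 2)) * ((1 - 5 * \<delta>\<^sup>2) * N))"
            using N0 d5 gam(1) a0pos by (intro divide_left_mono mult_pos_pos) auto
          also have "\<dots> = exp (\<delta>\<^sup>2 / 2) / (1 - 5 * \<delta>\<^sup>2) * (2 ^ n / (N * s) / 2) * s"
            using s N0 d5 by (simp add: exp_minus field_simps)
          also have "\<dots> \<le> exp (\<delta>\<^sup>2 / 2) / (1 - 5 * \<delta>\<^sup>2) * (sqrt (pi / 8) + \<delta>) * s"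
            using lim' s d5 by (intro mult_right_mono mult_left_mono) auto
          finally have "4 * h + 2 ^ n / 2 / (\<gamma> ^ (2 * K) * a0)
              \<le> (4 * \<delta> + exp (\<delta>\<^sup>2 / 2) / (1 - 5 * \<delta>\<^sup>2) * (sqrt (pi / 8) + \<delta>)) * s"
            using h(1) by (simp add: distrib_right)
          also have "\<dots> \<le> (sqrt (pi / 8) + \<epsilon>) * s" using d(3) s by (intro mult_right_mono) auto
          finally show ?thesis by (simp add: a0_def)
        qed
        have "card (fibre n r base (rung r h (Suc K)) z) \<le> (sqrt (pi / 8) + \<epsilon>) * sqrt n" for z
          using base(2)[of z] total unfolding s_def by linarith
        then show ?thesis using base(1) top_ge by (intro exI[of _ "rung r h (Suc K)"] exI[of _ base]) auto
      qed
    qed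
  qed
qed

section \<open>The Sperner subgraph\<close>

text \<open>The j-th smallest element of S is at least a + j - 1, so the sum is at least 1 + 2 + ...
  + \<open>card S\<close>.\<close>

lemma square_card_le:
  fixes S :: "nat set" and a :: real
  assumes "finite S" "0 \<le> a" "\<And>k. k \<in> S \<Longrightarrow> a \<le> k"
  shows "(real (card S))\<^sup>2 \<le> 2 * (\<Sum>k\<in>S. real k - a + 1)"
  using assms(1,3)
proof (induction S rule: finite_linorder_max_induct)
  case (insert b S)
  have "insert b S \<subseteq> {nat \<lceil>a\<rceil>..b}"
  proof
    fix k assume "k \<in> insert b S"
    then have "a \<le> k" "k \<le> b" using insert by (auto intro: less_imp_le)
    then show "k \<in> {nat \<lceil>a\<rceil>..b}" by (simp add: ceiling_le_iff)
  qed
  then have "card (insert b S) \<le> card {nat \<lceil>a\<rceil>..b}" by (intro card_mono) auto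
  moreover have "nat \<lceil>a\<rceil> \<le> b" using insert.prems[of b] by (simp add: ceiling_le_iff)
  ultimately have "card (insert b S) + nat \<lceil>a\<rceil> \<le> b + 1"
    unfolding card_atLeastAtMost by linarith
  then have "real (card (insert b S) + nat \<lceil>a\<rceil>) \<le> real (b + 1)" by (rule of_nat_mono)
  then have "real (card (insert b S)) \<le> real b - real (nat \<lceil>a\<rceil>) + 1" by simp
  moreover have "a \<le> real (nat \<lceil>a\<rceil>)" by linarith
  moreover have bS: "b \<notin> S" using insert by auto
  ultimately have c: "real (card S) + 1 \<le> real b - a + 1" using insert by simp
  have "(real (card (insert b S)))\<^sup>2 = (real (card S))\<^sup>2 + 2 * real (card S) + 1"
    using insert bS by (simp add: power2_eq_square algebra_simps)
  also have "\<dots> \<le> 2 * (\<Sum>k\<in>S. real k - a + 1) + 2 * (real b - a + 1)"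
    using insert.IH insert.prems c by fastforce
  also have "\<dots> = 2 * (\<Sum>k\<in>insert b S. real k - a + 1)" using insert bS by simp
  finally show ?case .
qed simp

text \<open>A distance of at least d is at most its square divided by d. This turns the linear bound
  into squared deviations and gains the factor 1/d that makes the tails negligible.\<close>

lemma square_card_chain_le:
  fixes f :: "'a \<Rightarrow> nat" and c d :: real
  assumes fin: "finite S" and inj: "inj_on f S" and c: "0 \<le> c" and d: "1 \<le> d"
    and S: "\<And>x. x \<in> S \<Longrightarrow> d \<le> real (f x) - c"
  shows "(real (card S))\<^sup>2 \<le> 2 / d * (\<Sum>x\<in>S. (real (f x) - c)\<^sup>2)"
proof -
  have "(real (card S))\<^sup>2 = (real (card (f ` S)))\<^sup>2" using card_image[OF inj] by simp
  also have "\<dots> \<le> 2 * (\<Sum>k\<in>f ` S. real k - (c + d) + 1)"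
    using fin c d S by (intro square_card_le) (auto simp: algebra_simps)
  also have "\<dots> = 2 * (\<Sum>x\<in>S. real (f x) - (c + d) + 1)" using sum.reindex[OF inj] by simp
  also have "\<dots> \<le> 2 * (\<Sum>x\<in>S. (real (f x) - c)\<^sup>2 / d)"
  proof (intro mult_left_mono sum_mono)
    fix x assume x: "x \<in> S"
    have "real (f x) - (c + d) + 1 \<le> real (f x) - c" using d by simp
    also have "\<dots> = d * (real (f x) - c) / d" using d by simp
    also have "\<dots> \<le> (real (f x) - c)\<^sup>2 / d"
      unfolding power2_eq_square using S[OF x] d by (intro divide_right_mono mult_right_mono) auto
    finally show "real (f x) - (c + d) + 1 \<le> (real (f x) - c)\<^sup>2 / d" .
  qed simp
  also have "\<dots> = 2 / d * (\<Sum>x\<in>S. (real (f x) - c)\<^sup>2)" by (simp add: sum_divide_distrib[symmetric])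
  finally show ?thesis .
qed

text \<open>Only the central part of every chain is controlled; the tails contribute little because
  a chain meets every level at most once, so that its squared tail length is dominated by
  the squared deviations of its members from the middle level.\<close>

lemma sum_fibre_card_le:
  fixes cid :: "nat set \<Rightarrow> 'b" and B d :: real
  assumes chain: "\<And>x y. x \<subseteq> {1..n} \<Longrightarrow> y \<subseteq> {1..n} \<Longrightarrow> cid x = cid y \<Longrightarrow> x \<subseteq> y \<or> y \<subseteq> x"
    and d: "1 \<le> d" and B: "0 \<le> B"
    and central: "\<And>z. card {x. x \<subseteq> {1..n} \<and> \<bar>real (card x) - n / 2\<bar> < d \<and> cid x = z} \<le> B"
  shows "(\<Sum>x\<in>Pow {1..n}. real (card {y. y \<subseteq> {1..n} \<and> cid y = cid x}))
    \<le> 2 ^ n * (B + B * n / (4 * d\<^sup>2) + n / d)"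
proof -
  define F where "F z = {y. y \<subseteq> {1..n} \<and> cid y = z}" for z
  define dev where "dev x = (real (card x) - n / 2)\<^sup>2" for x :: "nat set"
  define T where "T z = {y\<in>F z. d \<le> \<bar>real (card y) - n / 2\<bar>}" for z
  define t where "t z = real (card (T z))" for z
  define Z where "Z = cid ` Pow {1..n}"
  have finF: "finite (F z)" for z by (rule finite_subset[of _ "Pow {1..n}"]) (auto simp: F_def)
  have finT: "finite (T z)" for z using finF by (simp add: T_def)
  have group: "(\<Sum>z\<in>Z. \<Sum>x\<in>F z. g x) = (\<Sum>x\<in>Pow {1..n}. g x)" for g :: "nat set \<Rightarrow> real"
  proof -
    have "F z = {x\<in>Pow {1..n}. cid x = z}" for z by (auto simp: F_def)
    then show ?thesis using sum.group[of "Pow {1..n}" Z cid g] by (simp add: Z_def)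
  qed
  have sdev: "(\<Sum>x\<in>Pow {1..n}. dev x) = 2 ^ n * n / 4"
    using sum_sq_dev[of "{1..n}"] by (simp add: dev_def)
  have Fle: "real (card (F z)) \<le> B + t z" for z
  proof -
    have "F z = {x. x \<subseteq> {1..n} \<and> \<bar>real (card x) - n / 2\<bar> < d \<and> cid x = z} \<union> T z" (is "_ = ?A \<union> _")
      by (auto simp: F_def T_def)
    then have "card (F z) \<le> card ?A + card (T z)" using card_Un_le[of ?A "T z"] by simp
    then show ?thesis using central[of z] by (simp add: t_def)
  qed
  have inj: "inj_on card (F z)" for z
  proof (rule inj_onI)
    fix x y assume xy: "x \<in> F z" "y \<in> F z" "card x = card y"
    then have "finite x" "finite y" by (auto simp: F_def intro: finite_subset)
    moreover have "x \<subseteq> y \<or> y \<subseteq> x" using xy chain by (auto simp: F_def)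
    ultimately show "x = y" using xy(3) card_subset_eq by metis
  qed
  \<comment> \<open>The upper tail P is treated directly, the lower tail Q after replacing each size
    by its reflection n - \<open>card x\<close>.\<close>
  have tsq: "(t z)\<^sup>2 \<le> 4 / d * (\<Sum>x\<in>F z. dev x)" for z
  proof -
    define P where "P = {y\<in>F z. d \<le> real (card y) - n / 2}"
    define Q where "Q = {y\<in>F z. d \<le> n / 2 - real (card y)}"
    have fin: "finite P" "finite Q" using finF by (auto simp: P_def Q_def)
    have cn: "card y \<le> n" if "y \<in> F z" for y using that card_mono[of "{1..n}" y] by (simp add: F_def)
    have "T z \<subseteq> P \<union> Q" by (auto simp: T_def P_def Q_def abs_if split: if_splits)
    then have "card (T z) \<le> card (P \<union> Q)" using fin by (intro card_mono) auto
    then have "card (T z) \<le> card P + card Q" using card_Un_le[of P Q] by linarith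
    then have "t z \<le> real (card P) + real (card Q)" by (simp add: t_def)
    then have "(t z)\<^sup>2 \<le> (real (card P) + real (card Q))\<^sup>2" by (intro power_mono) (auto simp: t_def)
    also have "\<dots> \<le> 2 * (real (card P))\<^sup>2 + 2 * (real (card Q))\<^sup>2"
      using sum_squares_bound[of "real (card P)" "real (card Q)"] by (simp add: power2_sum)
    also have "(real (card P))\<^sup>2 \<le> 2 / d * (\<Sum>x\<in>P. dev x)"
      unfolding dev_def using fin d inj[of z]
      by (intro square_card_chain_le) (auto simp: P_def intro: inj_on_subset)
    also have "(real (card Q))\<^sup>2 \<le> 2 / d * (\<Sum>x\<in>Q. (real (n - card x) - n / 2)\<^sup>2)"
    proof (rule square_card_chain_le)
      show "inj_on (\<lambda>x. n - card x) Q"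
      proof (rule inj_onI)
        fix x y assume xy: "x \<in> Q" "y \<in> Q" "n - card x = n - card y"
        then have "card x = card y" using cn[of x] cn[of y] by (simp add: Q_def)
        then show "x = y" using inj[of z] xy by (auto simp: Q_def inj_on_def)
      qed
      show "d \<le> real (n - card x) - n / 2" if "x \<in> Q" for x
        using that cn[of x] by (simp add: Q_def of_nat_diff)
    qed (use fin d in auto)
    also have "(\<Sum>x\<in>Q. (real (n - card x) - n / 2)\<^sup>2) = (\<Sum>x\<in>Q. dev x)"
    proof (rule sum.cong[OF refl])
      fix x assume "x \<in> Q"
      then have "real (n - card x) - n / 2 = - (real (card x) - n / 2)"
        using cn[of x] by (simp add: Q_def of_nat_diff)
      then show "(real (n - card x) - n / 2)\<^sup>2 = dev x" by (simp only: dev_def power2_minus)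
    qed
    finally have "(t z)\<^sup>2 \<le> 4 / d * ((\<Sum>x\<in>P. dev x) + (\<Sum>x\<in>Q. dev x))"
      by (simp add: distrib_left)
    also have "(\<Sum>x\<in>P. dev x) + (\<Sum>x\<in>Q. dev x) = (\<Sum>x\<in>P \<union> Q. dev x)"
      using fin d by (intro sum.union_disjoint[symmetric]) (auto simp: P_def Q_def)
    also have "4 / d * (\<Sum>x\<in>P \<union> Q. dev x) \<le> 4 / d * (\<Sum>x\<in>F z. dev x)"
      using finF d by (intro mult_left_mono sum_mono2) (auto simp: P_def Q_def dev_def)
    finally show ?thesis .
  qed
  have tle: "t z \<le> (\<Sum>x\<in>F z. dev x) / d\<^sup>2" for z
  proof -
    have "t z = (\<Sum>x\<in>T z. 1)" by (simp add: t_def)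
    also have "\<dots> \<le> (\<Sum>x\<in>T z. dev x / d\<^sup>2)"
    proof (rule sum_mono)
      fix x assume "x \<in> T z"
      then have "d \<le> \<bar>real (card x) - n / 2\<bar>" by (simp add: T_def)
      then have "d\<^sup>2 \<le> dev x" unfolding dev_def using d power_mono[of d "\<bar>real (card x) - n / 2\<bar>" 2] by simp
      then show "1 \<le> dev x / d\<^sup>2" using d by (simp add: le_divide_eq)
    qed
    also have "\<dots> \<le> (\<Sum>x\<in>F z. dev x / d\<^sup>2)" using finF by (intro sum_mono2) (auto simp: T_def dev_def)
    finally show ?thesis by (simp add: sum_divide_distrib)
  qed
  have "(\<Sum>x\<in>Pow {1..n}. real (card (F (cid x)))) \<le> (\<Sum>x\<in>Pow {1..n}. B + t (cid x))"
    by (intro sum_mono Fle)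
  also have "\<dots> = B * 2 ^ n + (\<Sum>z\<in>Z. \<Sum>x\<in>F z. t (cid x))"
    unfolding group by (simp add: sum.distrib card_Pow)
  also have "(\<Sum>z\<in>Z. \<Sum>x\<in>F z. t (cid x)) = (\<Sum>z\<in>Z. real (card (F z)) * t z)"
  proof (rule sum.cong[OF refl])
    fix z
    have "(\<Sum>x\<in>F z. t (cid x)) = (\<Sum>x\<in>F z. t z)" by (rule sum.cong) (auto simp: F_def)
    then show "(\<Sum>x\<in>F z. t (cid x)) = real (card (F z)) * t z" by simp
  qed
  \<comment> \<open>From |F| t <= (B + t) t: the part B t is bounded in Chebyshev's way by
    \<open>tle\<close>, the part t^2 by \<open>tsq\<close>. Summing over the chains restores the
    total variance.\<close>
  also have "\<dots> \<le> (\<Sum>z\<in>Z. B * ((\<Sum>x\<in>F z. dev x) / d\<^sup>2) + 4 / d * (\<Sum>x\<in>F z. dev x))"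
  proof (rule sum_mono)
    fix z
    have "real (card (F z)) * t z \<le> (B + t z) * t z" using Fle by (intro mult_right_mono) (auto simp: t_def)
    also have "\<dots> = B * t z + (t z)\<^sup>2" by (simp add: power2_eq_square distrib_right)
    also have "\<dots> \<le> B * ((\<Sum>x\<in>F z. dev x) / d\<^sup>2) + 4 / d * (\<Sum>x\<in>F z. dev x)"
      using tle tsq B by (intro add_mono mult_left_mono) auto
    finally show "real (card (F z)) * t z \<le> B * ((\<Sum>x\<in>F z. dev x) / d\<^sup>2) + 4 / d * (\<Sum>x\<in>F z. dev x)" .
  qed
  also have "\<dots> = B / d\<^sup>2 * (\<Sum>z\<in>Z. \<Sum>x\<in>F z. dev x) + 4 / d * (\<Sum>z\<in>Z. \<Sum>x\<in>F z. dev x)"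
    by (simp add: sum.distrib sum_distrib_left sum_divide_distrib)
  also have "(\<Sum>z\<in>Z. \<Sum>x\<in>F z. dev x) = 2 ^ n * n / 4" unfolding group by (rule sdev)
  finally show ?thesis unfolding F_def using d by (simp add: algebra_simps)
qed

text \<open>The graph is a disjoint union of cliques, one per chain. An independent set has at most
  one element in each, and the chains are indexed by the middle level. A degree is bounded by the
  size of the chain, the set itself included.\<close>

lemma chain_graph:
  fixes cid :: "nat set \<Rightarrow> nat set"
  assumes cid: "\<And>x. x \<subseteq> {1..n} \<Longrightarrow> cid x \<in> level n (n div 2)"
    and chain: "\<And>x y. x \<subseteq> {1..n} \<Longrightarrow> y \<subseteq> {1..n} \<Longrightarrow> cid x = cid y \<Longrightarrow> x \<subseteq> y \<or> y \<subseteq> x"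
  shows "\<exists>G. sperner_subgraph n G \<and>
    2 * real (card (edges G)) \<le> (\<Sum>x\<in>Pow {1..n}. real (card {y. y \<subseteq> {1..n} \<and> cid y = cid x}))"
proof -
  define E where "E = {{x, y} | x y. x \<subseteq> {1..n} \<and> y \<subseteq> {1..n} \<and> x \<noteq> y \<and> cid x = cid y}"
  define G where "G = \<lparr>verts = Pow {1..n}, edges = E\<rparr>"
  have EP: "e \<subseteq> Pow {1..n}" if "e \<in> E" for e using that by (auto simp: E_def)
  have finE: "finite E" using EP by (intro finite_subset[of E "Pow (Pow {1..n})"]) auto
  have "E \<subseteq> edges (comparability_graph n)"
  proof
    fix e assume "e \<in> E"
    then obtain x y where "e = {x, y}" "x \<subseteq> {1..n}" "y \<subseteq> {1..n}" "x \<noteq> y" "cid x = cid y"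
      unfolding E_def by blast
    then show "e \<in> edges (comparability_graph n)"
      using chain[of x y] unfolding comparability_graph_def by auto
  qed
  then have "subgraph G (comparability_graph n)"
    using EP by (simp add: subgraph_def comparability_graph_def G_def)
  moreover have "card S \<le> n choose (n div 2)" if "independent_set G S" for S
  proof -
    have S: "S \<subseteq> Pow {1..n}" "\<And>x y. x \<in> S \<Longrightarrow> y \<in> S \<Longrightarrow> x \<noteq> y \<Longrightarrow> {x, y} \<notin> E"
      using that by (auto simp: independent_set_def G_def)
    have "inj_on cid S"
    proof (rule inj_onI, rule ccontr)
      fix x y assume xy: "x \<in> S" "y \<in> S" "cid x = cid y" "x \<noteq> y"
      then have "x \<subseteq> {1..n}" "y \<subseteq> {1..n}" using S(1) by blast+
      then have "{x, y} \<in> E" using xy unfolding E_def by blast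
      then show False using S(2) xy by blast
    qed
    then have "card S \<le> card (level n (n div 2))"
      using S(1) cid by (intro card_inj_on_le[where f = cid]) auto
    then show ?thesis by (simp add: card_level)
  qed
  ultimately have "sperner_subgraph n G" by (auto simp: sperner_subgraph_def G_def)
  moreover have "2 * real (card E) \<le> (\<Sum>x\<in>Pow {1..n}. real (card {y. y \<subseteq> {1..n} \<and> cid y = cid x}))"
  proof -
    have "2 * card E = (\<Sum>e\<in>E. card e)"
    proof -
      have "card e = 2" if "e \<in> E" for e using that by (auto simp: E_def card_2_iff)
      then show ?thesis by simp
    qed
    also have "\<dots> = (\<Sum>e\<in>E. \<Sum>x\<in>Pow {1..n}. if x \<in> e then 1 else 0)"
      using EP by (intro sum.cong refl) (auto simp: sum.If_cases Int_absorb1 Int_def[symmetric] Collect_mem_eq)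
    also have "\<dots> = (\<Sum>x\<in>Pow {1..n}. \<Sum>e\<in>E. if x \<in> e then 1 else 0)" by (rule sum.swap)
    also have "\<dots> = (\<Sum>x\<in>Pow {1..n}. card {e\<in>E. x \<in> e})"
      using finE by (simp add: sum.If_cases Int_def)
    also have "\<dots> \<le> (\<Sum>x\<in>Pow {1..n}. card {y. y \<subseteq> {1..n} \<and> cid y = cid x})"
    proof (rule sum_mono)
      fix x
      have fin: "finite {y. y \<subseteq> {1..n} \<and> cid y = cid x}"
        by (rule finite_subset[of _ "Pow {1..n}"]) auto
      have "{e\<in>E. x \<in> e} \<subseteq> (\<lambda>y. {x, y}) ` {y. y \<subseteq> {1..n} \<and> cid y = cid x}"
        by (auto simp: E_def insert_commute)
      then show "card {e\<in>E. x \<in> e} \<le> card {y. y \<subseteq> {1..n} \<and> cid y = cid x}"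
        using fin by (meson card_image_le card_mono finite_imageI order_trans)
    qed
    finally have "real (2 * card E) \<le> real (\<Sum>x\<in>Pow {1..n}. card {y. y \<subseteq> {1..n} \<and> cid y = cid x})"
      by (rule of_nat_mono)
    then show ?thesis by simp
  qed
  ultimately show ?thesis by (intro exI[of _ G]) (simp add: G_def)
qed

text \<open>Turan's bound gives 4^n/N - 2^n for twice the number of edges; divided by 2^n sqrt n,
  the subtracted term is 1/sqrt n and vanishes.\<close>

lemma sperner_subgraph_lower_bound:
  fixes \<epsilon> :: real
  assumes eps: "0 < \<epsilon>"
  shows "\<forall>\<^sub>F n in sequentially. \<forall>G. sperner_subgraph n G \<longrightarrow>
    (sqrt (pi / 8) - \<epsilon>) * (2 ^ n * sqrt n) \<le> card (edges G)"
proof -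
  have "(\<lambda>n. 2 ^ n / (real (n choose (n div 2)) * sqrt n) - 1 / sqrt n) \<longlonglongrightarrow> sqrt (pi / 2) - 0"
    by (intro tendsto_diff central_binomial_limit) real_asymp
  then have "\<forall>\<^sub>F n in sequentially. 2 * (sqrt (pi / 8) - \<epsilon>) < 2 ^ n / (real (n choose (n div 2)) * sqrt n) - 1 / sqrt n"
    by (rule order_tendstoD) (use eps sqrt_half_pi in simp)
  then show ?thesis
    using eventually_gt_at_top[of 0]
  proof eventually_elim
    case (elim n)
    define N where "N = n choose (n div 2)"
    have N: "0 < N" by (simp add: N_def)
    show ?case
    proof (intro allI impI)
      fix G assume G: "sperner_subgraph n G"
      have E: "e \<subseteq> Pow {1..n} \<and> card e = 2" if "e \<in> edges G" for e
      proof -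
        have "e \<in> edges (comparability_graph n)" using G that by (auto simp: sperner_subgraph_def subgraph_def)
        then show ?thesis by (auto simp: comparability_graph_def card_2_iff)
      qed
      have finE: "finite (edges G)"
        using E by (intro finite_subset[of "edges G" "Pow (Pow {1..n})"]) auto
      have "(real (card (Pow {1..n})))\<^sup>2 / N - card (Pow {1..n}) \<le> 2 * real (card (edges G))"
        using G by (intro turan_edge_bound E finE N)
          (auto simp: sperner_subgraph_def independent_set_def N_def)
      then have e: "(2 ^ n)\<^sup>2 / N - 2 ^ n \<le> 2 * real (card (edges G))" by (simp add: card_Pow)
      have s: "0 < sqrt n" using elim(2) by simp
      have "2 * (sqrt (pi / 8) - \<epsilon>) * (2 ^ n * sqrt n) \<le> (2 ^ n / (real N * sqrt n) - 1 / sqrt n) * (2 ^ n * sqrt n)"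
        using elim(1) by (intro mult_right_mono) (auto simp: N_def)
      also have "\<dots> = (2 ^ n)\<^sup>2 / N - 2 ^ n"
        using s N by (simp add: left_diff_distrib power2_eq_square)
      finally show "(sqrt (pi / 8) - \<epsilon>) * (2 ^ n * sqrt n) \<le> card (edges G)"
        using e unfolding mult.assoc by linarith
    qed
  qed
qed

text \<open>The lower half is the complement of a half cover starting at level n - r, whose
  complements form level r for odd n as well. Both maps fix level r, so sets from different halves
  of one chain are comparable through their common set on that level.\<close>

lemma glue_half_covers:
  fixes base1 base2 :: "nat set \<Rightarrow> nat set" and H d :: real and n top1 top2 :: nat
  defines "r \<equiv> n div 2"
  assumes up: "chain_map n r base1" "n / 2 + d \<le> real top1" "\<And>z. card (fibre n r base1 top1 z) \<le> H"
    and down: "chain_map n (n - r) base2" "n / 2 + d \<le> real top2"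
      "\<And>z. card (fibre n (n - r) base2 top2 z) \<le> H"
  shows "\<exists>cid. (\<forall>x. x \<subseteq> {1..n} \<longrightarrow> cid x \<in> level n r) \<and>
    (\<forall>x y. x \<subseteq> {1..n} \<longrightarrow> y \<subseteq> {1..n} \<longrightarrow> cid x = cid y \<longrightarrow> x \<subseteq> y \<or> y \<subseteq> x) \<and>
    (\<forall>z. card {x. x \<subseteq> {1..n} \<and> \<bar>real (card x) - n / 2\<bar> < d \<and> cid x = z} \<le> 2 * H)"
proof -
  define co where "co x = {1..n} - x" for x :: "nat set"
  have rn: "r \<le> n" by (simp add: r_def)
  note up1 = up(1)[unfolded chain_map_def, THEN conjunct1, rule_format]
    and up2 = up(1)[unfolded chain_map_def, THEN conjunct2, THEN conjunct1, rule_format]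
    and up3 = up(1)[unfolded chain_map_def, THEN conjunct2, THEN conjunct2, rule_format]
    and down1 = down(1)[unfolded chain_map_def, THEN conjunct1, rule_format]
    and down2 = down(1)[unfolded chain_map_def, THEN conjunct2, THEN conjunct1, rule_format]
    and down3 = down(1)[unfolded chain_map_def, THEN conjunct2, THEN conjunct2, rule_format]
  have co_sub: "co x \<subseteq> {1..n}" for x by (auto simp: co_def)
  have coco: "co (co x) = x" if "x \<subseteq> {1..n}" for x using that by (auto simp: co_def)
  have card_co: "card (co x) = n - card x" if "x \<subseteq> {1..n}" for x
    using that finite_subset[OF that] by (simp add: co_def card_Diff_subset)
  have le_n: "card x \<le> n" if "x \<subseteq> {1..n}" for x using that card_mono[of "{1..n}" x] by simp
  have co_mono: "co y \<subseteq> co x \<Longrightarrow> x \<subseteq> y" if "x \<subseteq> {1..n}" for x y using that by (auto simp: co_def)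
  define low where "low x = co (base2 (co x))" for x
  define cid where "cid x = (if r \<le> card x then base1 x else low x)" for x
  have b2: "base2 (co x) \<in> level n (n - r)" if "x \<subseteq> {1..n}" "card x \<le> r" for x
    using down1 co_sub[of x] card_co[OF that(1)] that by (simp add: diff_le_mono2)
  have low_level: "low x \<in> level n r" if "x \<subseteq> {1..n}" "card x \<le> r" for x
    using b2[OF that] co_sub[of "base2 (co x)"] card_co[of "base2 (co x)"] rn by (simp add: low_def level_def)
  have low_fix: "low x = x" if "x \<in> level n r" for x
  proof -
    have x: "x \<subseteq> {1..n}" "card x = r" using that by (auto simp: level_def)
    then have "co x \<in> level n (n - r)" using co_sub card_co[OF x(1)] by (simp add: level_def)
    then show ?thesis using down2 coco[OF x(1)] by (simp add: low_def)
  qed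
  have low_b2: "base2 (co x) = co (low x)" if "x \<subseteq> {1..n}" "card x \<le> r" for x
    using b2[OF that] coco[of "base2 (co x)"] by (simp add: low_def level_def)
  have low_chain: "x \<subseteq> y \<or> y \<subseteq> x"
    if "x \<subseteq> {1..n}" "card x \<le> r" "y \<subseteq> {1..n}" "card y \<le> r" "low x = low y" for x y
  proof -
    have "base2 (co x) = base2 (co y)" using low_b2 that by simp
    then have "co x \<subseteq> co y \<or> co y \<subseteq> co x"
      using down3 co_sub card_co that by (simp add: diff_le_mono2)
    then show ?thesis using co_mono that by blast
  qed
  have cid_level: "cid x \<in> level n r" if "x \<subseteq> {1..n}" for x
    using up1 low_level that by (auto simp: cid_def)
  have above: "cid x \<subseteq> x" if x: "x \<subseteq> {1..n}" "r \<le> card x" for x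
  proof -
    define z where "z = cid x"
    have z: "z \<in> level n r" using cid_level[OF x(1)] by (simp add: z_def)
    then have zz: "z \<subseteq> {1..n}" "card z = r" by (auto simp: level_def)
    have "base1 x = base1 z" using up2 z x by (simp add: z_def cid_def)
    then have "x \<subseteq> z \<or> z \<subseteq> x" using up3 x zz by blast
    then show ?thesis
    proof
      assume "x \<subseteq> z"
      then have "x = z" using zz x card_subset_eq[of z x] finite_subset[OF zz(1)] card_mono[of z x] by simp
      then show ?thesis by (simp add: z_def)
    qed (simp add: z_def)
  qed
  have below: "x \<subseteq> cid x" if x: "x \<subseteq> {1..n}" "card x < r" for x
  proof -
    define z where "z = cid x"
    have z: "z \<in> level n r" using cid_level[OF x(1)] by (simp add: z_def)
    then have zz: "z \<subseteq> {1..n}" "card z = r" by (auto simp: level_def)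
    have "low x = low z" using low_fix[OF z] x by (simp add: z_def cid_def)
    then have "x \<subseteq> z \<or> z \<subseteq> x" using low_chain[of x z] x zz by simp
    moreover have "\<not> z \<subseteq> x" using card_mono[of x z] finite_subset[OF x(1)] x zz by auto
    ultimately show ?thesis by (simp add: z_def)
  qed
  have chain: "x \<subseteq> y \<or> y \<subseteq> x" if xy: "x \<subseteq> {1..n}" "y \<subseteq> {1..n}" "cid x = cid y" for x y
  proof -
    consider "r \<le> card x" "r \<le> card y" | "card x < r" "card y < r"
      | "r \<le> card x" "card y < r" | "card x < r" "r \<le> card y" by linarith
    then show ?thesis
    proof cases
      case 1 then show ?thesis using up3 xy by (simp add: cid_def)
    next
      case 2 then show ?thesis using low_chain[of x y] xy by (simp add: cid_def)
    next
      case 3 then show ?thesis using above[of x] below[of y] xy by auto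
    next
      case 4 then show ?thesis using above[of y] below[of x] xy by auto
    qed
  qed
  have central: "card {x. x \<subseteq> {1..n} \<and> \<bar>real (card x) - n / 2\<bar> < d \<and> cid x = z} \<le> 2 * H" for z
  proof -
    define U where "U = fibre n r base1 top1 z"
    define D where "D = fibre n (n - r) base2 top2 (co z)"
    have fin: "finite U" "finite D" by (auto simp: U_def D_def fibre_def intro: finite_subset[of _ "Pow {1..n}"])
    have "{x. x \<subseteq> {1..n} \<and> \<bar>real (card x) - n / 2\<bar> < d \<and> cid x = z} \<subseteq> U \<union> co ` D"
    proof clarify
      fix x assume x: "x \<subseteq> {1..n}" "\<bar>real (card x) - n / 2\<bar> < d" "z = cid x" "x \<notin> co ` D"
      show "x \<in> U"
      proof (cases "r \<le> card x")
        case True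
        have "real (card x) < real top1" using x(2) up(2) by linarith
        then show ?thesis using x True by (simp add: U_def fibre_def cid_def)
      next
        case False
        have "real (n - card x) < real top2" using x(2) down(2) le_n[OF x(1)] by (simp add: of_nat_diff)
        then have "co x \<in> D"
          using x False co_sub[of x] card_co[OF x(1)] low_b2[OF x(1)] by (simp add: D_def fibre_def cid_def diff_le_mono2)
        then show ?thesis using x(4) coco[OF x(1)] by (metis imageI)
      qed
    qed
    then have "card {x. x \<subseteq> {1..n} \<and> \<bar>real (card x) - n / 2\<bar> < d \<and> cid x = z} \<le> card (U \<union> co ` D)"
      using fin by (intro card_mono) auto
    also have "\<dots> \<le> card U + card (co ` D)" by (rule card_Un_le)
    also have "\<dots> \<le> card U + card D" using card_image_le[OF fin(2), of co] by simp
    finally have "real (card {x. x \<subseteq> {1..n} \<and> \<bar>real (card x) - n / 2\<bar> < d \<and> cid x = z}) \<le> real (card U + card D)"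
      by (rule of_nat_mono)
    also have "\<dots> = real (card U) + real (card D)" by (rule of_nat_add)
    also have "\<dots> \<le> H + H" unfolding U_def D_def by (intro add_mono up(3) down(3))
    finally show ?thesis by simp
  qed
  show ?thesis using cid_level chain central by (intro exI[of _ cid]) blast
qed

text \<open>The half covers reach distance d = sqrt n/\<eta> from the middle, that is C = 1/\<eta>.
  The tail terms of \<open>sum_fibre_card_le\<close> are then B \<eta>^2/4 and \<eta> sqrt n, both
  small multiples of sqrt n.\<close>

lemma sperner_subgraph_upper_bound:
  fixes \<epsilon> :: real
  assumes eps: "0 < \<epsilon>"
  shows "\<forall>\<^sub>F n in sequentially. \<exists>G. sperner_subgraph n G \<and>
    card (edges G) \<le> (sqrt (pi / 8) + \<epsilon>) * (2 ^ n * sqrt n)"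
proof -
  have "\<forall>\<^sub>F x in at_right (0::real). (sqrt (pi / 8) + x) * (1 + x\<^sup>2 / 4) + x / 2 < sqrt (pi / 8) + \<epsilon>"
  proof (rule order_tendstoD)
    have "((\<lambda>x. (sqrt (pi / 8) + x) * (1 + x\<^sup>2 / 4) + x / 2) \<longlongrightarrow>
        (sqrt (pi / 8) + 0) * (1 + 0\<^sup>2 / 4) + 0 / 2) (at_right (0::real))"
      by (intro tendsto_intros) auto
    then show "((\<lambda>x. (sqrt (pi / 8) + x) * (1 + x\<^sup>2 / 4) + x / 2) \<longlongrightarrow> sqrt (pi / 8)) (at_right (0::real))" by simp
  qed (use eps in simp)
  moreover have "\<forall>\<^sub>F x in at_right (0::real). 0 < x" by (simp add: eventually_at_right_less)
  ultimately have "\<forall>\<^sub>F x in at_right (0::real). 0 < x \<and> (sqrt (pi / 8) + x) * (1 + x\<^sup>2 / 4) + x / 2 < sqrt (pi / 8) + \<epsilon>"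
    by eventually_elim auto
  then obtain \<eta> where eta: "0 < \<eta>" "(sqrt (pi / 8) + \<eta>) * (1 + \<eta>\<^sup>2 / 4) + \<eta> / 2 < sqrt (pi / 8) + \<epsilon>"
    using eventually_happens'[OF trivial_limit_at_right_real] by blast
  have "\<forall>\<^sub>F n in sequentially. 1 \<le> 1 / \<eta> * sqrt (real n)" using eta(1) by real_asymp
  moreover have "0 < 1 / \<eta>" using eta(1) by simp
  note half_cover_asymptotic[OF eta(1) this]
  ultimately show ?thesis
    using eventually_gt_at_top[of 0]
  proof eventually_elim
    case (elim n)
    define s where "s = sqrt (real n)"
    define d where "d = 1 / \<eta> * s"
    define k where "k = sqrt (pi / 8)"
    have s: "0 < s" "s * s = real n" using elim by (auto simp: s_def)
    have d: "1 \<le> d" using elim(1) by (simp add: d_def s_def)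
    have "n \<le> 2 * (n div 2) + 1" "2 * (n div 2) \<le> n + 1" "n \<le> 2 * (n - n div 2) + 1" "2 * (n - n div 2) \<le> n + 1"
      by linarith+
    note halves = elim(2)[rule_format, OF this(1,2)] elim(2)[rule_format, OF this(3,4)]
    obtain top1 base1 where up: "chain_map n (n div 2) base1" "n / 2 + d \<le> real top1"
      "\<And>z. card (fibre n (n div 2) base1 top1 z) \<le> (k + \<eta>) * s"
      using halves(1) unfolding d_def s_def k_def by blast
    obtain top2 base2 where down: "chain_map n (n - n div 2) base2" "n / 2 + d \<le> real top2"
      "\<And>z. card (fibre n (n - n div 2) base2 top2 z) \<le> (k + \<eta>) * s"
      using halves(2) unfolding d_def s_def k_def by blast
    obtain cid where "\<forall>x. x \<subseteq> {1..n} \<longrightarrow> cid x \<in> level n (n div 2)"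
      "\<forall>x y. x \<subseteq> {1..n} \<longrightarrow> y \<subseteq> {1..n} \<longrightarrow> cid x = cid y \<longrightarrow> x \<subseteq> y \<or> y \<subseteq> x"
      "\<forall>z. card {x. x \<subseteq> {1..n} \<and> \<bar>real (card x) - n / 2\<bar> < d \<and> cid x = z} \<le> 2 * ((k + \<eta>) * s)"
      using glue_half_covers[OF up down] by (elim exE conjE) (rule that; assumption)
    note cid = this[rule_format]
    have "\<exists>G. sperner_subgraph n G \<and>
      2 * real (card (edges G)) \<le> (\<Sum>x\<in>Pow {1..n}. real (card {y. y \<subseteq> {1..n} \<and> cid y = cid x}))"
      by (rule chain_graph) (fact cid)+
    then obtain G where G: "sperner_subgraph n G"
      "2 * real (card (edges G)) \<le> (\<Sum>x\<in>Pow {1..n}. real (card {y. y \<subseteq> {1..n} \<and> cid y = cid x}))"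
      by (elim exE conjE) (rule that)
    have B: "0 \<le> 2 * ((k + \<eta>) * s)" using s eta by (simp add: k_def)
    note G(2)
    also have "(\<Sum>x\<in>Pow {1..n}. real (card {y. y \<subseteq> {1..n} \<and> cid y = cid x}))
        \<le> 2 ^ n * (2 * ((k + \<eta>) * s) + 2 * ((k + \<eta>) * s) * n / (4 * d\<^sup>2) + n / d)"
      by (rule sum_fibre_card_le[OF cid(2) d B cid(3)])
    also have "real n / d = \<eta> * s" using s eta unfolding d_def s(2)[symmetric] by simp
    also have "2 * ((k + \<eta>) * s) * n / (4 * d\<^sup>2) = 2 * ((k + \<eta>) * s) * (\<eta>\<^sup>2 / 4)"
      using s eta unfolding d_def s(2)[symmetric] by (simp add: power2_eq_square)
    also have "2 ^ n * (2 * ((k + \<eta>) * s) + 2 * ((k + \<eta>) * s) * (\<eta>\<^sup>2 / 4) + \<eta> * s)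
        = 2 * (((k + \<eta>) * (1 + \<eta>\<^sup>2 / 4) + \<eta> / 2) * (2 ^ n * s))" by (simp add: algebra_simps)
    finally have "real (card (edges G)) \<le> ((k + \<eta>) * (1 + \<eta>\<^sup>2 / 4) + \<eta> / 2) * (2 ^ n * s)" by simp
    also have "\<dots> \<le> (k + \<epsilon>) * (2 ^ n * s)" using eta(2) s by (intro mult_right_mono) (auto simp: k_def)
    finally show ?case using G(1) by (auto simp: k_def s_def)
  qed
qed

theorem theorem1p4:
  "\<exists>\<epsilon> :: nat \<Rightarrow> real. \<epsilon> \<in> o(\<lambda>_. 1) \<and>
     (\<forall>n G. min_sperner_subgraph n G \<longrightarrow>
        real (card (edges G)) = (sqrt (pi / 8) + \<epsilon> n) * 2 ^ n * sqrt (real n))"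
proof -
  \<comment> \<open>All minimisers for n have the same number of edges, so the choice is harmless
    and \<epsilon> depends on n alone; the default 0 covers any n without a minimiser.\<close>
  define e where "e n = real (card (edges (SOME G. min_sperner_subgraph n G)))" for n
  define \<epsilon> where "\<epsilon> n = (if \<exists>G. min_sperner_subgraph n G then e n / (2 ^ n * sqrt n) - sqrt (pi / 8) else 0)" for n
  have min: "sperner_subgraph n G \<and> (sperner_subgraph n G' \<longrightarrow> card (edges G) \<le> card (edges G'))"
    if "min_sperner_subgraph n G" for n G G'
    using that by (auto simp: min_sperner_subgraph_def is_arg_min_def not_less)
  have eq: "real (card (edges G)) = e n" if G: "min_sperner_subgraph n G" for n G
  proof -
    have "min_sperner_subgraph n (SOME G. min_sperner_subgraph n G)" using G by (rule someI)
    then have "card (edges G) = card (edges (SOME G. min_sperner_subgraph n G))"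
      using min G by (blast intro: le_antisym)
    then show ?thesis by (simp add: e_def)
  qed
  have "\<epsilon> \<longlonglongrightarrow> 0"
  proof (rule tendstoI)
    fix x :: real assume x: "0 < x"
    have x2: "0 < x / 2" using x by simp
    show "\<forall>\<^sub>F n in sequentially. dist (\<epsilon> n) 0 < x"
      using sperner_subgraph_lower_bound[OF x2] sperner_subgraph_upper_bound[OF x2] eventually_gt_at_top[of 0]
    proof eventually_elim
      case (elim n)
      show ?case
      proof (cases "\<exists>G. min_sperner_subgraph n G")
        case True
        then obtain G where G: "min_sperner_subgraph n G" by blast
        obtain G' where G': "sperner_subgraph n G'" "card (edges G') \<le> (sqrt (pi / 8) + x / 2) * (2 ^ n * sqrt n)"
          using elim(2) by blast
        have p: "0 < 2 ^ n * sqrt (real n)" using elim(3) by simp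
        have sG: "sperner_subgraph n G" "card (edges G) \<le> card (edges G')"
          using min[OF G] G'(1) by blast+
        have "e n \<le> (sqrt (pi / 8) + x / 2) * (2 ^ n * sqrt n)"
          using of_nat_mono[OF sG(2), where 'a = real] G'(2) eq[OF G] by linarith
        then have "e n / (2 ^ n * sqrt n) \<le> sqrt (pi / 8) + x / 2" using p by (simp only: pos_divide_le_eq)
        moreover have "(sqrt (pi / 8) - x / 2) * (2 ^ n * sqrt n) \<le> e n" using elim(1) sG(1) eq[OF G] by auto
        then have "sqrt (pi / 8) - x / 2 \<le> e n / (2 ^ n * sqrt n)" using p by (simp only: pos_le_divide_eq)
        moreover have "\<epsilon> n = e n / (2 ^ n * sqrt n) - sqrt (pi / 8)" using True by (simp add: \<epsilon>_def)
        ultimately show ?thesis using x unfolding dist_real_def by linarith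
      qed (use x in \<open>simp add: \<epsilon>_def\<close>)
    qed
  qed
  then have "\<epsilon> \<in> o(\<lambda>_. 1)" by (intro smalloI_tendsto) auto
  moreover have "real (card (edges G)) = (sqrt (pi / 8) + \<epsilon> n) * 2 ^ n * sqrt (real n)"
    if G: "min_sperner_subgraph n G" for n G
  proof (cases "n = 0")
    case True
    \<comment> \<open>For n = 0 the denominator of \<epsilon> vanishes, but so does the claimed
      value, and the cube with a single vertex has no edges.\<close>
    have "edges G \<subseteq> edges (comparability_graph 0)"
      using min[OF G] True by (simp add: sperner_subgraph_def subgraph_def)
    also have "edges (comparability_graph 0) = {}" by (auto simp: comparability_graph_def)
    finally show ?thesis using True by simp
  next
    case False
    have "\<epsilon> n = e n / (2 ^ n * sqrt n) - sqrt (pi / 8)" using G by (auto simp: \<epsilon>_def)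
    then show ?thesis using eq[OF G] False by simp
  qed
  ultimately show ?thesis by blast
qed

end
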